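(* Let $G_0$ and $G_1$ be graphs. The weak modular product $G_0 \nabla G_1$ is perfect if and only if there are $z\in\{0,1\}$, with $\overline{z}=1-z$, and $m,n,r,s\in\mathbb{N}$ such that at least one of the following holds: 1. $G_z$ is isomorphic to one of $K_1, K_2, E_2$ (and $G_{\overline{z}}$ is arbitrary); 2. $G_z \cong P_4$ and $G_{\overline{z}}$ is isomorphic to one of $K_{1,r}$, $K_r \uplus K_1$, $P_4$; 3. $G_z \cong C_5$ and $G_{\overline{z}}$ is isomorphic to one of $P_3$, $K_2 \uplus E_1$, $P_4$, $C_5$; 4. $G_z \cong K_r \uplus K_s$ and $G_{\overline{z}}$ is a disjoint union of stars and cliques; 5. $G_z \cong K_{m,n}$ and $G_{\overline{z}}$ is connected and ($P_4$, cricket, dart, hourglass)-free; 6. $G_z \cong K_n$ and $G_{\overline{z}}$ is (odd hole, paw)-free; 7. $G_z \cong E_n$ and $G_{\overline{z}}$ is (odd antihole, co-paw)-free; 8. $G_z$ and $G_{\overline{z}}$ are both complete multipartite; 9. $G_z$ and $G_{\overline{z}}$ are both disjoint unions of cliques; 10. $G_z \cong K_r \uplus K_s$ and $G_{\overline{z}} \cong K_{m,n}$.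
   Context: All graphs are finite and simple, and $\mathbb{N}$ denotes the positive integers. The weak modular product $G\nabla H$ of graphs $G,H$ has vertex set $V(G)\times V(H)$, and $\{(x,y),(x',y')\}$ is an edge iff either $\{x,x'\}\in E(G)$ and $\{y,y'\}\in E(H)$, or $\{x,x'\}\in E(\overline G)$ and $\{y,y'\}\in E(\overline H)$, where $\overline G$ is the complement of $G$ (so in either case $x\ne x'$ and $y\neq y'$). A graph is perfect if every induced subgraph has chromatic number equal to its clique number. $K_n, E_n, P_n, C_n$ are the complete graph, edgeless graph, path and cycle on $n$ vertices; $K_{m,n}$ is the complete bipartite graph with parts of sizes $m,n$; $\uplus$ is disjoint union. A star is a complete bipartite graph with at least one part of size one. A complete multipartite graph $K_{n_1,\dots,n_k}$ ($k\ge 2$) has vertex set partitioned into $k$ independent parts of sizes $n_1,\dots,n_k$ with all edges between different parts. A disjoint union of cliques (resp. of stars and cliques) is a graph each of whose connected components is a complete graph (resp. a star or a complete graph); it may have a single component. The paw is a triangle with one pendant vertex attached; the co-paw is its complement, $P_3\uplus E_1$. The cricket is a triangle with two pendant vertices attached to the same triangle vertex. The dart is the diamond ($K_4$ minus an edge) with a pendant vertex attached to one of its degree-3 vertices. The hourglass is two triangles sharing exactly one vertex. An odd hole is an induced cycle of odd length at least 5; an odd antihole is an induced subgraph that is the complement of a cycle of odd length at least 5. A graph is $(X_1,\dots,X_k)$-free if it contains none of $X_1,\dots,X_k$ as an induced subgraph. *)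

theory Defs
  imports Main "HOL-Library.Disjoint_Sets"
begin

section \<open>Finite simple graphs\<close>

text \<open>Edges are two-element sets of vertices. As usual, a graph has at least one vertex.\<close>

datatype 'a graph = Graph (verts: "'a set") (edges: "'a set set")

definition simple_graph :: "'a graph \<Rightarrow> bool" where
  "simple_graph G \<longleftrightarrow>
     finite (verts G) \<and> verts G \<noteq> {} \<and>
     edges G \<subseteq> {{x, y} | x y. x \<in> verts G \<and> y \<in> verts G \<and> x \<noteq> y}"

definition graph_complement :: "'a graph \<Rightarrow> 'a graph" where
  "graph_complement G =
     Graph (verts G) {{x, y} | x y. x \<in> verts G \<and> y \<in> verts G \<and> x \<noteq> y \<and> {x, y} \<notin> edges G}"

definition induced_graph :: "'a graph \<Rightarrow> 'a set \<Rightarrow> 'a graph" where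
  "induced_graph G S = Graph S {e \<in> edges G. e \<subseteq> S}"

definition graph_iso :: "'a graph \<Rightarrow> 'b graph \<Rightarrow> bool"  (infix "\<cong>" 50) where
  "G \<cong> H \<longleftrightarrow>
     (\<exists>f. bij_betw f (verts G) (verts H) \<and>
          (\<forall>x\<in>verts G. \<forall>y\<in>verts G. {x, y} \<in> edges G \<longleftrightarrow> {f x, f y} \<in> edges H))"

definition contains_induced :: "'a graph \<Rightarrow> 'b graph \<Rightarrow> bool" where
  "contains_induced G X \<longleftrightarrow> (\<exists>S\<subseteq>verts G. induced_graph G S \<cong> X)"


section \<open>Weak modular product and perfection\<close>

definition weak_modular_product :: "'a graph \<Rightarrow> 'b graph \<Rightarrow> ('a \<times> 'b) graph"  (infixl "\<nabla>" 70)
  where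
  "G \<nabla> H =
     Graph (verts G \<times> verts H)
       {{(x, y), (x', y')} | x y x' y'.
          {x, x'} \<in> edges G \<and> {y, y'} \<in> edges H \<or>
          {x, x'} \<in> edges (graph_complement G) \<and> {y, y'} \<in> edges (graph_complement H)}"

definition colourable :: "'a graph \<Rightarrow> nat \<Rightarrow> bool" where
  "colourable G k \<longleftrightarrow>
     (\<exists>c :: 'a \<Rightarrow> nat. (\<forall>x\<in>verts G. c x < k) \<and> (\<forall>x y. {x, y} \<in> edges G \<longrightarrow> c x \<noteq> c y))"

definition chromatic_number :: "'a graph \<Rightarrow> nat" where
  "chromatic_number G = (LEAST k. colourable G k)"

definition is_clique :: "'a graph \<Rightarrow> 'a set \<Rightarrow> bool" where
  "is_clique G C \<longleftrightarrow> C \<subseteq> verts G \<and> (\<forall>x\<in>C. \<forall>y\<in>C. x \<noteq> y \<longrightarrow> {x, y} \<in> edges G)"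

definition clique_number :: "'a graph \<Rightarrow> nat" where
  "clique_number G = Max (card ` {C. is_clique G C})"

definition perfect :: "'a graph \<Rightarrow> bool" where
  "perfect G \<longleftrightarrow>
     (\<forall>S\<subseteq>verts G. chromatic_number (induced_graph G S) = clique_number (induced_graph G S))"


section \<open>Connectedness and components\<close>

definition reachable :: "'a graph \<Rightarrow> ('a \<times> 'a) set" where
  "reachable G = {(x, y). {x, y} \<in> edges G}\<^sup>*"

definition connected_graph :: "'a graph \<Rightarrow> bool" where
  "connected_graph G \<longleftrightarrow> (\<forall>x\<in>verts G. \<forall>y\<in>verts G. (x, y) \<in> reachable G)"

definition components :: "'a graph \<Rightarrow> 'a graph set" where
  "components G = {induced_graph G {y \<in> verts G. (x, y) \<in> reachable G} | x. x \<in> verts G}"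


section \<open>Particular graphs\<close>

definition complete_graph :: "nat \<Rightarrow> nat graph" where
  "complete_graph n = Graph {..<n} {{i, j} | i j. i < n \<and> j < n \<and> i \<noteq> j}"

definition edgeless_graph :: "nat \<Rightarrow> nat graph" where
  "edgeless_graph n = Graph {..<n} {}"

definition path_graph :: "nat \<Rightarrow> nat graph" where
  "path_graph n = Graph {..<n} {{i, Suc i} | i. Suc i < n}"

text \<open>The following is the cycle on \<open>n\<close> vertices for \<open>n \<ge> 3\<close>.\<close>

definition cycle_graph :: "nat \<Rightarrow> nat graph" where
  "cycle_graph n = Graph {..<n} {{i, Suc i mod n} | i. i < n}"

definition complete_bipartite_graph :: "nat \<Rightarrow> nat \<Rightarrow> (nat + nat) graph" where
  "complete_bipartite_graph m n =
     Graph ({..<m} <+> {..<n}) {{Inl i, Inr j} | i j. i < m \<and> j < n}"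

definition disjoint_union :: "'a graph \<Rightarrow> 'b graph \<Rightarrow> ('a + 'b) graph"  (infixl "\<uplus>" 65) where
  "G \<uplus> H = Graph (verts G <+> verts H) ((`) Inl ` edges G \<union> (`) Inr ` edges H)"

definition paw :: "nat graph" where
  "paw = Graph {..<4} {{0, 1}, {0, 2}, {1, 2}, {0, 3}}"

definition co_paw :: "nat graph" where
  "co_paw = graph_complement paw"

definition cricket :: "nat graph" where
  "cricket = Graph {..<5} {{0, 1}, {0, 2}, {1, 2}, {0, 3}, {0, 4}}"

text \<open>In the dart, the vertices below 4 induce the diamond, with non-adjacent vertices 2 and 3.\<close>

definition dart :: "nat graph" where
  "dart = Graph {..<5} {{0, 1}, {0, 2}, {0, 3}, {1, 2}, {1, 3}, {0, 4}}"

definition hourglass :: "nat graph" where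
  "hourglass = Graph {..<5} {{0, 1}, {0, 2}, {1, 2}, {0, 3}, {0, 4}, {3, 4}}"


section \<open>Graph classes\<close>

definition is_complete :: "'a graph \<Rightarrow> bool" where
  "is_complete G \<longleftrightarrow> (\<exists>n\<ge>1. G \<cong> complete_graph n)"

definition is_star :: "'a graph \<Rightarrow> bool" where
  "is_star G \<longleftrightarrow> (\<exists>m\<ge>1. \<exists>n\<ge>1. (m = 1 \<or> n = 1) \<and> G \<cong> complete_bipartite_graph m n)"

definition union_of_cliques :: "'a graph \<Rightarrow> bool" where
  "union_of_cliques G \<longleftrightarrow> (\<forall>C\<in>components G. is_complete C)"

definition union_of_stars_and_cliques :: "'a graph \<Rightarrow> bool" where
  "union_of_stars_and_cliques G \<longleftrightarrow> (\<forall>C\<in>components G. is_star C \<or> is_complete C)"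

text \<open>The members of \<open>P\<close> are the parts; \<open>partition_on\<close> makes them nonempty.\<close>

definition complete_multipartite :: "'a graph \<Rightarrow> bool" where
  "complete_multipartite G \<longleftrightarrow>
     (\<exists>P. partition_on (verts G) P \<and> card P \<ge> 2 \<and>
          edges G = {{x, y} | x y. \<exists>A\<in>P. \<exists>B\<in>P. A \<noteq> B \<and> x \<in> A \<and> y \<in> B})"

definition odd_hole_free :: "'a graph \<Rightarrow> bool" where
  "odd_hole_free G \<longleftrightarrow> (\<forall>k\<ge>5. odd k \<longrightarrow> \<not> contains_induced G (cycle_graph k))"

definition odd_antihole_free :: "'a graph \<Rightarrow> bool" where
  "odd_antihole_free G \<longleftrightarrow>
     (\<forall>k\<ge>5. odd k \<longrightarrow> \<not> contains_induced G (graph_complement (cycle_graph k)))"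


section \<open>The list of pairs with perfect product\<close>

text \<open>
  Here \<open>G\<close> and \<open>H\<close> play the roles of $G_z$ and $G_{1-z}$. As the two graphs may have different
  vertex types, \<open>z\<close> cannot be a bound variable; it is eliminated by swapping the arguments.
\<close>

definition perfect_pair :: "'a graph \<Rightarrow> 'b graph \<Rightarrow> nat \<Rightarrow> nat \<Rightarrow> nat \<Rightarrow> nat \<Rightarrow> bool" where
  "perfect_pair G H m n r s \<longleftrightarrow>
     (G \<cong> complete_graph 1 \<or> G \<cong> complete_graph 2 \<or> G \<cong> edgeless_graph 2) \<or>
     (G \<cong> path_graph 4 \<and>
        (H \<cong> complete_bipartite_graph 1 r \<or> H \<cong> complete_graph r \<uplus> complete_graph 1 \<or>
         H \<cong> path_graph 4)) \<or>
     (G \<cong> cycle_graph 5 \<and>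
        (H \<cong> path_graph 3 \<or> H \<cong> complete_graph 2 \<uplus> edgeless_graph 1 \<or>
         H \<cong> path_graph 4 \<or> H \<cong> cycle_graph 5)) \<or>
     (G \<cong> complete_graph r \<uplus> complete_graph s \<and> union_of_stars_and_cliques H) \<or>
     (G \<cong> complete_bipartite_graph m n \<and> connected_graph H \<and>
        \<not> contains_induced H (path_graph 4) \<and> \<not> contains_induced H cricket \<and>
        \<not> contains_induced H dart \<and> \<not> contains_induced H hourglass) \<or>
     (G \<cong> complete_graph n \<and> odd_hole_free H \<and> \<not> contains_induced H paw) \<or>
     (G \<cong> edgeless_graph n \<and> odd_antihole_free H \<and> \<not> contains_induced H co_paw) \<or>
     (complete_multipartite G \<and> complete_multipartite H) \<or>
     (union_of_cliques G \<and> union_of_cliques H) \<or>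
     (G \<cong> complete_graph r \<uplus> complete_graph s \<and> H \<cong> complete_bipartite_graph m n)"

end

theory Submission
  imports Defs
begin

text \<open>
  Replacing both factors by their complements does not change the weak modular product, and swapping
  the factors gives an isomorphic graph. Hence every listed case has a dual, and on either side
  only one case of each dual pair needs an argument. Throughout, perfection means that
  every induced subgraph has a colouring with as many colours as one of its cliques has vertices;
  sufficiency is shown by giving such colourings, necessity by finding odd holes, which have none.

  \<^bold>\<open>The listed products are perfect.\<close> The product of two complete graphs is the complement of a
  rook's graph, and its perfection is Koenig's theorem on matchings and covers in bipartite graphs
  (\<open>perfect_rel_co_rook\<close>). The product of two disjoint unions of cliques arises from such a
  graph by substituting such graphs for its vertices, and substitution keeps perfection
  (\<open>perfect_rel_substitution\<close>, from Lovasz's replication argument in \<open>weighted_colouring\<close>). Dually,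
  products of complete multipartite graphs are perfect. If one factor is complete, then the product
  decomposes along the components of the other factor \<open>H\<close>. If \<open>H\<close> has neither an odd hole nor a
  paw, then each component is bipartite or complete multipartite (\<open>paw_free_component\<close>,
  \<open>odd_hole_free_component\<close>); it contributes a bipartite graph, or one that arises by
  substitution again. The product of two cycles of length five is the rook's graph
  of the five by five board, and rook's graphs are perfect by Koenig's theorem on edge colourings
  (\<open>perfect_rel_rook\<close>); the paths with three and four vertices and the complement of the former are
  induced subgraphs of the cycle. If one factor is a union of two cliques and the other a
  union of stars and cliques, then the vertices fall into two rows of blocks, with all edges
  between blocks of different rows and different columns; colourings of the blocks are combined in
  \<open>clique_colourable_crossed\<close>. The case of a complete bipartite factor is dual to this one, because
  the complement of a connected graph with the given forbidden subgraphs is a union of stars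
  and cliques (\<open>complement_union_of_stars_and_cliques\<close>). In the remaining cases the product is
  bipartite, or it can be coloured by hand (\<open>perfect_rel_P4_star\<close>).

  \<^bold>\<open>Perfect products are listed.\<close> Let the product be perfect and let \<open>H\<close> contain the
  complement of the path with three vertices. Holes of length five and seven then show that \<open>G\<close> has
  no induced paw, no induced diamond, no four-cycle with an isolated vertex, and no
  induced path with four vertices that a fifth vertex extends to anything but a five-cycle.
  Therefore \<open>G\<close> is a union of stars and cliques, complete bipartite, a path with four vertices or a
  five-cycle (\<open>factor_class\<close>). Dually, if \<open>G\<close> contains the path with three vertices, then the
  complement of \<open>H\<close> is of one of these kinds, and if both happen, comparing the two lists gives the
  cases of the theorem (\<open>listed_P3_coP3\<close>). If this happens in neither
  order of the factors, then some factor is complete or edgeless, or both are unions of cliques, or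
  both are complete multipartite. In the first of these situations the other factor is restricted
  because a triangle in one factor and a paw or an odd hole in the other give an odd hole in the
  product (\<open>triangle_paw_free\<close>, \<open>triangle_odd_hole_free\<close>).
\<close>

section \<open>Perfection of a relation on a finite set\<close>

definition clique_on :: "('a \<Rightarrow> 'a \<Rightarrow> bool) \<Rightarrow> 'a set \<Rightarrow> bool" where
  "clique_on R C \<longleftrightarrow> (\<forall>x\<in>C. \<forall>y\<in>C. x \<noteq> y \<longrightarrow> R x y)"

definition proper_colouring :: "('a \<Rightarrow> 'a \<Rightarrow> bool) \<Rightarrow> 'a set \<Rightarrow> nat \<Rightarrow> ('a \<Rightarrow> nat) \<Rightarrow> bool" where
  "proper_colouring R T k c \<longleftrightarrow>
     (\<forall>x\<in>T. c x < k) \<and> (\<forall>x\<in>T. \<forall>y\<in>T. R x y \<longrightarrow> c x \<noteq> c y)"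

text \<open>
  The witnessing pair \<open>C\<close>, \<open>c\<close> certifies at once that the clique number and the chromatic number
  of \<open>T\<close> are both \<open>card C\<close>; see \<open>clique_card_le_colours\<close>.
\<close>

definition clique_colourable :: "('a \<Rightarrow> 'a \<Rightarrow> bool) \<Rightarrow> 'a set \<Rightarrow> bool" where
  "clique_colourable R T \<longleftrightarrow> (\<exists>C\<subseteq>T. clique_on R C \<and> (\<exists>c. proper_colouring R T (card C) c))"

text \<open>
  Perfection of the graph that \<open>R\<close> induces on \<open>S\<close>. A loop would make colouring impossible, so
  \<open>R\<close> is then irreflexive on \<open>S\<close>.
\<close>

definition perfect_rel :: "('a \<Rightarrow> 'a \<Rightarrow> bool) \<Rightarrow> 'a set \<Rightarrow> bool" where
  "perfect_rel R S \<longleftrightarrow> finite S \<and> (\<forall>T\<subseteq>S. clique_colourable R T)"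

lemma clique_card_le_colours:
  assumes "proper_colouring R T k c" "C \<subseteq> T" "clique_on R C"
  shows "card C \<le> k"
proof -
  have "inj_on c C"
  proof (rule inj_onI, rule ccontr)
    fix x y assume "x \<in> C" "y \<in> C" "c x = c y" "x \<noteq> y"
    moreover from this have "R x y" using assms(3) unfolding clique_on_def by simp
    ultimately show False using assms(1,2) unfolding proper_colouring_def by (simp add: subset_iff)
  qed
  moreover have "c ` C \<subseteq> {..<k}"
    using assms unfolding proper_colouring_def by auto
  ultimately show ?thesis
    by (metis card_image card_lessThan card_mono finite_lessThan)
qed

lemma proper_colouring_mono:
  "proper_colouring R T k c \<Longrightarrow> k \<le> l \<Longrightarrow> proper_colouring R T l c"
  unfolding proper_colouring_def using less_le_trans by blast

lemma clique_colourableI: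
  assumes "C \<subseteq> T" "clique_on R C" "proper_colouring R T k c" "k \<le> card C"
  shows "clique_colourable R T"
  unfolding clique_colourable_def using assms(1,2) proper_colouring_mono[OF assms(3,4)] by auto

lemma perfect_relD: "perfect_rel R S \<Longrightarrow> T \<subseteq> S \<Longrightarrow> clique_colourable R T"
  by (simp add: perfect_rel_def)

lemma perfect_rel_finite: "perfect_rel R S \<Longrightarrow> finite S"
  by (simp add: perfect_rel_def)

lemma perfect_rel_subset: "perfect_rel R S \<Longrightarrow> T \<subseteq> S \<Longrightarrow> perfect_rel R T"
  unfolding perfect_rel_def by (auto intro: finite_subset)

lemma clique_colourable_irrefl:
  assumes "clique_colourable R T" "x \<in> T"
  shows "\<not> R x x"
proof -
  obtain k c where "proper_colouring R T k c"
    using assms(1) unfolding clique_colourable_def by auto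
  then show ?thesis using assms(2) unfolding proper_colouring_def by auto
qed

lemma perfect_rel_irrefl: "perfect_rel R S \<Longrightarrow> x \<in> S \<Longrightarrow> \<not> R x x"
  by (rule clique_colourable_irrefl[OF perfect_relD[OF _ order_refl]])

lemma perfect_rel_inj_image:
  assumes "perfect_rel R' S'" "inj_on f S" "f ` S \<subseteq> S'"
    and R: "\<And>x y. x \<in> S \<Longrightarrow> y \<in> S \<Longrightarrow> R x y \<longleftrightarrow> R' (f x) (f y)"
  shows "perfect_rel R S"
  unfolding perfect_rel_def
proof (intro conjI allI impI)
  show "finite S"
    using finite_subset[OF assms(3) perfect_rel_finite[OF assms(1)]] assms(2) by (rule finite_imageD)
next
  fix T assume T: "T \<subseteq> S"
  have inj: "inj_on f T"
    using assms(2) T by (rule inj_on_subset)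
  have TS: "x \<in> S" if "x \<in> T" for x using T that by blast
  have "f ` T \<subseteq> S'" using assms(3) T by blast
  with assms(1) have "clique_colourable R' (f ` T)" by (rule perfect_relD)
  then obtain C' c where C': "C' \<subseteq> f ` T" "clique_on R' C'" "proper_colouring R' (f ` T) (card C') c"
    unfolding clique_colourable_def by blast
  define C where "C = {x \<in> T. f x \<in> C'}"
  have CT: "C \<subseteq> T" unfolding C_def by blast
  have img: "f ` C = C'" using C'(1) unfolding C_def by auto
  have "inj_on f C" using inj CT by (rule inj_on_subset)
  then have card: "card C = card C'" using img card_image by metis
  have "clique_on R C"
    unfolding clique_on_def
  proof (intro ballI impI)
    fix x y assume xy: "x \<in> C" "y \<in> C" "x \<noteq> y"
    then have "f x \<noteq> f y" using inj_onD[OF inj] CT by blast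
    then show "R x y" using C'(2) xy R TS unfolding clique_on_def C_def by simp
  qed
  moreover have "proper_colouring R T (card C) (\<lambda>x. c (f x))"
    using C'(3) TS R unfolding proper_colouring_def card by simp
  ultimately show "clique_colourable R T"
    unfolding clique_colourable_def using CT by blast
qed

lemma perfect_rel_cong:
  assumes "perfect_rel R' S" "\<And>x y. x \<in> S \<Longrightarrow> y \<in> S \<Longrightarrow> R x y \<longleftrightarrow> R' x y"
  shows "perfect_rel R S"
  by (rule perfect_rel_inj_image[of R' S id]) (use assms in auto)

lemma clique_colourable_edgeless:
  assumes "\<And>x y. x \<in> T \<Longrightarrow> y \<in> T \<Longrightarrow> \<not> R x y"
  shows "clique_colourable R T"
proof (cases "T = {}")
  case True
  then show ?thesis
    by (intro clique_colourableI[of "{}" _ _ 0]) (auto simp: clique_on_def proper_colouring_def)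
next
  case False
  then obtain x where "x \<in> T" by blast
  then show ?thesis
    by (intro clique_colourableI[of "{x}" _ _ 1 "\<lambda>_. 0"])
      (use assms in \<open>auto simp: clique_on_def proper_colouring_def\<close>)
qed

lemma perfect_rel_edgeless:
  assumes "finite S" "\<And>x y. x \<in> S \<Longrightarrow> y \<in> S \<Longrightarrow> \<not> R x y"
  shows "perfect_rel R S"
  unfolding perfect_rel_def using assms clique_colourable_edgeless by (metis subsetD)

lemma clique_colourable_bipartite:
  assumes sym: "\<And>x y. R x y \<Longrightarrow> R y x"
    and bip: "\<And>x y. x \<in> T \<Longrightarrow> y \<in> T \<Longrightarrow> R x y \<Longrightarrow> p x \<noteq> (p y :: bool)"
  shows "clique_colourable R T"
proof (cases "\<exists>x\<in>T. \<exists>y\<in>T. R x y")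
  case True
  then obtain x y where xy: "x \<in> T" "y \<in> T" "R x y" by blast
  show ?thesis
  proof (rule clique_colourableI)
    show "{x, y} \<subseteq> T" using xy by simp
    show "clique_on R {x, y}" using xy(3) sym[OF xy(3)] unfolding clique_on_def by simp
    show "proper_colouring R T 2 (\<lambda>x. of_bool (p x))"
      unfolding proper_colouring_def by (auto dest: bip)
    show "2 \<le> card {x, y}" using bip[OF xy] by (auto simp: card_insert_if)
  qed
next
  case False
  show ?thesis by (rule clique_colourable_edgeless) (use False in simp)
qed

lemma perfect_rel_bipartite:
  assumes "finite S" "\<And>x y. R x y \<Longrightarrow> R y x"
    and "\<And>x y. x \<in> S \<Longrightarrow> y \<in> S \<Longrightarrow> R x y \<Longrightarrow> p x \<noteq> (p y :: bool)"
  shows "perfect_rel R S"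
  unfolding perfect_rel_def
proof (intro conjI allI impI)
  fix T assume T: "T \<subseteq> S"
  show "clique_colourable R T"
    by (rule clique_colourable_bipartite[of R T p]) (fact assms(2), use T assms(3) in blast)
qed fact

section \<open>Weighted colourings and substitution\<close>

definition set_colouring ::
  "('a \<Rightarrow> 'a \<Rightarrow> bool) \<Rightarrow> 'a set \<Rightarrow> ('a \<Rightarrow> nat) \<Rightarrow> nat \<Rightarrow> ('a \<Rightarrow> nat set) \<Rightarrow> bool" where
  "set_colouring R I w k \<phi> \<longleftrightarrow>
     (\<forall>i\<in>I. \<phi> i \<subseteq> {..<k} \<and> card (\<phi> i) = w i) \<and>
     (\<forall>i\<in>I. \<forall>j\<in>I. R i j \<longrightarrow> \<phi> i \<inter> \<phi> j = {})"

text \<open>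
  This is Lovasz's replication lemma in terms of weights: a vertex of weight \<open>w i\<close> stands for a
  clique of \<open>w i\<close> copies of it. The proof lowers the weight of one vertex \<open>i\<close> by one and colours
  what remains with \<open>k\<close> colours, \<open>k\<close> being the largest weight of a clique. If some clique of
  weight \<open>k\<close> contains \<open>i\<close>, then a new colour is allowed. Otherwise the colour class of a colour
  \<open>t\<close> at \<open>i\<close>, without \<open>i\<close>, meets all cliques of weight \<open>k\<close>; so after lowering the weights on it,
  \<open>k - 1\<close> colours suffice, and the last colour serves this stable class and the copy of \<open>i\<close>.
\<close>

lemma weighted_colouring:
  assumes "perfect_rel R I"
  shows "\<exists>C \<phi>. C \<subseteq> I \<and> clique_on R C \<and> set_colouring R I w (sum w C) \<phi>"
proof (induction "sum w I" arbitrary: w rule: less_induct)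
  case less
  note fin = perfect_rel_finite[OF assms]
  show ?case
  proof (cases "\<forall>i\<in>I. w i \<le> 1")
    case True
    define T where "T = {i\<in>I. w i = 1}"
    have "T \<subseteq> I" unfolding T_def by blast
    then have "clique_colourable R T" by (rule perfect_relD[OF assms])
    then obtain C c where C: "C \<subseteq> T" "clique_on R C" "proper_colouring R T (card C) c"
      unfolding clique_colourable_def by blast
    have "\<And>i. i \<in> C \<Longrightarrow> w i = 1" using C(1) unfolding T_def by blast
    then have sum: "sum w C = card C" by simp
    have w0: "w i = 0" if "i \<in> I" "i \<notin> T" for i
    proof -
      have "w i \<le> 1" "w i \<noteq> 1" using True that unfolding T_def by auto
      then show ?thesis by simp
    qed
    have w1: "w i = 1" if "i \<in> T" for i using that unfolding T_def by blast
    define \<phi> where "\<phi> i = (if i \<in> T then {c i} else {})" for i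
    show ?thesis
      unfolding set_colouring_def
    proof (intro exI conjI ballI impI)
      show "C \<subseteq> I" "clique_on R C" using C \<open>T \<subseteq> I\<close> by auto
      fix i assume i: "i \<in> I"
      show "\<phi> i \<subseteq> {..<sum w C}" using C(3) unfolding sum \<phi>_def proper_colouring_def by simp
      show "card (\<phi> i) = w i" using w0 w1 i unfolding \<phi>_def by simp
      fix j assume "j \<in> I" "R i j"
      have "c i \<noteq> c j" if "i \<in> T" "j \<in> T"
        using C(3) that \<open>R i j\<close> unfolding proper_colouring_def by blast
      then show "\<phi> i \<inter> \<phi> j = {}" unfolding \<phi>_def by auto
    qed
  next
    case False
    then obtain i where i: "i \<in> I" "2 \<le> w i" by force
    define w' where "w' = w(i := w i - 1)"
    have sum_w: "sum w J = (if i \<in> J then Suc (sum w' J) else sum w' J)" if "J \<subseteq> I" for J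
    proof -
      have "finite J" using that fin by (rule finite_subset)
      have eq: "sum w (J - {i}) = sum w' (J - {i})" by (rule sum.cong) (auto simp: w'_def)
      show ?thesis
      proof (cases "i \<in> J")
        case True
        have "sum w J = w i + sum w (J - {i})" "sum w' J = w' i + sum w' (J - {i})"
          using \<open>finite J\<close> True by (auto intro: sum.remove)
        moreover have "w i = Suc (w' i)" using i unfolding w'_def by simp
        ultimately have "sum w J = Suc (sum w' J)" using eq by linarith
        then show ?thesis using True by simp
      next
        case False
        then show ?thesis using eq by simp
      qed
    qed
    have "sum w' I < sum w I" using sum_w[of I] i by simp
    from less(1)[OF this] obtain C' \<phi>' where C': "C' \<subseteq> I" "clique_on R C'"
      and set: "set_colouring R I w' (sum w' C') \<phi>'"
      by blast
    have \<phi>': "\<And>j. j \<in> I \<Longrightarrow> \<phi>' j \<subseteq> {..<sum w' C'}" "\<And>j. j \<in> I \<Longrightarrow> card (\<phi>' j) = w' j"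
        "\<And>j l. j \<in> I \<Longrightarrow> l \<in> I \<Longrightarrow> R j l \<Longrightarrow> \<phi>' j \<inter> \<phi>' l = {}"
      using set unfolding set_colouring_def by simp_all
    define k where "k = sum w' C'"
    have union: "card (\<Union>j\<in>D. \<phi>' j) = sum w' D" if "D \<subseteq> I" "clique_on R D" for D
    proof -
      have "finite D" using that(1) fin by (rule finite_subset)
      moreover have "\<forall>j\<in>D. finite (\<phi>' j)"
        using \<phi>'(1) that(1) finite_subset[OF _ finite_lessThan] by (metis subsetD)
      moreover have "\<forall>j\<in>D. \<forall>l\<in>D. j \<noteq> l \<longrightarrow> \<phi>' j \<inter> \<phi>' l = {}"
        using \<phi>'(3) that unfolding clique_on_def by (simp add: subset_iff)
      ultimately have "card (\<Union>j\<in>D. \<phi>' j) = (\<Sum>j\<in>D. card (\<phi>' j))" by (rule card_UN_disjoint)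
      also have "\<dots> = sum w' D" using \<phi>'(2) that by (intro sum.cong) auto
      finally show ?thesis .
    qed
    have union_sub: "(\<Union>j\<in>D. \<phi>' j) \<subseteq> {..<k}" if "D \<subseteq> I" for D
      using \<phi>'(1) that unfolding k_def by blast
    have le_k: "sum w' D \<le> k" if "D \<subseteq> I" "clique_on R D" for D
      using union[OF that] union_sub[OF that(1)] by (metis card_lessThan card_mono finite_lessThan)
    show ?thesis
    proof (cases "\<exists>C\<subseteq>I. clique_on R C \<and> i \<in> C \<and> sum w' C = k")
      case True
      then obtain C where C: "C \<subseteq> I" "clique_on R C" "i \<in> C" "sum w' C = k" by blast
      have sumC: "sum w C = Suc k" using sum_w[OF C(1)] C by simp
      have irr: "\<not> R i i" using perfect_rel_irrefl[OF assms i(1)] .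
      have lt: "\<phi>' j \<subseteq> {..<k}" if "j \<in> I" for j using \<phi>'(1)[OF that] k_def by simp
      have notin: "k \<notin> \<phi>' j" if "j \<in> I" for j using lt[OF that] by blast
      moreover have "finite (\<phi>' i)" using lt[OF i(1)] finite_subset by blast
      ultimately have card: "card (insert k (\<phi>' i)) = w i" using \<phi>'(2)[OF i(1)] i by (simp add: w'_def)
      show ?thesis
        unfolding set_colouring_def
      proof (intro exI conjI ballI impI)
        show "C \<subseteq> I" "clique_on R C" by fact+
        fix j assume j: "j \<in> I"
        show "(\<phi>'(i := insert k (\<phi>' i))) j \<subseteq> {..<sum w C}" using lt[OF j] by (auto simp: sumC)
        show "card ((\<phi>'(i := insert k (\<phi>' i))) j) = w j" using card \<phi>'(2) j by (auto simp: w'_def)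
        fix l assume l: "l \<in> I" "R j l"
        show "(\<phi>'(i := insert k (\<phi>' i))) j \<inter> (\<phi>'(i := insert k (\<phi>' i))) l = {}"
          using \<phi>'(3)[OF j l] irr l notin[OF j] notin[OF l(1)] by (auto split: if_splits)
      qed
    next
      case False
      have "card (\<phi>' i) \<noteq> 0" using \<phi>'(2)[OF i(1)] i by (simp add: w'_def)
      then obtain t where t: "t \<in> \<phi>' i" by fastforce
      then have tk: "t < k" using \<phi>'(1) i k_def by blast
      \<comment> \<open>The stable class of the colour \<open>t\<close>. The weight of \<open>i\<close> itself was lowered already.\<close>
      define A where "A = {j\<in>I. t \<in> \<phi>' j}"
      have wA: "w' j \<ge> 1" if "j \<in> A" for j
      proof -
        have "j \<in> I" "t \<in> \<phi>' j" using that unfolding A_def by auto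
        moreover have "finite (\<phi>' j)" using \<phi>'(1)[OF \<open>j \<in> I\<close>] finite_subset by blast
        ultimately have "card (\<phi>' j) > 0" using card_gt_0_iff by blast
        then show ?thesis using \<phi>'(2)[OF \<open>j \<in> I\<close>] by simp
      qed
      define w'' where "w'' j = (if j \<in> A - {i} then w' j - 1 else w' j)" for j
      have w''_le: "w'' j \<le> w' j" for j unfolding w''_def by simp
      have "sum w'' I \<le> sum w' I" using w''_le by (simp add: sum_mono)
      then have "sum w'' I < sum w I" using \<open>sum w' I < sum w I\<close> by simp
      from less(1)[OF this] obtain D \<phi> where D: "D \<subseteq> I" "clique_on R D"
        and set: "set_colouring R I w'' (sum w'' D) \<phi>"
        by blast
      have \<phi>: "\<And>j. j \<in> I \<Longrightarrow> \<phi> j \<subseteq> {..<sum w'' D}" "\<And>j. j \<in> I \<Longrightarrow> card (\<phi> j) = w'' j"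
          "\<And>j l. j \<in> I \<Longrightarrow> l \<in> I \<Longrightarrow> R j l \<Longrightarrow> \<phi> j \<inter> \<phi> l = {}"
        using set unfolding set_colouring_def by simp_all
      have "finite D" using D fin finite_subset by blast
      \<comment> \<open>A clique of weight \<open>k\<close> uses all \<open>k\<close> colours, so it meets the class of \<open>t\<close>, and not just in \<open>i\<close>.\<close>
      have small: "sum w'' D < k"
      proof (cases "sum w' D < k")
        case True
        then show ?thesis using sum_mono[of D w'' w'] w''_le by (meson le_less_trans)
      next
        case eq: False
        then have "sum w' D = k" using le_k D by (meson le_neq_implies_less)
        then have "i \<notin> D" using False D by blast
        have "(\<Union>j\<in>D. \<phi>' j) = {..<k}"
          using union[OF D] union_sub[OF D(1)] \<open>sum w' D = k\<close> by (metis card_lessThan card_subset_eq finite_lessThan)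
        then obtain j where j: "j \<in> D" "t \<in> \<phi>' j" using tk by blast
        then have jA: "j \<in> A - {i}" using D \<open>i \<notin> D\<close> unfolding A_def by auto
        then have "w'' j < w' j" using wA[of j] unfolding w''_def by simp
        then have "sum w'' D < sum w' D"
          using \<open>finite D\<close> j(1) w''_le by (intro sum_strict_mono_ex1) auto
        then show ?thesis using \<open>sum w' D = k\<close> by simp
      qed
      have lt: "\<phi> j \<subseteq> {..<k - 1}" if "j \<in> I" for j using \<phi>(1)[OF that] small by (auto simp: subset_iff)
      have notin: "k - 1 \<notin> \<phi> j" if "j \<in> I" for j using lt[OF that] by blast
      have fin_\<phi>: "finite (\<phi> j)" if "j \<in> I" for j using lt[OF that] finite_subset by blast
      have stable: "\<not> R j l" if "j \<in> A" "l \<in> A" for j l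
        using that \<phi>'(3) unfolding A_def by blast
      have "i \<notin> C'" using False C' k_def by blast
      then have sumC': "sum w C' = k" using sum_w[OF C'(1)] k_def by simp
      have iA: "i \<in> A" using i t unfolding A_def by blast
      show ?thesis
        unfolding set_colouring_def
      proof (intro exI conjI ballI impI)
        show "C' \<subseteq> I" "clique_on R C'" by fact+
        fix j assume j: "j \<in> I"
        let ?\<psi> = "\<lambda>j. if j \<in> A then insert (k - 1) (\<phi> j) else \<phi> j"
        show "?\<psi> j \<subseteq> {..<sum w C'}" using lt[OF j] tk by (auto simp: sumC' subset_iff)
        show "card (?\<psi> j) = w j"
          using \<phi>(2)[OF j] notin[OF j] fin_\<phi>[OF j] i wA[of j] iA
          by (cases "j = i") (auto simp: w''_def w'_def)
        fix l assume l: "l \<in> I" "R j l"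
        show "?\<psi> j \<inter> ?\<psi> l = {}"
          using \<phi>(3)[OF j l] stable[of j l] l notin[OF j] notin[OF l(1)] by auto
      qed
    qed
  qed
qed


lemma finite_obtain_max:
  fixes f :: "'a \<Rightarrow> nat"
  assumes "finite A" "A \<noteq> {}"
  obtains m where "m \<in> A" "\<And>x. x \<in> A \<Longrightarrow> f x \<le> f m"
proof -
  have "Max (f ` A) \<in> f ` A" using assms by (intro Max_in) auto
  then obtain m where "m \<in> A" "f m = Max (f ` A)" by auto
  moreover have "f x \<le> Max (f ` A)" if "x \<in> A" for x using assms(1) that by simp
  ultimately show ?thesis using that by simp
qed

lemma clique_on_subset: "clique_on R C \<Longrightarrow> D \<subseteq> C \<Longrightarrow> clique_on R D"
  unfolding clique_on_def by (simp add: subset_iff)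

lemma clique_on_Un:
  assumes "clique_on R C" "clique_on R D" "\<And>x y. x \<in> C \<Longrightarrow> y \<in> D \<Longrightarrow> R x y \<and> R y x"
  shows "clique_on R (C \<union> D)"
  using assms unfolding clique_on_def by auto

definition maximum_clique :: "('a \<Rightarrow> 'a \<Rightarrow> bool) \<Rightarrow> 'a set \<Rightarrow> 'a set \<Rightarrow> bool" where
  "maximum_clique R T M \<longleftrightarrow>
     M \<subseteq> T \<and> clique_on R M \<and> (\<forall>C\<subseteq>T. clique_on R C \<longrightarrow> card C \<le> card M)"

lemma maximum_clique_exists:
  assumes "finite T"
  obtains M where "maximum_clique R T M"
proof -
  have "{C. C \<subseteq> T \<and> clique_on R C} \<noteq> {}" by (auto simp: clique_on_def)
  moreover have "finite {C. C \<subseteq> T \<and> clique_on R C}" using assms by simp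
  ultimately obtain M where "M \<in> {C. C \<subseteq> T \<and> clique_on R C}"
    "\<And>C. C \<in> {C. C \<subseteq> T \<and> clique_on R C} \<Longrightarrow> card C \<le> card M"
    using finite_obtain_max[of "{C. C \<subseteq> T \<and> clique_on R C}" card] by blast
  then have "maximum_clique R T M" unfolding maximum_clique_def by blast
  then show ?thesis by (rule that)
qed

text \<open>
  A stable set that meets every maximum clique can form one colour class, since removing it
  lowers the clique number.
\<close>

lemma clique_colourable_remove_stable:
  assumes "finite T" "L \<subseteq> T" "clique_colourable R (T - L)"
    and stable: "\<And>x y. x \<in> L \<Longrightarrow> y \<in> L \<Longrightarrow> \<not> R x y"
    and meets: "\<And>M. maximum_clique R T M \<Longrightarrow> M \<inter> L \<noteq> {}"
  shows "clique_colourable R T"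
proof -
  obtain M c where M: "M \<subseteq> T - L" "clique_on R M" "proper_colouring R (T - L) (card M) c"
    using assms(3) unfolding clique_colourable_def by blast
  obtain K where K: "maximum_clique R T K" using maximum_clique_exists[OF assms(1)] .
  then have K': "K \<subseteq> T" "clique_on R K" "card M \<le> card K"
    using M(1,2) unfolding maximum_clique_def by auto
  have "card M \<noteq> card K"
  proof
    assume "card M = card K"
    then have "maximum_clique R T M" using K M(1,2) unfolding maximum_clique_def by auto
    then show False using meets M(1) by blast
  qed
  then have le: "Suc (card M) \<le> card K" using K'(3) by simp
  have c: "c x < card M" if "x \<in> T" "x \<notin> L" for x
    using M(3) that unfolding proper_colouring_def by simp
  have "proper_colouring R T (Suc (card M)) (\<lambda>x. if x \<in> L then card M else c x)"
    unfolding proper_colouring_def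
  proof (intro conjI ballI impI)
    fix x assume x: "x \<in> T"
    then show "(if x \<in> L then card M else c x) < Suc (card M)" using c[of x] by auto
    fix y assume y: "y \<in> T" "R x y"
    show "(if x \<in> L then card M else c x) \<noteq> (if y \<in> L then card M else c y)"
    proof (cases "x \<in> L \<or> y \<in> L")
      case True
      then show ?thesis using stable[of x y] y c[of x] c[of y] x by auto
    next
      case False
      then show ?thesis using M(3) x y unfolding proper_colouring_def by simp
    qed
  qed
  then show ?thesis using K'(1,2) le by (intro clique_colourableI[of K T R])
qed

text \<open>
  Lovasz's substitution theorem: the blocks \<open>{x\<in>S. h x = i}\<close> are substituted for the
  vertices \<open>i\<close> of the graph \<open>Q\<close>. Give every vertex of \<open>Q\<close> the clique number of its block as a
  weight; an optimal colouring of the block can then use the set of colours that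
  \<open>weighted_colouring\<close> assigns to the vertex.
\<close>

lemma perfect_rel_substitution:
  assumes fin: "finite S"
    and outer: "perfect_rel Q (h ` S)"
    and inner: "\<And>i. i \<in> h ` S \<Longrightarrow> perfect_rel R {x\<in>S. h x = i}"
    and R: "\<And>x y. x \<in> S \<Longrightarrow> y \<in> S \<Longrightarrow> h x \<noteq> h y \<Longrightarrow> R x y \<longleftrightarrow> Q (h x) (h y)"
  shows "perfect_rel R S"
  unfolding perfect_rel_def
proof (intro conjI allI impI)
  show "finite S" by fact
  fix T assume TS: "T \<subseteq> S"
  then have finT: "finite T" using fin by (rule finite_subset)
  define B where "B i = {x\<in>T. h x = i}" for i
  have "\<exists>C c. C \<subseteq> B i \<and> clique_on R C \<and> proper_colouring R (B i) (card C) c" if "i \<in> h ` T" for i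
  proof -
    have "i \<in> h ` S" "B i \<subseteq> {x\<in>S. h x = i}" using that TS unfolding B_def by auto
    then have "clique_colourable R (B i)" using perfect_relD[OF inner] by blast
    then show ?thesis unfolding clique_colourable_def by blast
  qed
  then obtain C c where C: "\<And>i. i \<in> h ` T \<Longrightarrow> C i \<subseteq> B i" "\<And>i. i \<in> h ` T \<Longrightarrow> clique_on R (C i)"
      "\<And>i. i \<in> h ` T \<Longrightarrow> proper_colouring R (B i) (card (C i)) (c i)"
    by metis
  have "perfect_rel Q (h ` T)" using outer image_mono[OF TS] by (rule perfect_rel_subset)
  then obtain D \<phi> where D: "D \<subseteq> h ` T" "clique_on Q D"
    and set: "set_colouring Q (h ` T) (\<lambda>i. card (C i)) (\<Sum>i\<in>D. card (C i)) \<phi>"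
    using weighted_colouring[of Q "h ` T" "\<lambda>i. card (C i)"] by blast
  have \<phi>: "\<phi> i \<subseteq> {..<(\<Sum>i\<in>D. card (C i))}" "card (\<phi> i) = card (C i)"
    if "i \<in> h ` T" for i using set that unfolding set_colouring_def by auto
  have "\<exists>g. bij_betw g {..<card (C i)} (\<phi> i)" if "i \<in> h ` T" for i
    using ex_bij_betw_nat_finite[of "\<phi> i"] \<phi>[OF that] finite_subset lessThan_atLeast0 by auto
  then obtain g where g: "\<And>i. i \<in> h ` T \<Longrightarrow> bij_betw (g i) {..<card (C i)} (\<phi> i)" by metis
  define K where "K = (\<Union>i\<in>D. C i)"
  define col where "col x = g (h x) (c (h x) x)" for x
  have c_lt: "c (h x) x < card (C (h x))" if "x \<in> T" for x
    using C(3)[of "h x"] that unfolding proper_colouring_def B_def by simp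
  have col_in: "col x \<in> \<phi> (h x)" if "x \<in> T" for x
    using g[of "h x"] c_lt[OF that] that bij_betwE unfolding col_def by blast
  have finB: "finite (B i)" for i using finT unfolding B_def by simp
  have memC: "x \<in> T \<and> h x = i" if "i \<in> D" "x \<in> C i" for x i
    using C(1)[of i] D(1) that unfolding B_def by blast
  have cardK: "card K = (\<Sum>i\<in>D. card (C i))"
    unfolding K_def
  proof (rule card_UN_disjoint)
    show "finite D" using D(1) finT finite_subset by blast
    show "\<forall>i\<in>D. finite (C i)" using C(1) D(1) finB finite_subset by (meson subsetD)
    show "\<forall>i\<in>D. \<forall>j\<in>D. i \<noteq> j \<longrightarrow> C i \<inter> C j = {}" using memC by blast
  qed
  show "clique_colourable R T"
  proof (rule clique_colourableI)
    show "K \<subseteq> T" using memC unfolding K_def by blast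
    show "clique_on R K"
      unfolding clique_on_def
    proof (intro ballI impI)
      fix x y assume xy: "x \<in> K" "y \<in> K" "x \<noteq> y"
      then obtain i j where ij: "i \<in> D" "x \<in> C i" "j \<in> D" "y \<in> C j" unfolding K_def by blast
      then have xyT: "x \<in> T" "h x = i" "y \<in> T" "h y = j" using memC by auto
      show "R x y"
      proof (cases "i = j")
        case True
        then show ?thesis using C(2)[of i] D(1) ij xy unfolding clique_on_def by blast
      next
        case False
        then have "Q i j" using D(2) ij unfolding clique_on_def by blast
        then show ?thesis using R[of x y] xyT TS False by blast
      qed
    qed
    show "proper_colouring R T (card K) col"
      unfolding proper_colouring_def
    proof (intro conjI ballI impI)
      fix x assume x: "x \<in> T"
      then show "col x < card K" using col_in[OF x] \<phi>(1)[of "h x"] unfolding cardK by blast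
      fix y assume y: "y \<in> T" "R x y"
      show "col x \<noteq> col y"
      proof (cases "h x = h y")
        case True
        have "c (h x) x \<noteq> c (h x) y"
          using C(3)[of "h x"] x y True unfolding proper_colouring_def B_def by simp
        moreover have "inj_on (g (h x)) {..<card (C (h x))}"
          using g[of "h x"] x by (simp add: bij_betw_imp_inj_on)
        ultimately show ?thesis
          using c_lt[OF x] c_lt[OF y(1)] True unfolding col_def inj_on_def by auto
      next
        case False
        then have "Q (h x) (h y)" using R[of x y] x y TS by blast
        then have "\<phi> (h x) \<inter> \<phi> (h y) = {}" using set x y unfolding set_colouring_def by simp
        then show ?thesis using col_in[OF x] col_in[OF y(1)] by auto
      qed
    qed
    show "card K \<le> card K" by simp
  qed
qed

lemma perfect_rel_disjoint_union:
  assumes "finite S"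
    and "\<And>i. i \<in> h ` S \<Longrightarrow> perfect_rel R {x\<in>S. h x = i}"
    and "\<And>x y. x \<in> S \<Longrightarrow> y \<in> S \<Longrightarrow> R x y \<Longrightarrow> h x = h y"
  shows "perfect_rel R S"
proof (rule perfect_rel_substitution)
  show "perfect_rel (\<lambda>_ _. False) (h ` S)" using assms(1) by (intro perfect_rel_edgeless) auto
qed (use assms in auto)

section \<open>Rook graphs and their complements\<close>

text \<open>
  Adjacency of the rook's graph, which is the line graph of a complete bipartite graph: its
  elements are the edges, and rows and columns are the vertices. Cliques of the complement are
  therefore matchings.
\<close>

abbreviation rook :: "'a \<times> 'b \<Rightarrow> 'a \<times> 'b \<Rightarrow> bool" where
  "rook p q \<equiv> p \<noteq> q \<and> (fst p = fst q \<or> snd p = snd q)"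

abbreviation co_rook :: "'a \<times> 'b \<Rightarrow> 'a \<times> 'b \<Rightarrow> bool" where
  "co_rook p q \<equiv> fst p \<noteq> fst q \<and> snd p \<noteq> snd q"

text \<open>
  De Caen's argument for Koenig's theorem. If a maximum matching \<open>M\<close> misses the row \<open>x\<close> and a
  maximum matching \<open>N\<close> misses the column \<open>y\<close>, then exchange the two along the alternating path
  that starts in row \<open>x\<close>, whose rows are \<open>Z\<close>. One exchange shows that \<open>N\<close> has at most as many
  cells in these rows as \<open>M\<close>; the other exchange produces a matching at least as large as \<open>N\<close> to
  which the cell \<open>(x, y)\<close> can be added.
\<close>

lemma maximum_clique_co_rook_meets_line:
  assumes fin: "finite T" and xy: "(x, y) \<in> T"
    and M: "maximum_clique co_rook T M" and N: "maximum_clique co_rook T N"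
  shows "x \<in> fst ` M \<or> y \<in> snd ` N"
proof (rule ccontr)
  assume contr: "\<not> (x \<in> fst ` M \<or> y \<in> snd ` N)"
  define step where "step = {(r, r'). \<exists>c. (r, c) \<in> N \<and> (r', c) \<in> M}"
  define Z where "Z = {r. (x, r) \<in> step\<^sup>*}"
  define MZ where "MZ = {p\<in>M. fst p \<in> Z}"
  define NZ where "NZ = {p\<in>N. fst p \<in> Z}"
  have MT: "M \<subseteq> T" "clique_on co_rook M" and NT: "N \<subseteq> T" "clique_on co_rook N"
    using M N unfolding maximum_clique_def by auto
  have finMN: "finite M" "finite N" using MT NT fin finite_subset by auto
  have x: "x \<in> Z" unfolding Z_def by simp
  have Z_step: "r' \<in> Z" if "r \<in> Z" "(r, c) \<in> N" "(r', c) \<in> M" for r r' c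
    using that unfolding Z_def step_def by (auto intro: rtrancl_into_rtrancl)
  have Z_pred: "\<exists>r'\<in>Z. \<exists>c. (r', c) \<in> N \<and> (r, c) \<in> M" if "r \<in> Z" "r \<noteq> x" for r
  proof -
    have "(x, r) \<in> step\<^sup>*" using that unfolding Z_def by simp
    then obtain r' where "(x, r') \<in> step\<^sup>*" "(r', r) \<in> step"
      using \<open>r \<noteq> x\<close> by (metis rtranclE)
    then show ?thesis unfolding step_def Z_def by blast
  qed
  have M_eq: "p = q" if "p \<in> M" "q \<in> M" "fst p = fst q \<or> snd p = snd q" for p q
    using MT(2) that unfolding clique_on_def by blast
  have N_eq: "p = q" if "p \<in> N" "q \<in> N" "fst p = fst q \<or> snd p = snd q" for p q
    using NT(2) that unfolding clique_on_def by blast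
  \<comment> \<open>Row \<open>x\<close> has no cell of \<open>M\<close>, so every cell of \<open>M\<close> in the rows \<open>Z\<close> has a predecessor on the path.\<close>
  have pred: "\<exists>r'\<in>Z. (r', snd p) \<in> N" if "p \<in> MZ" for p
  proof -
    have p: "p \<in> M" "fst p \<in> Z" using that unfolding MZ_def by auto
    moreover have "fst p \<noteq> x" using p contr by force
    ultimately obtain r' c' where "r' \<in> Z" "(r', c') \<in> N" "(fst p, c') \<in> M" using Z_pred by blast
    moreover from this have "c' = snd p" using M_eq[of p "(fst p, c')"] p by (metis fst_conv snd_conv)
    ultimately show ?thesis by blast
  qed
  have "card NZ \<le> card MZ"
  proof -
    have cross: "co_rook p q \<and> co_rook q p" if pq: "p \<in> M - MZ" "q \<in> NZ" for p q
    proof -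
      have *: "fst p \<notin> Z" "fst q \<in> Z" "p \<in> M" "q \<in> N" using pq unfolding MZ_def NZ_def by auto
      moreover have "snd p \<noteq> snd q"
        using Z_step[of "fst q" "snd q" "fst p"] * by (metis prod.collapse)
      ultimately show ?thesis by auto
    qed
    have "clique_on co_rook (M - MZ \<union> NZ)"
      by (rule clique_on_Un[OF clique_on_subset[OF MT(2)] clique_on_subset[OF NT(2)]])
        (use cross in \<open>auto simp: NZ_def\<close>)
    moreover have "M - MZ \<union> NZ \<subseteq> T" using MT NT unfolding NZ_def by auto
    ultimately have "card (M - MZ \<union> NZ) \<le> card M" using M unfolding maximum_clique_def by blast
    moreover have "(M - MZ) \<inter> NZ = {}" unfolding MZ_def NZ_def by auto
    then have "card (M - MZ \<union> NZ) = card M - card MZ + card NZ"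
      using finMN by (subst card_Un_disjoint) (auto simp: MZ_def NZ_def card_Diff_subset)
    moreover have "card MZ \<le> card M" using finMN unfolding MZ_def by (intro card_mono) auto
    ultimately show ?thesis by linarith
  qed
  moreover have "card MZ < card NZ"
  proof -
    have cross: "co_rook p q \<and> co_rook q p" if pq: "p \<in> N - NZ" "q \<in> MZ" for p q
    proof -
      have p: "fst p \<notin> Z" "p \<in> N" and q: "fst q \<in> Z" using pq unfolding MZ_def NZ_def by auto
      obtain r' where "r' \<in> Z" "(r', snd q) \<in> N" using pred[OF pq(2)] by blast
      then have "snd p \<noteq> snd q" using N_eq[of p "(r', snd q)"] p by auto
      then show ?thesis using p q by auto
    qed
    have cl: "clique_on co_rook (N - NZ \<union> MZ)"
      by (rule clique_on_Un[OF clique_on_subset[OF NT(2)] clique_on_subset[OF MT(2)]])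
        (use cross in \<open>auto simp: MZ_def\<close>)
    have free: "co_rook p (x, y) \<and> co_rook (x, y) p" if "p \<in> N - NZ \<union> MZ" for p
    proof (cases "p \<in> MZ")
      case True
      then have "p \<in> M" unfolding MZ_def by simp
      then have "fst p \<noteq> x" using contr by auto
      moreover have "snd p \<in> snd ` N" using pred[OF True] by (metis image_eqI snd_conv)
      ultimately show ?thesis using contr by auto
    next
      case False
      then have "p \<in> N" "fst p \<notin> Z" using that unfolding NZ_def by auto
      then show ?thesis using contr x by auto
    qed
    have "clique_on co_rook ((N - NZ \<union> MZ) \<union> {(x, y)})"
      by (rule clique_on_Un[OF cl]) (use free in \<open>auto simp: clique_on_def\<close>)
    moreover have "N - NZ \<union> MZ \<union> {(x, y)} \<subseteq> T" using xy MT NT unfolding MZ_def by auto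
    ultimately have "card (N - NZ \<union> MZ \<union> {(x, y)}) \<le> card N" using N unfolding maximum_clique_def by blast
    moreover have "(N - NZ) \<inter> MZ = {}" unfolding MZ_def NZ_def by auto
    then have "card (N - NZ \<union> MZ) = card N - card NZ + card MZ"
      using finMN by (subst card_Un_disjoint) (auto simp: MZ_def NZ_def card_Diff_subset)
    moreover have "card NZ \<le> card N" using finMN unfolding NZ_def by (intro card_mono) auto
    moreover have "finite (N - NZ \<union> MZ)" "(x, y) \<notin> N - NZ \<union> MZ"
      using finMN free[of "(x, y)"] unfolding MZ_def by auto
    then have "card (N - NZ \<union> MZ \<union> {(x, y)}) = Suc (card (N - NZ \<union> MZ))" by simp
    ultimately show ?thesis by linarith
  qed
  ultimately show False by simp
qed

text \<open>
  By the previous lemma, the row or the column of any cell meets all maximum matchings, and a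
  line is a stable set. Removing such lines one by one gives the colouring, that is, a vertex
  cover.
\<close>

lemma perfect_rel_co_rook:
  assumes "finite S"
  shows "perfect_rel co_rook S"
proof -
  have "clique_colourable co_rook T" if "finite T" for T :: "('a \<times> 'b) set"
    using that
  proof (induction "card T" arbitrary: T rule: less_induct)
    case less
    show ?case
    proof (cases "T = {}")
      case True
      then show ?thesis by (intro clique_colourable_edgeless) auto
    next
      case False
      then obtain x y where xy: "(x, y) \<in> T" by force
      \<comment> \<open>If some maximum matching misses row \<open>x\<close>, then column \<open>y\<close> meets all of them.\<close>
      define L where "L = (if \<forall>M. maximum_clique co_rook T M \<longrightarrow> x \<in> fst ` M
        then {p\<in>T. fst p = x} else {p\<in>T. snd p = y})"
      have L: "L \<subseteq> T" "(x, y) \<in> L" using xy unfolding L_def by auto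
      have stable: "\<not> co_rook p q" if "p \<in> L" "q \<in> L" for p q
        using that unfolding L_def by (auto split: if_splits)
      have meets: "M \<inter> L \<noteq> {}" if M: "maximum_clique co_rook T M" for M
      proof -
        have "M \<subseteq> T" using M unfolding maximum_clique_def by simp
        show ?thesis
        proof (cases "\<forall>M. maximum_clique co_rook T M \<longrightarrow> x \<in> fst ` M")
          case True
          then have "x \<in> fst ` M" using M by simp
          then show ?thesis using True \<open>M \<subseteq> T\<close> unfolding L_def by auto
        next
          case False
          then have "y \<in> snd ` M" using maximum_clique_co_rook_meets_line[OF less(2) xy _ M] by auto
          then show ?thesis using False \<open>M \<subseteq> T\<close> unfolding L_def by auto
        qed
      qed
      have "card (T - L) < card T" using L xy less(2) by (intro psubset_card_mono) auto
      then have "clique_colourable co_rook (T - L)" using less(1)[of "T - L"] less(2) by simp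
      then show ?thesis using L less(2) stable meets by (intro clique_colourable_remove_stable[of T L]) auto
    qed
  qed
  then show ?thesis unfolding perfect_rel_def using assms finite_subset by blast
qed


text \<open>
  Koenig's theorem on edge colourings of bipartite graphs, by Kempe's argument. When the cell
  \<open>(x, y)\<close> is added, a colour \<open>\<alpha>\<close> is free in row \<open>x\<close> and a colour \<open>\<beta>\<close> is free in
  column \<open>y\<close>. Swapping the two colours in the set \<open>Z\<close> of rows that an alternating path from row
  \<open>x\<close> reaches makes \<open>\<beta>\<close> free in both; the path enters columns through cells of colour
  \<open>\<beta>\<close>, so it does not reach column \<open>y\<close>.
\<close>

lemma rook_colouring:
  assumes "finite T"
    and "\<And>x. card {p\<in>T. fst p = x} \<le> k" "\<And>y. card {p\<in>T. snd p = y} \<le> k"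
  shows "\<exists>c. proper_colouring rook T k c"
  using assms
proof (induction T rule: finite_induct)
  case empty
  then show ?case unfolding proper_colouring_def by auto
next
  case (insert e T)
  obtain x y where e: "e = (x, y)" by force
  have le: "card {p\<in>T. P p} \<le> card {p\<in>insert e T. P p}" for P
    using insert.hyps by (intro card_mono) auto
  obtain c where c: "proper_colouring rook T k c"
    using insert.IH insert.prems le by (meson order_trans)
  have c_lt: "c p < k" if "p \<in> T" for p using c that unfolding proper_colouring_def by simp
  have c_eq: "p = q" if "p \<in> T" "q \<in> T" "fst p = fst q \<or> snd p = snd q" "c p = c q" for p q
    using c that unfolding proper_colouring_def by blast
  have missing: "\<exists>\<alpha><k. \<forall>p\<in>T. P p \<longrightarrow> c p \<noteq> \<alpha>" if "P e" "card {p\<in>insert e T. P p} \<le> k" for P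
  proof -
    have "{p\<in>insert e T. P p} = insert e {p\<in>T. P p}" using that by auto
    then have "card {p\<in>T. P p} < k" using that(2) insert.hyps by simp
    moreover have "card (c ` {p\<in>T. P p}) \<le> card {p\<in>T. P p}"
      using insert.hyps by (intro card_image_le) auto
    ultimately have "\<not> {..<k} \<subseteq> c ` {p\<in>T. P p}"
      using insert.hyps(1) card_mono[of "c ` {p\<in>T. P p}" "{..<k}"] by auto
    then show ?thesis by blast
  qed
  obtain \<alpha> where \<alpha>: "\<alpha> < k" "\<And>p. p \<in> T \<Longrightarrow> fst p = x \<Longrightarrow> c p \<noteq> \<alpha>"
    using missing[of "\<lambda>p. fst p = x"] insert.prems(1)[of x] by (auto simp: e)
  obtain \<beta> where \<beta>: "\<beta> < k" "\<And>p. p \<in> T \<Longrightarrow> snd p = y \<Longrightarrow> c p \<noteq> \<beta>"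
    using missing[of "\<lambda>p. snd p = y"] insert.prems(2)[of y] by (auto simp: e)
  define step where "step = {(r, r'). \<exists>p\<in>T. \<exists>q\<in>T. fst p = r \<and> c p = \<beta> \<and> fst q = r' \<and> c q = \<alpha> \<and> snd p = snd q}"
  define Z where "Z = {r. (x, r) \<in> step\<^sup>*}"
  have x: "x \<in> Z" unfolding Z_def by simp
  have Z_step: "fst q \<in> Z"
    if "fst p \<in> Z" "p \<in> T" "q \<in> T" "c p = \<beta>" "c q = \<alpha>" "snd p = snd q" for p q
  proof -
    have "(fst p, fst q) \<in> step" using that unfolding step_def by auto
    then show ?thesis using that(1) unfolding Z_def by (auto intro: rtrancl_into_rtrancl)
  qed
  have Z_pred: "\<exists>p\<in>T. fst p \<in> Z \<and> c p = \<beta> \<and> snd p = snd q" if "fst q \<in> Z" "q \<in> T" "c q = \<alpha>" for q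
  proof -
    have "fst q \<noteq> x" using \<alpha>(2)[of q] that by blast
    moreover have "(x, fst q) \<in> step\<^sup>*" using that unfolding Z_def by simp
    ultimately obtain r where r: "(x, r) \<in> step\<^sup>*" "(r, fst q) \<in> step" by (metis rtranclE)
    then obtain p q' where pq: "p \<in> T" "q' \<in> T" "fst p = r" "c p = \<beta>" "fst q' = fst q" "c q' = \<alpha>" "snd p = snd q'"
      unfolding step_def by auto
    then have "q' = q" using c_eq[of q' q] that by simp
    then show ?thesis using pq r unfolding Z_def by blast
  qed
  have step_col: "fst p \<in> Z \<longleftrightarrow> fst q \<in> Z"
    if "p \<in> T" "q \<in> T" "c p = \<beta>" "c q = \<alpha>" "snd p = snd q" for p q
  proof
    assume "fst q \<in> Z"
    then obtain p' where "p' \<in> T" "fst p' \<in> Z" "c p' = \<beta>" "snd p' = snd q"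
      using Z_pred[of q] \<open>q \<in> T\<close> \<open>c q = \<alpha>\<close> by blast
    then show "fst p \<in> Z" using c_eq[of p p'] that by simp
  qed (use Z_step that in blast)
  \<comment> \<open>The Kempe swap, with the new cell in colour \<open>\<beta>\<close>.\<close>
  define c' where "c' p = (if p = e then \<beta> else if fst p \<in> Z \<and> c p = \<alpha> then \<beta>
    else if fst p \<in> Z \<and> c p = \<beta> then \<alpha> else c p)" for p
  have new: "c' p \<noteq> \<beta>" if "p \<in> T" "fst p = x \<or> snd p = y" for p
  proof -
    have pe: "p \<noteq> e" using that insert.hyps by auto
    show ?thesis
    proof (cases "fst p = x")
      case True
      then show ?thesis using \<alpha>(2)[of p] that x pe unfolding c'_def by auto
    next
      case False
      then have y: "snd p = y" using that by simp
      then have "c p \<noteq> \<beta>" using \<beta>(2) that by simp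
      moreover have "\<not> (fst p \<in> Z \<and> c p = \<alpha>)"
        using Z_pred[of p] \<beta>(2) that y by metis
      ultimately show ?thesis using pe unfolding c'_def by auto
    qed
  qed
  have old: "c' p \<noteq> c' q" if "p \<in> T" "q \<in> T" "rook p q" for p q
  proof -
    have "p \<noteq> e" "q \<noteq> e" using that insert.hyps by auto
    moreover have "c p \<noteq> c q" using c_eq[of p q] that by blast
    moreover have "fst p \<in> Z \<longleftrightarrow> fst q \<in> Z" if "c p = \<beta> \<and> c q = \<alpha> \<or> c p = \<alpha> \<and> c q = \<beta>"
    proof (cases "fst p = fst q")
      case False
      then have "snd p = snd q" using \<open>rook p q\<close> by simp
      then show ?thesis
        using that step_col[of p q] step_col[of q p] \<open>p \<in> T\<close> \<open>q \<in> T\<close> by (metis (no_types))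
    qed simp
    ultimately show ?thesis unfolding c'_def by (cases "fst p \<in> Z"; cases "fst q \<in> Z") auto
  qed
  have "proper_colouring rook (insert e T) k c'"
    unfolding proper_colouring_def
  proof (intro conjI ballI impI)
    fix p assume p: "p \<in> insert e T"
    then show "c' p < k" using c_lt[of p] \<alpha>(1) \<beta>(1) unfolding c'_def by auto
    fix q assume q: "q \<in> insert e T" "rook p q"
    have "c' e = \<beta>" unfolding c'_def by simp
    then show "c' p \<noteq> c' q" using p q old[of p q] new[of p] new[of q] unfolding e by auto
  qed
  then show ?case by blast
qed

text \<open>
  A row or column with the most cells is a clique, and \<open>rook_colouring\<close> needs no more colours
  than it has cells.
\<close>

lemma perfect_rel_rook:
  assumes "finite S"
  shows "perfect_rel rook S"
proof -
  have "clique_colourable rook T" if fin: "finite T" for T :: "('a \<times> 'b) set"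
  proof (cases "T = {}")
    case True
    then show ?thesis by (intro clique_colourable_edgeless) auto
  next
    case False
    define \<L> where "\<L> = (\<lambda>x. {p\<in>T. fst p = x}) ` fst ` T \<union> (\<lambda>y. {p\<in>T. snd p = y}) ` snd ` T"
    obtain L where L: "L \<in> \<L>" "\<And>K. K \<in> \<L> \<Longrightarrow> card K \<le> card L"
      using finite_obtain_max[of \<L> card] fin False unfolding \<L>_def by auto
    have rows: "card {p\<in>T. fst p = x} \<le> card L" for x
    proof (cases "x \<in> fst ` T")
      case True
      then show ?thesis using L(2) unfolding \<L>_def by blast
    next
      case False
      then have "{p\<in>T. fst p = x} = {}" by blast
      then show ?thesis by (metis card.empty le0)
    qed
    have cols: "card {p\<in>T. snd p = y} \<le> card L" for y
    proof (cases "y \<in> snd ` T")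
      case True
      then show ?thesis using L(2) unfolding \<L>_def by blast
    next
      case False
      then have "{p\<in>T. snd p = y} = {}" by blast
      then show ?thesis by (metis card.empty le0)
    qed
    obtain c where "proper_colouring rook T (card L) c"
      using rook_colouring[OF fin rows cols] by blast
    moreover have "clique_on rook L" "L \<subseteq> T" using L(1) unfolding \<L>_def clique_on_def by auto
    ultimately show ?thesis unfolding clique_colourable_def by blast
  qed
  then show ?thesis unfolding perfect_rel_def using assms finite_subset by blast
qed

section \<open>Perfect products\<close>

text \<open>
  Adjacency in the weak modular product. As it compares \<open>A\<close> and \<open>B\<close> at distinct vertices only,
  it does not change when both are negated, and the negations represent the complements.
\<close>

definition wprod :: "('a \<Rightarrow> 'a \<Rightarrow> bool) \<Rightarrow> ('b \<Rightarrow> 'b \<Rightarrow> bool) \<Rightarrow> 'a \<times> 'b \<Rightarrow> 'a \<times> 'b \<Rightarrow> bool" where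
  "wprod A B p q \<longleftrightarrow>
     fst p \<noteq> fst q \<and> snd p \<noteq> snd q \<and> (A (fst p) (fst q) \<longleftrightarrow> B (snd p) (snd q))"

lemma wprod_sym: "symp A \<Longrightarrow> symp B \<Longrightarrow> wprod A B p q \<Longrightarrow> wprod A B q p"
  unfolding wprod_def symp_def by metis

text \<open>
  Adjacent pairs have distinct first components, so a factor with at most two vertices makes the
  product bipartite.
\<close>

lemma perfect_rel_two_vertices:
  assumes "card V \<le> 2" "finite V" "finite W" "symp A" "symp B"
  shows "perfect_rel (wprod A B) (V \<times> W)"
proof -
  obtain a where a: "\<And>x y. x \<in> V \<Longrightarrow> y \<in> V \<Longrightarrow> x \<noteq> y \<Longrightarrow> (x = a) \<noteq> (y = a)"
  proof (cases "V = {}")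
    case False
    then obtain a where "a \<in> V" by blast
    have "x = a \<or> y = a" if "x \<in> V" "y \<in> V" "x \<noteq> y" for x y
    proof (rule ccontr)
      assume "\<not> ?thesis"
      then have "card {x, y, a} = 3" using that by auto
      moreover have "card {x, y, a} \<le> card V" using that \<open>a \<in> V\<close> assms by (intro card_mono) auto
      ultimately show False using assms by simp
    qed
    then show ?thesis using that by metis
  qed auto
  show ?thesis
  proof (rule perfect_rel_bipartite)
    fix p q assume "p \<in> V \<times> W" "q \<in> V \<times> W" "wprod A B p q"
    then show "(fst p = a) \<noteq> (fst q = a)" using a[of "fst p" "fst q"] unfolding wprod_def by auto
  qed (use assms wprod_sym in auto)
qed

text \<open>
  The classes of \<open>f\<close> and \<open>g\<close> are the cliques of the two factors. Pairs of classes are adjacent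
  like the cells of the complement of a rook's graph, and within a pair of classes the same is
  true of the vertices.
\<close>

lemma perfect_rel_partitions:
  assumes "finite V" "finite W"
    and A: "\<And>x y. x \<in> V \<Longrightarrow> y \<in> V \<Longrightarrow> x \<noteq> y \<Longrightarrow> A x y \<longleftrightarrow> f x = f y"
    and B: "\<And>x y. x \<in> W \<Longrightarrow> y \<in> W \<Longrightarrow> x \<noteq> y \<Longrightarrow> B x y \<longleftrightarrow> g x = g y"
  shows "perfect_rel (wprod A B) (V \<times> W)"
proof (rule perfect_rel_substitution)
  let ?h = "\<lambda>p. (f (fst p), g (snd p))"
  show fin: "finite (V \<times> W)" using assms by simp
  then show "perfect_rel co_rook (?h ` (V \<times> W))" by (intro perfect_rel_co_rook) simp
  show "perfect_rel (wprod A B) {p \<in> V \<times> W. ?h p = i}" for i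
    by (rule perfect_rel_cong[OF perfect_rel_co_rook]) (use assms fin in \<open>auto simp: wprod_def\<close>)
  fix p q assume pq: "p \<in> V \<times> W" "q \<in> V \<times> W" "?h p \<noteq> ?h q"
  then show "wprod A B p q \<longleftrightarrow> co_rook (?h p) (?h q)"
    using A[of "fst p" "fst q"] B[of "snd p" "snd q"] unfolding wprod_def
    by (cases "fst p = fst q"; cases "snd p = snd q") auto
qed

lemma wprod_complement: "wprod (\<lambda>x y. \<not> A x y) (\<lambda>x y. \<not> B x y) = wprod A B"
  unfolding wprod_def by auto

lemma perfect_rel_copartitions:
  assumes "finite V" "finite W"
    and "\<And>x y. x \<in> V \<Longrightarrow> y \<in> V \<Longrightarrow> x \<noteq> y \<Longrightarrow> A x y \<longleftrightarrow> f x \<noteq> f y"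
    and "\<And>x y. x \<in> W \<Longrightarrow> y \<in> W \<Longrightarrow> x \<noteq> y \<Longrightarrow> B x y \<longleftrightarrow> g x \<noteq> g y"
  shows "perfect_rel (wprod A B) (V \<times> W)"
proof -
  have "perfect_rel (wprod (\<lambda>x y. \<not> A x y) (\<lambda>x y. \<not> B x y)) (V \<times> W)"
    by (rule perfect_rel_partitions[of _ _ _ f _ g]) (use assms in auto)
  then show ?thesis unfolding wprod_complement .
qed

text \<open>
  Along an edge of the product exactly one of \<open>f\<close> and \<open>g\<close> changes, so the parity of \<open>f\<close> and \<open>g\<close>
  is a 2-colouring.
\<close>

lemma perfect_rel_two_cliques_bipartite:
  fixes f :: "'a \<Rightarrow> bool" and g :: "'b \<Rightarrow> bool"
  assumes "finite V" "finite W" "symp A" "symp B"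
    and A: "\<And>x y. x \<in> V \<Longrightarrow> y \<in> V \<Longrightarrow> x \<noteq> y \<Longrightarrow> A x y \<longleftrightarrow> f x = f y"
    and B: "\<And>x y. x \<in> W \<Longrightarrow> y \<in> W \<Longrightarrow> x \<noteq> y \<Longrightarrow> B x y \<longleftrightarrow> g x \<noteq> g y"
  shows "perfect_rel (wprod A B) (V \<times> W)"
proof (rule perfect_rel_bipartite)
  fix p q assume "p \<in> V \<times> W" "q \<in> V \<times> W" "wprod A B p q"
  then show "(f (fst p) = g (snd p)) \<noteq> (f (fst q) = g (snd q))"
    using A[of "fst p" "fst q"] B[of "snd p" "snd q"] unfolding wprod_def by auto
qed (use assms wprod_sym in auto)

text \<open>
  The classes of \<open>h\<close> are the components of the second factor. Over a bipartite component the
  product is bipartite; over a complete multipartite component with parts \<open>g\<close> it is the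
  complement of a rook's graph with stable sets substituted for the cells.
\<close>

lemma perfect_rel_complete_factor:
  assumes "finite V" "finite W" "symp A" "symp B"
    and A: "\<And>x y. x \<in> V \<Longrightarrow> y \<in> V \<Longrightarrow> x \<noteq> y \<Longrightarrow> A x y"
    and h: "\<And>x y. x \<in> W \<Longrightarrow> y \<in> W \<Longrightarrow> B x y \<Longrightarrow> h x = h y"
    and comp: "\<And>i. i \<in> h ` W \<Longrightarrow>
      (\<exists>p :: 'b \<Rightarrow> bool. \<forall>x\<in>W. \<forall>y\<in>W. h x = i \<longrightarrow> h y = i \<longrightarrow> B x y \<longrightarrow> p x \<noteq> p y) \<or>
      (\<exists>g :: 'b \<Rightarrow> 'b set. \<forall>x\<in>W. \<forall>y\<in>W. h x = i \<longrightarrow> h y = i \<longrightarrow> x \<noteq> y \<longrightarrow> B x y \<longleftrightarrow> g x \<noteq> g y)"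
  shows "perfect_rel (wprod A B) (V \<times> W)"
proof (rule perfect_rel_disjoint_union)
  show fin: "finite (V \<times> W)" using assms by simp
  fix i assume "i \<in> (\<lambda>p. h (snd p)) ` (V \<times> W)"
  then have "i \<in> h ` W" by auto
  from comp[OF this] show "perfect_rel (wprod A B) {p \<in> V \<times> W. h (snd p) = i}"
  proof (elim disjE exE)
    fix c :: "'b \<Rightarrow> bool"
    assume c: "\<forall>x\<in>W. \<forall>y\<in>W. h x = i \<longrightarrow> h y = i \<longrightarrow> B x y \<longrightarrow> c x \<noteq> c y"
    show ?thesis
    proof (rule perfect_rel_bipartite)
      fix p q assume "p \<in> {p \<in> V \<times> W. h (snd p) = i}" "q \<in> {p \<in> V \<times> W. h (snd p) = i}" "wprod A B p q"
      then show "c (snd p) \<noteq> c (snd q)" using A c unfolding wprod_def by auto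
    qed (use fin assms wprod_sym in auto)
  next
    fix g :: "'b \<Rightarrow> 'b set"
    assume g: "\<forall>x\<in>W. \<forall>y\<in>W. h x = i \<longrightarrow> h y = i \<longrightarrow> x \<noteq> y \<longrightarrow> B x y \<longleftrightarrow> g x \<noteq> g y"
    let ?S = "{p \<in> V \<times> W. h (snd p) = i}" and ?h = "\<lambda>p. (fst p, g (snd p))"
    show ?thesis
    proof (rule perfect_rel_substitution)
      show "perfect_rel co_rook (?h ` ?S)" using fin by (intro perfect_rel_co_rook) simp
      show "perfect_rel (wprod A B) {p \<in> ?S. ?h p = j}" for j
        by (rule perfect_rel_edgeless) (use fin in \<open>auto simp: wprod_def\<close>)
      fix p q assume pq: "p \<in> ?S" "q \<in> ?S" "?h p \<noteq> ?h q"
      then have "snd p \<noteq> snd q \<Longrightarrow> B (snd p) (snd q) \<longleftrightarrow> g (snd p) \<noteq> g (snd q)"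
        using g by auto
      then show "wprod A B p q \<longleftrightarrow> co_rook (?h p) (?h q)"
        using A[of "fst p" "fst q"] pq unfolding wprod_def
        by (cases "fst p = fst q"; cases "snd p = snd q") auto
    qed (use fin in simp)
  qed
next
  fix p q assume "p \<in> V \<times> W" "q \<in> V \<times> W" "wprod A B p q"
  then show "h (snd p) = h (snd q)"
    using A[of "fst p" "fst q"] h[of "snd p" "snd q"] unfolding wprod_def by auto
qed

text \<open>
  An embedding into the cycle on the residues modulo 5.
\<close>

definition C5_embedding :: "'a set \<Rightarrow> ('a \<Rightarrow> 'a \<Rightarrow> bool) \<Rightarrow> ('a \<Rightarrow> int) \<Rightarrow> bool" where
  "C5_embedding V A f \<longleftrightarrow>
     (\<forall>x\<in>V. f x \<in> {0, 1, 2, 3, 4}) \<and>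
     (\<forall>x\<in>V. \<forall>y\<in>V. f x = f y \<longrightarrow> x = y) \<and>
     (\<forall>x\<in>V. \<forall>y\<in>V. A x y \<longleftrightarrow> (f x - f y) mod 5 \<in> {1, 4})"

lemma C5_embedding_eq_iff:
  assumes "C5_embedding V A f" "x \<in> V" "y \<in> V"
  shows "x = y \<longleftrightarrow> (f x - f y) mod 5 = 0"
proof -
  have "f x \<in> {0, 1, 2, 3, 4}" "f y \<in> {0, 1, 2, 3, 4}" "f x = f y \<longrightarrow> x = y"
    using assms unfolding C5_embedding_def by simp_all
  then show ?thesis by auto
qed

text \<open>
  Two pairs of residues are adjacent in the product of two five-cycles iff their difference is a
  nonzero multiple of \<open>(1, 1)\<close> or of \<open>(1, -1)\<close>. In the coordinates \<open>u = x + y\<close> and \<open>v = x - y\<close>,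
  which are invertible modulo 5, this is the rook's graph.
\<close>

lemma perfect_rel_C5_C5:
  assumes "finite V" "finite W" "C5_embedding V A f" "C5_embedding W B g"
  shows "perfect_rel (wprod A B) (V \<times> W)"
proof -
  define F where "F p = ((f (fst p) + g (snd p)) mod 5, (f (fst p) - g (snd p)) mod 5)" for p
  have F: "fst (F p) = fst (F q) \<longleftrightarrow> (f (fst p) - f (fst q) + (g (snd p) - g (snd q))) mod 5 = 0"
    "snd (F p) = snd (F q) \<longleftrightarrow> (f (fst p) - f (fst q) - (g (snd p) - g (snd q))) mod 5 = 0" for p q
    unfolding F_def fst_conv snd_conv mod_eq_dvd_iff mod_eq_0_iff_dvd by (simp_all add: algebra_simps)
  have main: "(((d + e) mod 5 = 0 \<and> (d - e) mod 5 = 0) \<longleftrightarrow> (d mod 5 = 0 \<and> e mod 5 = 0)) \<and>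
    (((d + e) mod 5 = 0 \<or> (d - e) mod 5 = 0) \<longleftrightarrow> (d mod 5 = 0 \<and> e mod 5 = 0) \<or>
     (d mod 5 \<noteq> 0 \<and> e mod 5 \<noteq> 0 \<and> (d mod 5 \<in> {1, 4} \<longleftrightarrow> e mod 5 \<in> {1, 4})))" for d e :: int
  proof -
    have residues: "\<forall>d'\<in>{0, 1, 2, 3, 4 :: int}. \<forall>e'\<in>{0, 1, 2, 3, 4 :: int}.
      (((d' + e') mod 5 = 0 \<and> (d' - e') mod 5 = 0) \<longleftrightarrow> (d' = 0 \<and> e' = 0)) \<and>
      (((d' + e') mod 5 = 0 \<or> (d' - e') mod 5 = 0) \<longleftrightarrow> (d' = 0 \<and> e' = 0) \<or>
       (d' \<noteq> 0 \<and> e' \<noteq> 0 \<and> (d' \<in> {1, 4} \<longleftrightarrow> e' \<in> {1, 4})))" by simp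
    have "(d + e) mod 5 = (d mod 5 + e mod 5) mod 5" "(d - e) mod 5 = (d mod 5 - e mod 5) mod 5"
      by (simp_all add: mod_simps)
    moreover have "d mod 5 \<in> {0, 1, 2, 3, 4}" "e mod 5 \<in> {0, 1, 2, 3, 4}" by auto
    ultimately show ?thesis using residues by (simp only:)
  qed
  show ?thesis
  proof (rule perfect_rel_inj_image)
    show "perfect_rel rook (F ` (V \<times> W))" using assms by (intro perfect_rel_rook) simp
    have eq: "p = q \<longleftrightarrow> F p = F q" if pq: "p \<in> V \<times> W" "q \<in> V \<times> W" for p q
    proof -
      have V: "fst p \<in> V" "fst q \<in> V" "snd p \<in> W" "snd q \<in> W" using pq by auto
      show ?thesis
        unfolding prod_eq_iff F C5_embedding_eq_iff[OF assms(3) V(1,2)] C5_embedding_eq_iff[OF assms(4) V(3,4)]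
        using main[of "f (fst p) - f (fst q)" "g (snd p) - g (snd q)"] by simp
    qed
    show "inj_on F (V \<times> W)" by (rule inj_onI) (simp add: eq)
    fix p q assume pq: "p \<in> V \<times> W" "q \<in> V \<times> W"
    have V: "fst p \<in> V" "fst q \<in> V" "snd p \<in> W" "snd q \<in> W" using pq by auto
    let ?d = "f (fst p) - f (fst q)" and ?e = "g (snd p) - g (snd q)"
    have A: "A (fst p) (fst q) \<longleftrightarrow> ?d mod 5 \<in> {1, 4}" using assms(3) V unfolding C5_embedding_def by simp
    have B: "B (snd p) (snd q) \<longleftrightarrow> ?e mod 5 \<in> {1, 4}" using assms(4) V unfolding C5_embedding_def by simp
    show "wprod A B p q \<longleftrightarrow> rook (F p) (F q)"
      unfolding wprod_def A B prod_eq_iff[of "F p"] F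
        C5_embedding_eq_iff[OF assms(3) V(1,2)] C5_embedding_eq_iff[OF assms(4) V(3,4)]
      using main[of ?d ?e] by argo
  qed simp
qed

text \<open>
  Numbering the path by 0 to 3 and calling \<open>c\<close> the centre of the star, 3 colours always suffice:
  one for the centre, and two for the leaves, since two leaves can only be adjacent at path
  vertices of distance at least two. A triangle consists of a centre at 1 or 2 and two leaves at
  its neighbours. Without triangles, a centre at 1 forbids the edges between leaves at 0 and 2,
  a centre at 2 those at 1 and 3, and in each of the four situations the remaining edges admit
  the 2-colouring given by \<open>leaf\<close> and \<open>centre\<close>.
\<close>

lemma perfect_rel_P4_star:
  fixes f :: "'a \<Rightarrow> nat"
  assumes fin: "finite V" "finite W" and sym: "symp A" "symp B"
    and f: "inj_on f V" "f ` V \<subseteq> {0, 1, 2, 3}"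
    and A: "\<And>x y. x \<in> V \<Longrightarrow> y \<in> V \<Longrightarrow> A x y \<longleftrightarrow> f x = Suc (f y) \<or> f y = Suc (f x)"
    and B: "\<And>x y. x \<in> W \<Longrightarrow> y \<in> W \<Longrightarrow> B x y \<longleftrightarrow> x \<noteq> y \<and> (x = c \<or> y = c)"
  shows "perfect_rel (wprod A B) (V \<times> W)"
  unfolding perfect_rel_def
proof (intro conjI allI impI)
  show "finite (V \<times> W)" using fin by simp
  fix T assume T: "T \<subseteq> V \<times> W"
  have f4: "f (fst p) \<in> {0, 1, 2, 3}" if "p \<in> T" for p
  proof -
    have "fst p \<in> V" using that T by auto
    then show ?thesis using f(2) by blast
  qed
  have edge: "wprod A B p q \<longleftrightarrow> f (fst p) \<noteq> f (fst q) \<and> snd p \<noteq> snd q \<and>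
      ((f (fst p) = Suc (f (fst q)) \<or> f (fst q) = Suc (f (fst p))) \<longleftrightarrow> (snd p = c \<or> snd q = c))"
    if pq: "p \<in> T" "q \<in> T" for p q
  proof -
    have V: "fst p \<in> V" "fst q \<in> V" "snd p \<in> W" "snd q \<in> W" using pq T by auto
    then show ?thesis
      using inj_on_eq_iff[OF f(1) V(1,2)] unfolding wprod_def A[OF V(1,2)] B[OF V(3,4)] by auto
  qed
  show "clique_colourable (wprod A B) T"
  proof (cases "\<exists>C\<subseteq>T. clique_on (wprod A B) C \<and> card C = 3")
    case True
    then obtain C where C: "C \<subseteq> T" "clique_on (wprod A B) C" "card C = 3" by blast
    show ?thesis
    proof (rule clique_colourableI[OF C(1,2)])
      show "proper_colouring (wprod A B) T 3
        (\<lambda>p. if snd p = c then 2 else if f (fst p) \<le> 1 then 0 else 1)"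
        unfolding proper_colouring_def
      proof (intro conjI ballI impI)
        fix p q assume pq: "p \<in> T" "q \<in> T" "wprod A B p q"
        then show "(if snd p = c then 2 else if f (fst p) \<le> 1 then 0 else 1) \<noteq>
          (if snd q = c then 2 else if f (fst q) \<le> 1 then 0 else 1 :: nat)"
          using edge[OF pq(1,2)] f4[OF pq(1)] f4[OF pq(2)] by auto
      qed simp
    qed (use C in simp)
  next
    case False
    define c1 where "c1 \<longleftrightarrow> (\<exists>p\<in>T. snd p = c \<and> f (fst p) = 1)"
    define c2 where "c2 \<longleftrightarrow> (\<exists>p\<in>T. snd p = c \<and> f (fst p) = 2)"
    define leaf where "leaf (n :: nat) \<longleftrightarrow> (if c1 \<and> c2 then n \<in> {0, 2} else if c1 then n \<in> {0, 1, 2}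
      else if c2 then n \<in> {1, 2, 3} else n \<in> {0, 1})" for n
    define centre where "centre (n :: nat) \<longleftrightarrow> (if c1 \<and> c2 then n \<in> {0, 2} else if c1 \<or> c2 then False
      else n = 3)" for n
    have no_triangle: False
      if "m \<in> T" "p \<in> T" "q \<in> T" "wprod A B m p" "wprod A B m q" "wprod A B p q" for m p q
    proof -
      have "clique_on (wprod A B) {m, p, q}"
        using that wprod_sym[OF sym] unfolding clique_on_def by auto
      moreover have "m \<noteq> p" "m \<noteq> q" "p \<noteq> q" using that(4-6) unfolding wprod_def by auto
      then have "card {m, p, q} = 3" by simp
      ultimately show False using False that by (metis bot.extremum insert_subset)
    qed
    have c1: "snd p = snd q \<or> snd p = c \<or> snd q = c"
      if pq: "c1" "p \<in> T" "q \<in> T" "f (fst p) = 0" "f (fst q) = 2" for p q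
    proof (rule ccontr)
      assume neq: "\<not> ?thesis"
      obtain m where m: "m \<in> T" "snd m = c" "f (fst m) = 1" using pq(1) unfolding c1_def by blast
      show False by (rule no_triangle[of m p q]) (use pq m neq edge in auto)
    qed
    have c2: "snd p = snd q \<or> snd p = c \<or> snd q = c"
      if pq: "c2" "p \<in> T" "q \<in> T" "f (fst p) = 1" "f (fst q) = 3" for p q
    proof (rule ccontr)
      assume neq: "\<not> ?thesis"
      obtain m where m: "m \<in> T" "snd m = c" "f (fst m) = 2" using pq(1) unfolding c2_def by blast
      show False by (rule no_triangle[of m p q]) (use pq m neq edge in auto)
    qed
    define col where "col p = (if snd p = c then centre (f (fst p)) else leaf (f (fst p)))" for p
    have ll: "col p \<noteq> col q"
      if pq: "p \<in> T" "q \<in> T" "wprod A B p q" "snd p \<noteq> c" "snd q \<noteq> c" "f (fst p) < f (fst q)" for p q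
    proof -
      have "snd p \<noteq> snd q" "f (fst q) \<noteq> Suc (f (fst p))" using edge[OF pq(1,2)] pq by auto
      then have "(f (fst p), f (fst q)) \<in> {(0, 2), (0, 3), (1, 3)}"
        using f4[OF pq(1)] f4[OF pq(2)] pq by auto
      then show ?thesis
        using c1[OF _ pq(1,2)] c2[OF _ pq(1,2)] \<open>snd p \<noteq> snd q\<close> pq(4,5)
        unfolding col_def leaf_def by auto
    qed
    have cl: "col p \<noteq> col q"
      if pq: "p \<in> T" "q \<in> T" "wprod A B p q" "snd p = c" "snd q \<noteq> c" for p q
    proof -
      have "f (fst p) = Suc (f (fst q)) \<or> f (fst q) = Suc (f (fst p))" using edge[OF pq(1,2)] pq by auto
      moreover have "f (fst p) = 1 \<Longrightarrow> c1" "f (fst p) = 2 \<Longrightarrow> c2" using pq unfolding c1_def c2_def by auto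
      moreover have "(f (fst p), f (fst q)) \<in> {(0, 1), (1, 0), (1, 2), (2, 1), (2, 3), (3, 2)}"
        using f4[OF pq(1)] f4[OF pq(2)] calculation(1) by (elim insertE emptyE disjE) simp_all
      ultimately have "centre (f (fst p)) \<noteq> leaf (f (fst q))"
        unfolding leaf_def centre_def by (cases c1; cases c2) auto
      then show ?thesis using pq(4,5) unfolding col_def by simp
    qed
    show ?thesis
    proof (rule clique_colourable_bipartite)
      fix p q assume pq: "p \<in> T" "q \<in> T" "wprod A B p q"
      have "wprod A B q p" using wprod_sym[OF sym pq(3)] .
      moreover have "f (fst p) \<noteq> f (fst q)" "snd p \<noteq> snd q" using edge[OF pq(1,2)] pq(3) by auto
      ultimately show "col p \<noteq> col q"
        using ll[of p q] ll[of q p] cl[of p q] cl[of q p] pq by (metis linorder_neqE_nat)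
    qed (use wprod_sym[OF sym] in blast)
  qed
qed


text \<open>
  The vertices lie in two rows, distinguished by \<open>s\<close>, and in columns, numbered by \<open>h\<close>; a block
  is the part of a row in a column. There are all edges between blocks in different rows and
  columns and none between blocks of one row, while two blocks in a column are either not joined
  at all or form a bipartite graph of a special kind, where only leaves are joined to leaves of
  the other row.

  Let \<open>w b i\<close> be the clique number of the block in row \<open>b\<close> and column \<open>i\<close>. If the two rows
  attain their maximal values in different columns, then the sum of the maxima is the clique
  number, and the rows can be coloured with disjoint sets of colours. Otherwise both maxima are
  attained in the same column \<open>i\<close> only; let \<open>v b\<close> be the maximum over the other columns. There
  are cliques of size \<open>w b i + v (\<not> b)\<close> for both rows \<open>b\<close>, and colours are saved in column
  \<open>i\<close>: if its blocks are not joined, then the block of row \<open>\<not> b\<close> may reuse the colours of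
  row \<open>b\<close> that the other columns do not use. In the special case all clique numbers are at most
  2, and few configurations remain.
\<close>

lemma clique_colourable_crossed:
  fixes s leaf :: "'a \<Rightarrow> bool" and h :: "'a \<Rightarrow> 'i"
  assumes fin: "finite T" and sym: "\<And>x y. R x y \<Longrightarrow> R y x"
    and same_side: "\<And>x y. x \<in> T \<Longrightarrow> y \<in> T \<Longrightarrow> s x = s y \<Longrightarrow> R x y \<Longrightarrow> h x = h y"
    and other_side: "\<And>x y. x \<in> T \<Longrightarrow> y \<in> T \<Longrightarrow> s x \<noteq> s y \<Longrightarrow> h x \<noteq> h y \<Longrightarrow> R x y"
    and blocks: "\<And>b i. clique_colourable R {x\<in>T. s x = b \<and> h x = i}"
    and block_pair: "\<And>i. (\<forall>x\<in>T. \<forall>y\<in>T. h x = i \<longrightarrow> h y = i \<longrightarrow> s x \<noteq> s y \<longrightarrow> \<not> R x y) \<or>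
      (\<forall>x\<in>T. \<forall>y\<in>T. h x = i \<longrightarrow> h y = i \<longrightarrow> R x y \<longrightarrow>
         (if s x = s y then leaf x \<noteq> leaf y else leaf x \<and> leaf y))"
  shows "clique_colourable R T"
proof (cases "T = {}")
  case True
  then show ?thesis by (intro clique_colourable_edgeless) auto
next
  case False
  define B where "B b i = {x\<in>T. s x = b \<and> h x = i}" for b i
  have "\<exists>K c. K \<subseteq> B b i \<and> clique_on R K \<and> proper_colouring R (B b i) (card K) c" for b i
    using blocks[of b i] unfolding clique_colourable_def B_def by blast
  then obtain K c where K: "\<And>b i. K b i \<subseteq> B b i" "\<And>b i. clique_on R (K b i)"
    and c: "\<And>b i. proper_colouring R (B b i) (card (K b i)) (c b i)" by metis
  define w where "w b i = card (K b i)" for b i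
  define col where "col x = c (s x) (h x) x" for x
  have col_lt: "col x < w (s x) (h x)" if "x \<in> T" for x
    using c[of "s x" "h x"] that unfolding proper_colouring_def B_def col_def w_def by simp
  have col_neq: "col x \<noteq> col y" if "x \<in> T" "y \<in> T" "s x = s y" "R x y" for x y
    using c[of "s x" "h x"] same_side[OF that] that unfolding proper_colouring_def B_def col_def by simp
  have finK: "finite (K b i)" for b i
    using K(1)[of b i] fin unfolding B_def by (auto intro: finite_subset)
  have KT: "K b i \<subseteq> T" for b i using K(1)[of b i] unfolding B_def by auto
  have cross: "K b i \<union> K (\<not> b) j \<subseteq> T \<and> clique_on R (K b i \<union> K (\<not> b) j) \<and>
      card (K b i \<union> K (\<not> b) j) = w b i + w (\<not> b) j" if "i \<noteq> j" for b i j
  proof (intro conjI)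
    have mem: "x \<in> T \<and> s x = b' \<and> h x = i'" if "x \<in> K b' i'" for x b' i'
      using K(1)[of b' i'] that unfolding B_def by auto
    show "clique_on R (K b i \<union> K (\<not> b) j)"
    proof (rule clique_on_Un[OF K(2) K(2)])
      fix x y assume "x \<in> K b i" "y \<in> K (\<not> b) j"
      then have "R x y" using mem[of x b i] mem[of y "\<not> b" j] other_side[of x y] \<open>i \<noteq> j\<close> by auto
      then show "R x y \<and> R y x" using sym by blast
    qed
    have "K b i \<inter> K (\<not> b) j = {}" using mem[of _ b i] mem[of _ "\<not> b" j] by auto
    then show "card (K b i \<union> K (\<not> b) j) = w b i + w (\<not> b) j"
      using finK by (simp add: card_Un_disjoint w_def)
  qed (use KT in blast)
  have fin_h: "finite (h ` T)" "h ` T \<noteq> {}" using fin False by auto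
  have "\<exists>m. m \<in> h ` T \<and> (\<forall>j\<in>h ` T. w b j \<le> w b m)" for b
    using finite_obtain_max[OF fin_h, of "w b"] by metis
  then obtain m where m: "\<And>b. m b \<in> h ` T" "\<And>b j. j \<in> h ` T \<Longrightarrow> w b j \<le> w b (m b)" by metis
  show ?thesis
  proof (cases "(\<exists>b. w b (m b) = 0) \<or>
      (\<exists>i\<in>h ` T. \<exists>j\<in>h ` T. i \<noteq> j \<and> w True i = w True (m True) \<and> w False j = w False (m False))")
    case True
    have "proper_colouring R T (w True (m True) + w False (m False))
        (\<lambda>x. if s x then col x else w True (m True) + col x)"
      unfolding proper_colouring_def
    proof (intro conjI ballI impI)
      fix x assume x: "x \<in> T"
      have lt: "col z < w (s z) (m (s z))" if "z \<in> T" for z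
        using col_lt[OF that] m(2)[of "h z" "s z"] that by simp
      show "(if s x then col x else w True (m True) + col x) < w True (m True) + w False (m False)"
        using lt[OF x] by (cases "s x") auto
      fix y assume y: "y \<in> T" "R x y"
      show "(if s x then col x else w True (m True) + col x) \<noteq>
          (if s y then col y else w True (m True) + col y)"
        using lt[OF x] lt[OF y(1)] col_neq[OF x y(1) _ y(2)] by (cases "s x"; cases "s y") auto
    qed
    moreover have "\<exists>C\<subseteq>T. clique_on R C \<and> card C = w True (m True) + w False (m False)"
      using True
    proof (elim disjE exE bexE conjE)
      fix b assume "w b (m b) = 0"
      then show ?thesis
        using KT[of "\<not> b" "m (\<not> b)"] K(2)[of "\<not> b" "m (\<not> b)"]
        by (intro exI[of _ "K (\<not> b) (m (\<not> b))"]) (cases b; simp add: w_def)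
    next
      fix i j assume "i \<noteq> j" "w True i = w True (m True)" "w False j = w False (m False)"
      then show ?thesis using cross[of i j True] by (intro exI[of _ "K True i \<union> K False j"]) simp
    qed
    ultimately show ?thesis using clique_colourableI by (metis order_refl)
  next
    case no_pair: False
    define i where "i = m True"
    have "m False = m True" using no_pair m(1)[of True] m(1)[of False] by metis
    then have mi: "m b = i" for b unfolding i_def by (cases b) simp_all
    have pos: "0 < w b i" for b using no_pair mi by (metis gr0I)
    have iT: "i \<in> h ` T" using m(1) unfolding i_def .
    have less: "w b j < w b i" if "j \<in> h ` T" "j \<noteq> i" for b j
    proof -
      have "w b j \<noteq> w b i"
        using no_pair that iT unfolding mi by (cases b) metis+
      then show ?thesis using m(2)[OF that(1), of b] unfolding mi by simp
    qed
    \<comment> \<open>The maximum over the columns other than \<open>i\<close>, or 0 if there are none.\<close>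
    have "\<exists>v j. (\<forall>l\<in>h ` T. l \<noteq> i \<longrightarrow> w b l \<le> v) \<and> (v = 0 \<or> j \<in> h ` T \<and> j \<noteq> i \<and> w b j = v)" for b
    proof (cases "h ` T - {i} = {}")
      case False
      then obtain j where "j \<in> h ` T - {i}" "\<And>l. l \<in> h ` T - {i} \<Longrightarrow> w b l \<le> w b j"
        using finite_obtain_max[of "h ` T - {i}" "w b"] fin_h by auto
      then show ?thesis by (intro exI[of _ "w b j"] exI[of _ j]) auto
    qed auto
    then obtain v j where v: "\<And>b l. l \<in> h ` T \<Longrightarrow> l \<noteq> i \<Longrightarrow> w b l \<le> v b"
      and vj: "\<And>b. v b = 0 \<or> j b \<in> h ` T \<and> j b \<noteq> i \<and> w b (j b) = v b" by metis
    have v_less: "v b < w b i" for b using vj[of b] less[of "j b" b] pos[of b] by auto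
    have big: "\<exists>C\<subseteq>T. clique_on R C \<and> card C = w b i + v (\<not> b)" for b
    proof (cases "v (\<not> b) = 0")
      case True
      then show ?thesis using KT[of b i] K(2)[of b i] by (intro exI[of _ "K b i"]) (simp add: w_def)
    next
      case False
      then show ?thesis
        using vj[of "\<not> b"] cross[of i "j (\<not> b)" b] by (intro exI[of _ "K b i \<union> K (\<not> b) (j (\<not> b))"]) auto
    qed
    have col_v: "col x < v (s x)" if "x \<in> T" "h x \<noteq> i" for x
      using col_lt[OF that(1)] v[of "h x" "s x"] that by simp
    have col_w: "col x < w (s x) i" if "x \<in> T" for x
      using col_lt[OF that] m(2)[of "h x" "s x"] that unfolding mi by simp
    show ?thesis
    proof (cases "\<forall>x\<in>T. \<forall>y\<in>T. h x = i \<longrightarrow> h y = i \<longrightarrow> s x \<noteq> s y \<longrightarrow> \<not> R x y")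
      case apart: True
      \<comment> \<open>Row \<open>b\<close> is chosen such that the larger of the two cliques meets it in column \<open>i\<close>.\<close>
      obtain b where b: "v b + w (\<not> b) i \<le> w b i + v (\<not> b)"
      proof (cases "v True + w False i \<le> w True i + v False")
        case True
        then show ?thesis using that[of True] by simp
      next
        case False
        then show ?thesis using that[of False] by simp
      qed
      have "proper_colouring R T (w b i + v (\<not> b))
          (\<lambda>x. if s x = b then col x else if h x = i then v b + col x else w b i + col x)"
        (is "proper_colouring R T ?k ?c")
        unfolding proper_colouring_def
      proof (intro conjI ballI impI)
        fix x assume x: "x \<in> T"
        show "?c x < ?k"
        proof (cases "s x = b")
          case True
          then show ?thesis using col_w[OF x] by simp
        next
          case False
          then have "s x = (\<not> b)" by simp
          then show ?thesis using col_w[OF x] col_v[OF x] b by simp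
        qed
        have cross_neq: "?c x \<noteq> ?c y" if "x \<in> T" "y \<in> T" "R x y" "s x = b" "s y \<noteq> b" for x y
        proof (cases "h y = i")
          case True
          then have "h x \<noteq> i" using apart that by auto
          then show ?thesis using True that col_v[of x] by auto
        next
          case False
          then show ?thesis using that col_w[of x] by auto
        qed
        fix y assume y: "y \<in> T" "R x y"
        show "?c x \<noteq> ?c y"
        proof (cases "s x = s y")
          case True
          then show ?thesis using col_neq[OF x y(1) True y(2)] same_side[OF x y(1) True y(2)] by auto
        next
          case False
          show ?thesis
          proof (cases "s x = b")
            case True
            then show ?thesis using cross_neq[of x y] x y False by blast
          next
            case sxb: False
            then have "?c y \<noteq> ?c x" using cross_neq[of y x] x y(1) sym[OF y(2)] False by blast
            then show ?thesis by simp
          qed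
        qed
      qed
      moreover obtain C where "C \<subseteq> T" "clique_on R C" "card C = w b i + v (\<not> b)" using big[of b] by blast
      ultimately show ?thesis using clique_colourableI[of C T R] by simp
    next
      case False
      then have star: "if s x = s y then leaf x \<noteq> leaf y else leaf x \<and> leaf y"
        if "x \<in> T" "y \<in> T" "h x = i" "h y = i" "R x y" for x y
        using block_pair[of i] that by blast
      have w2: "w b i \<le> 2" for b
      proof -
        have "proper_colouring R (K b i) 2 (\<lambda>x. of_bool (leaf x))"
          unfolding proper_colouring_def
        proof (intro conjI ballI impI)
          fix x y assume xy: "x \<in> K b i" "y \<in> K b i" "R x y"
          then have "x \<in> B b i" "y \<in> B b i" using K(1) by blast+
          then have "leaf x \<noteq> leaf y" using star[of x y] xy unfolding B_def by auto
          then show "of_bool (leaf x) \<noteq> (of_bool (leaf y) :: nat)" by simp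
        qed simp
        then show ?thesis unfolding w_def using clique_card_le_colours K(2) by blast
      qed
      \<comment> \<open>A block that is coloured with one colour has no edges.\<close>
      have small: "\<not> R x y" if "x \<in> T" "y \<in> T" "s x = s y" "w (s x) (h x) \<le> 1" for x y
      proof
        assume "R x y"
        then have "col x \<noteq> col y" "h x = h y" using col_neq same_side that by auto
        then show False using col_lt[OF that(1)] col_lt[OF that(2)] that(3,4) by simp
      qed
      have v1: "v b \<le> 1" for b using v_less[of b] w2[of b] by simp
      have outside: "\<not> R x y" if "x \<in> T" "y \<in> T" "s x = s y" "h x \<noteq> i" for x y
        using small[OF that(1-3)] v[of "h x" "s x"] v1[of "s x"] that by force
      show ?thesis
      proof (cases "\<forall>b. v b = 0")
        case True
        then have all_i: "h x = i" if "x \<in> T" for x using col_v[OF that] by auto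
        show ?thesis
        proof (rule clique_colourable_bipartite[of R T "\<lambda>x. s x = leaf x"])
          fix x y assume "x \<in> T" "y \<in> T" "R x y"
          then show "(s x = leaf x) \<noteq> (s y = leaf y)" using star[of x y] all_i by (auto split: if_splits)
        qed fact
      next
        case v_pos: False
        then obtain b where b: "v b = 1" using v1 by (metis le_neq_implies_less less_one)
        then have wb: "w b i = 2" using v_less[of b] w2[of b] by simp
        show ?thesis
        proof (cases "w (\<not> b) i = 2")
          case True
          obtain C where C: "C \<subseteq> T" "clique_on R C" "card C = 3"
            using big[of "\<not> b"] b True by auto
          show ?thesis
          proof (rule clique_colourableI[OF C(1,2)])
            \<comment> \<open>Outside column \<open>i\<close> the rows have colours 1 and 0. In column \<open>i\<close>, the leaves of one row
              and the nonleaves of the other get colour 2.\<close>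
            let ?c = "\<lambda>x. if h x = i \<and> s x = leaf x then 2 else of_bool (s x) :: nat"
            show "proper_colouring R T 3 ?c"
              unfolding proper_colouring_def
            proof (intro conjI ballI impI)
              fix x y assume xy: "x \<in> T" "y \<in> T" "R x y"
              show "?c x \<noteq> ?c y"
              proof (cases "h x = i \<and> h y = i")
                case True
                then have "if s x = s y then leaf x \<noteq> leaf y else leaf x \<and> leaf y"
                  using star[OF xy(1,2) _ _ xy(3)] by simp
                then show ?thesis
                  using True by (cases "s x"; cases "s y"; cases "leaf x"; cases "leaf y") simp_all
              next
                case False
                then have "s x \<noteq> s y" using outside[of x y] outside[of y x] xy sym by metis
                then show ?thesis using False by auto
              qed
            qed auto
          qed (use C in simp)
        next
          case False
          then have w1: "w (\<not> b) i = 1" "v (\<not> b) = 0" using w2[of "\<not> b"] pos[of "\<not> b"] v_less[of "\<not> b"] by auto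
          obtain C where C: "C \<subseteq> T" "clique_on R C" "card C = 2"
            using big[of b] w1 wb by auto
          \<comment> \<open>The row other than \<open>b\<close> lies in column \<open>i\<close> and is stable.\<close>
          have other_i: "h x = i" if "x \<in> T" "s x \<noteq> b" for x
            using col_v[OF that(1)] w1(2) that(2) by (cases "s x"; cases b) auto
          have other_free: "\<not> R x y" if "x \<in> T" "y \<in> T" "s x \<noteq> b" "s y \<noteq> b" for x y
          proof -
            have "s x = s y" "s x = (\<not> b)" using that by auto
            then show ?thesis using small[OF that(1,2)] w1(1) other_i[OF that(1,3)] by simp
          qed
          show ?thesis
          proof (rule clique_colourable_bipartite[of R T "\<lambda>x. s x = b \<and> (h x = i \<longrightarrow> leaf x)"])
            fix x y assume xy: "x \<in> T" "y \<in> T" "R x y"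
            have half: "(s x = b \<and> (h x = i \<longrightarrow> leaf x)) \<noteq> (s y = b \<and> (h y = i \<longrightarrow> leaf y))"
              if "x \<in> T" "y \<in> T" "R x y" "s x = b" for x y
            proof (cases "s y = b")
              case True
              then have "h x = i" "h y = i"
                using outside[of x y] outside[of y x] that sym by metis+
              then show ?thesis using star[of x y] that True by auto
            next
              case False
              then show ?thesis using star[of x y] other_i[of y] that by auto
            qed
            show "(s x = b \<and> (h x = i \<longrightarrow> leaf x)) \<noteq> (s y = b \<and> (h y = i \<longrightarrow> leaf y))"
              using half[of x y] half[of y x] other_free[of x y] xy sym by metis
          qed fact
        qed
      qed
    qed
  qed
qed

text \<open>
  The rows of \<open>clique_colourable_crossed\<close> are the two cliques of the first factor, the columns
  the components of the second. A component that is a clique gives two blocks without edges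
  between them, each the complement of a rook's graph; a star gives two bipartite blocks.
\<close>

lemma perfect_rel_two_cliques_stars_cliques:
  fixes f :: "'a \<Rightarrow> bool" and h :: "'b \<Rightarrow> 'i"
  assumes fin: "finite V" "finite W" and sym: "symp A" "symp B"
    and A: "\<And>x y. x \<in> V \<Longrightarrow> y \<in> V \<Longrightarrow> x \<noteq> y \<Longrightarrow> A x y \<longleftrightarrow> f x = f y"
    and h: "\<And>x y. x \<in> W \<Longrightarrow> y \<in> W \<Longrightarrow> B x y \<Longrightarrow> h x = h y"
    and B: "\<And>i. (\<forall>x\<in>W. \<forall>y\<in>W. h x = i \<longrightarrow> h y = i \<longrightarrow> x \<noteq> y \<longrightarrow> B x y) \<or>
      (\<exists>z. \<forall>x\<in>W. \<forall>y\<in>W. h x = i \<longrightarrow> h y = i \<longrightarrow> x \<noteq> y \<longrightarrow> (B x y \<longleftrightarrow> x = z \<or> y = z))"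
  shows "perfect_rel (wprod A B) (V \<times> W)"
proof -
  define clique where "clique i \<longleftrightarrow> (\<forall>x\<in>W. \<forall>y\<in>W. h x = i \<longrightarrow> h y = i \<longrightarrow> x \<noteq> y \<longrightarrow> B x y)" for i
  \<comment> \<open>An arbitrary centre is chosen for components that are cliques.\<close>
  have "\<exists>z. \<not> clique i \<longrightarrow> (\<forall>x\<in>W. \<forall>y\<in>W. h x = i \<longrightarrow> h y = i \<longrightarrow> x \<noteq> y \<longrightarrow> (B x y \<longleftrightarrow> x = z \<or> y = z))" for i
    using B[of i] unfolding clique_def by (elim disjE exE) auto
  then obtain z where z: "\<And>i. \<not> clique i \<longrightarrow> (\<forall>x\<in>W. \<forall>y\<in>W. h x = i \<longrightarrow> h y = i \<longrightarrow> x \<noteq> y \<longrightarrow> (B x y \<longleftrightarrow> x = z i \<or> y = z i))"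
    by metis
  have Bc: "B x y" if "clique (h x)" "x \<in> W" "y \<in> W" "h x = h y" "x \<noteq> y" for x y
    using that unfolding clique_def by auto
  have Bs: "B x y \<longleftrightarrow> x = z (h x) \<or> y = z (h x)" if "\<not> clique (h x)" "x \<in> W" "y \<in> W" "h x = h y" "x \<noteq> y" for x y
    using z[of "h x"] that by auto
  show ?thesis
    unfolding perfect_rel_def
  proof (intro conjI allI impI)
    show fin': "finite (V \<times> W)" using fin by simp
    fix T assume T: "T \<subseteq> V \<times> W"
    have mem: "fst p \<in> V" "snd p \<in> W" if "p \<in> T" for p using that T by auto
    show "clique_colourable (wprod A B) T"
    proof (rule clique_colourable_crossed[where s = "\<lambda>p. f (fst p)" and h = "\<lambda>p. h (snd p)"
          and leaf = "\<lambda>p. snd p \<noteq> z (h (snd p))"])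
      show "finite T" using T fin' by (rule finite_subset)
      fix p q
      show "wprod A B q p" if "wprod A B p q" using wprod_sym[OF sym that] .
      assume pq: "p \<in> T" "q \<in> T"
      note V = mem[OF pq(1)] mem[OF pq(2)]
      show "h (snd p) = h (snd q)" if "f (fst p) = f (fst q)" "wprod A B p q"
        using that A[OF V(1,3)] h[OF V(2,4)] unfolding wprod_def by auto
      show "wprod A B p q" if "f (fst p) \<noteq> f (fst q)" "h (snd p) \<noteq> h (snd q)"
        using that A[OF V(1,3)] h[OF V(2,4)] unfolding wprod_def by metis
    next
      fix b i
      let ?S = "{p \<in> T. f (fst p) = b \<and> h (snd p) = i}"
      have finS: "finite ?S" using finite_subset[OF T fin'] by simp
      show "clique_colourable (wprod A B) ?S"
      proof (cases "clique i")
        case True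
        have "perfect_rel (wprod A B) ?S"
        proof (rule perfect_rel_cong[OF perfect_rel_co_rook[OF finS]])
          fix p q assume pq: "p \<in> ?S" "q \<in> ?S"
          then have V: "fst p \<in> V" "snd p \<in> W" "fst q \<in> V" "snd q \<in> W" using mem by auto
          show "wprod A B p q \<longleftrightarrow> co_rook p q"
            using A[OF V(1,3)] Bc[OF _ V(2,4)] pq True unfolding wprod_def by auto
        qed
        then show ?thesis by (rule perfect_relD) simp
      next
        case False
        show ?thesis
        proof (rule clique_colourable_bipartite[where p = "\<lambda>p. snd p = z i"])
          fix p q assume pq: "p \<in> ?S" "q \<in> ?S" "wprod A B p q"
          then have V: "fst p \<in> V" "snd p \<in> W" "fst q \<in> V" "snd q \<in> W" using mem by auto
          show "(snd p = z i) \<noteq> (snd q = z i)"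
            using A[OF V(1,3)] Bs[OF _ V(2,4)] pq False unfolding wprod_def by auto
        qed (use wprod_sym[OF sym] in blast)
      qed
    next
      fix i
      show "(\<forall>p\<in>T. \<forall>q\<in>T. h (snd p) = i \<longrightarrow> h (snd q) = i \<longrightarrow> f (fst p) \<noteq> f (fst q) \<longrightarrow> \<not> wprod A B p q) \<or>
        (\<forall>p\<in>T. \<forall>q\<in>T. h (snd p) = i \<longrightarrow> h (snd q) = i \<longrightarrow> wprod A B p q \<longrightarrow>
         (if f (fst p) = f (fst q) then (snd p \<noteq> z (h (snd p))) \<noteq> (snd q \<noteq> z (h (snd q)))
          else snd p \<noteq> z (h (snd p)) \<and> snd q \<noteq> z (h (snd q))))"
      proof (cases "clique i")
        case True
        then show ?thesis
          using A Bc mem unfolding wprod_def by (intro disjI1 ballI impI) auto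
      next
        case False
        show ?thesis
        proof (intro disjI2 ballI impI)
          fix p q assume pq: "p \<in> T" "q \<in> T" "h (snd p) = i" "h (snd q) = i" "wprod A B p q"
          note V = mem[OF pq(1)] mem[OF pq(2)]
          show "if f (fst p) = f (fst q) then (snd p \<noteq> z (h (snd p))) \<noteq> (snd q \<noteq> z (h (snd q)))
              else snd p \<noteq> z (h (snd p)) \<and> snd q \<noteq> z (h (snd q))"
            using A[OF V(1,3)] Bs[OF _ V(2,4)] pq False unfolding wprod_def by auto
        qed
      qed
    qed
  qed
qed

section \<open>Adjacency, products and complements\<close>

abbreviation adj :: "'a graph \<Rightarrow> 'a \<Rightarrow> 'a \<Rightarrow> bool" where
  "adj G x y \<equiv> {x, y} \<in> edges G"

lemma adj_commute: "adj G x y \<longleftrightarrow> adj G y x"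
  by (simp add: insert_commute)

lemma symp_adj: "symp (adj G)"
  by (simp add: symp_def insert_commute)

lemma simple_graph_finite: "simple_graph G \<Longrightarrow> finite (verts G)"
  by (simp add: simple_graph_def)

lemma simple_graph_adjD:
  assumes "simple_graph G" "adj G x y"
  shows "x \<in> verts G" "y \<in> verts G" "x \<noteq> y"
proof -
  have "{x, y} \<in> {{x, y} | x y. x \<in> verts G \<and> y \<in> verts G \<and> x \<noteq> y}"
    using assms unfolding simple_graph_def by blast
  then show "x \<in> verts G" "y \<in> verts G" "x \<noteq> y" by (auto simp: doubleton_eq_iff)
qed

lemma adj_irrefl: "simple_graph G \<Longrightarrow> \<not> adj G x x"
  using simple_graph_adjD(3)[of G x x] by blast

lemma no_loop: "simple_graph G \<Longrightarrow> {x} \<notin> edges G"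
  using adj_irrefl[of G x] by simp

lemma simple_graph_edgesE:
  assumes "simple_graph G" "e \<in> edges G"
  obtains x y where "e = {x, y}" "x \<in> verts G" "y \<in> verts G" "x \<noteq> y"
  using assms unfolding simple_graph_def by blast

lemma adj_complement:
  "adj (graph_complement G) x y \<longleftrightarrow> x \<in> verts G \<and> y \<in> verts G \<and> x \<noteq> y \<and> \<not> adj G x y"
  unfolding graph_complement_def by (auto simp: doubleton_eq_iff insert_commute)

lemma verts_complement [simp]: "verts (graph_complement G) = verts G"
  unfolding graph_complement_def by simp

lemma simple_graph_complement [simp]: "simple_graph G \<Longrightarrow> simple_graph (graph_complement G)"
  unfolding simple_graph_def graph_complement_def by auto

lemma graph_complement_complement:
  assumes "simple_graph G"
  shows "graph_complement (graph_complement G) = G"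
proof (rule graph.expand, intro conjI)
  show "edges (graph_complement (graph_complement G)) = edges G"
  proof (intro set_eqI iffI)
    fix e assume "e \<in> edges (graph_complement (graph_complement G))"
    moreover from this obtain x y where "e = {x, y}"
      using simple_graph_edgesE[OF simple_graph_complement[OF simple_graph_complement[OF assms]]] by metis
    ultimately show "e \<in> edges G" by (auto simp: adj_complement)
  next
    fix e assume "e \<in> edges G"
    then obtain x y where "e = {x, y}" "x \<in> verts G" "y \<in> verts G" "x \<noteq> y"
      using simple_graph_edgesE[OF assms] by metis
    then show "e \<in> edges (graph_complement (graph_complement G))"
      using \<open>e \<in> edges G\<close> by (simp add: adj_complement)
  qed
qed simp

lemma verts_induced [simp]: "verts (induced_graph G S) = S"
  unfolding induced_graph_def by simp

lemma adj_induced: "adj (induced_graph G S) x y \<longleftrightarrow> adj G x y \<and> x \<in> S \<and> y \<in> S"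
  unfolding induced_graph_def by auto

lemma chromatic_number_eq_clique_number_iff:
  assumes fin: "finite S" and irrefl: "\<And>x. \<not> adj G x x"
  shows "chromatic_number (induced_graph G S) = clique_number (induced_graph G S) \<longleftrightarrow>
    clique_colourable (adj G) S"
proof -
  have col: "colourable (induced_graph G S) k \<longleftrightarrow> (\<exists>c. proper_colouring (adj G) S k c)" for k
    unfolding colourable_def proper_colouring_def adj_induced by auto
  have cl: "is_clique (induced_graph G S) C \<longleftrightarrow> C \<subseteq> S \<and> clique_on (adj G) C" for C
    unfolding is_clique_def clique_on_def adj_induced by auto
  obtain M where M: "maximum_clique (adj G) S M" using maximum_clique_exists[OF fin] .
  then have M': "M \<subseteq> S" "clique_on (adj G) M" unfolding maximum_clique_def by auto
  have \<omega>: "clique_number (induced_graph G S) = card M"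
    unfolding clique_number_def
  proof (rule Max_eqI)
    have "{C. is_clique (induced_graph G S) C} \<subseteq> Pow S" using cl by auto
    then show "finite (card ` {C. is_clique (induced_graph G S) C})"
      using fin finite_subset by blast
  qed (use M in \<open>auto simp: cl maximum_clique_def\<close>)
  obtain f where f: "bij_betw f S {..<card S}"
    using ex_bij_betw_finite_nat[OF fin] by (auto simp: lessThan_atLeast0)
  have "proper_colouring (adj G) S (card S) f"
    unfolding proper_colouring_def
  proof (intro conjI ballI impI)
    fix x assume x: "x \<in> S"
    then show "f x < card S" using f bij_betwE by blast
    fix y assume y: "y \<in> S" "adj G x y"
    then have "x \<noteq> y" using irrefl by auto
    then show "f x \<noteq> f y" using f x y by (auto simp: bij_betw_def inj_on_def)
  qed
  then have some: "colourable (induced_graph G S) (card S)" using col by blast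
  show ?thesis
  proof
    assume "chromatic_number (induced_graph G S) = clique_number (induced_graph G S)"
    then have "colourable (induced_graph G S) (card M)"
      using LeastI[of "colourable (induced_graph G S)", OF some] unfolding chromatic_number_def \<omega> by simp
    then obtain c where "proper_colouring (adj G) S (card M) c" using col by blast
    then show "clique_colourable (adj G) S" using M' by (intro clique_colourableI[of M S]) auto
  next
    assume "clique_colourable (adj G) S"
    then obtain C c where C: "C \<subseteq> S" "clique_on (adj G) C" "proper_colouring (adj G) S (card C) c"
      unfolding clique_colourable_def by blast
    have "card M \<le> card C" using clique_card_le_colours[OF C(3)] M unfolding maximum_clique_def by blast
    then have eq: "card C = card M" using M C unfolding maximum_clique_def by (simp add: le_antisym)
    show "chromatic_number (induced_graph G S) = clique_number (induced_graph G S)"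
      unfolding chromatic_number_def \<omega>
    proof (rule Least_equality)
      show "colourable (induced_graph G S) (card M)" using C(3) col unfolding eq by blast
      fix k assume "colourable (induced_graph G S) k"
      then obtain c' where "proper_colouring (adj G) S k c'" using col by blast
      then show "card M \<le> k" using M' by (rule clique_card_le_colours)
    qed
  qed
qed

lemma perfect_iff_perfect_rel:
  assumes "finite (verts G)" "\<And>x. \<not> adj G x x"
  shows "perfect G \<longleftrightarrow> perfect_rel (adj G) (verts G)"
proof -
  have "chromatic_number (induced_graph G S) = clique_number (induced_graph G S) \<longleftrightarrow>
      clique_colourable (adj G) S" if "S \<subseteq> verts G" for S
    using chromatic_number_eq_clique_number_iff[of S G] assms finite_subset[OF that] by blast
  then show ?thesis unfolding perfect_def perfect_rel_def using assms(1) by simp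
qed

lemma verts_product [simp]: "verts (G \<nabla> H) = verts G \<times> verts H"
  unfolding weak_modular_product_def by simp

lemma adj_product:
  assumes "simple_graph G" "simple_graph H"
  shows "adj (G \<nabla> H) p q \<longleftrightarrow>
    p \<in> verts G \<times> verts H \<and> q \<in> verts G \<times> verts H \<and> wprod (adj G) (adj H) p q"
proof -
  have "adj (G \<nabla> H) p q \<longleftrightarrow>
      adj G (fst p) (fst q) \<and> adj H (snd p) (snd q) \<or>
      adj (graph_complement G) (fst p) (fst q) \<and> adj (graph_complement H) (snd p) (snd q)"
    (is "_ \<longleftrightarrow> ?R p q")
  proof
    assume "adj (G \<nabla> H) p q"
    then obtain x y x' y' where "{p, q} = {(x, y), (x', y')}" "?R (x, y) (x', y')"
      unfolding weak_modular_product_def by auto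
    moreover have "?R a b \<Longrightarrow> ?R b a" for a b by (simp add: insert_commute)
    ultimately show "?R p q" unfolding doubleton_eq_iff by blast
  next
    assume "?R p q"
    then show "adj (G \<nabla> H) p q"
      unfolding weak_modular_product_def by (cases p; cases q) auto
  qed
  then show ?thesis
    unfolding adj_complement wprod_def
    using simple_graph_adjD[OF assms(1), of "fst p" "fst q"] simple_graph_adjD[OF assms(2), of "snd p" "snd q"]
    by (cases p; cases q) auto
qed

lemma perfect_product_iff:
  assumes "simple_graph G" "simple_graph H"
  shows "perfect (G \<nabla> H) \<longleftrightarrow> perfect_rel (wprod (adj G) (adj H)) (verts G \<times> verts H)"
proof -
  have irrefl: "\<not> adj (G \<nabla> H) p p" for p unfolding adj_product[OF assms] wprod_def by simp
  have "finite (verts (G \<nabla> H))" using assms by (simp add: simple_graph_finite)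
  then have "perfect (G \<nabla> H) \<longleftrightarrow> perfect_rel (adj (G \<nabla> H)) (verts G \<times> verts H)"
    using perfect_iff_perfect_rel[OF _ irrefl] by simp
  also have "\<dots> \<longleftrightarrow> perfect_rel (wprod (adj G) (adj H)) (verts G \<times> verts H)"
  proof
    assume "perfect_rel (adj (G \<nabla> H)) (verts G \<times> verts H)"
    then show "perfect_rel (wprod (adj G) (adj H)) (verts G \<times> verts H)"
      by (rule perfect_rel_cong) (simp add: adj_product[OF assms])
  next
    assume "perfect_rel (wprod (adj G) (adj H)) (verts G \<times> verts H)"
    then show "perfect_rel (adj (G \<nabla> H)) (verts G \<times> verts H)"
      by (rule perfect_rel_cong) (simp add: adj_product[OF assms])
  qed
  finally show ?thesis .
qed

text \<open>
  The two alternatives in the definition of the product change places.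
\<close>

lemma perfect_product_complement:
  assumes "simple_graph G" "simple_graph H"
  shows "perfect (graph_complement G \<nabla> graph_complement H) \<longleftrightarrow> perfect (G \<nabla> H)"
proof -
  have "wprod (adj (graph_complement G)) (adj (graph_complement H)) p q \<longleftrightarrow> wprod (adj G) (adj H) p q"
    if "p \<in> verts G \<times> verts H" "q \<in> verts G \<times> verts H" for p q
    using that unfolding wprod_def adj_complement by auto
  then show ?thesis
    using perfect_rel_cong[of "wprod (adj G) (adj H)" "verts G \<times> verts H" "wprod (adj (graph_complement G)) (adj (graph_complement H))"]
      perfect_rel_cong[of "wprod (adj (graph_complement G)) (adj (graph_complement H))" "verts G \<times> verts H" "wprod (adj G) (adj H)"]
    by (simp add: perfect_product_iff assms) blast
qed

lemma perfect_product_commute_aux: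
  assumes "simple_graph G" "simple_graph H" "perfect (G \<nabla> H)"
  shows "perfect (H \<nabla> G)"
  unfolding perfect_product_iff[OF assms(2,1)]
proof (rule perfect_rel_inj_image)
  show "perfect_rel (wprod (adj G) (adj H)) (verts G \<times> verts H)"
    using assms(3) unfolding perfect_product_iff[OF assms(1,2)] .
  show "inj_on prod.swap (verts H \<times> verts G)" by simp
qed (auto simp: wprod_def)

lemma perfect_product_commute:
  assumes "simple_graph G" "simple_graph H"
  shows "perfect (H \<nabla> G) \<longleftrightarrow> perfect (G \<nabla> H)"
  using perfect_product_commute_aux[OF assms] perfect_product_commute_aux[OF assms(2,1)] by (rule iffI[rotated])

section \<open>Isomorphism with small graphs\<close>

text \<open>
  An embedding as an induced subgraph. It replaces \<open>graph_iso\<close> and \<open>contains_induced\<close>, because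
  the concrete graphs are on the side of the domain and the conditions can be checked vertex by
  vertex.
\<close>

definition embedding :: "('b \<Rightarrow> 'a) \<Rightarrow> 'b graph \<Rightarrow> 'a graph \<Rightarrow> bool" where
  "embedding f X G \<longleftrightarrow> inj_on f (verts X) \<and> f ` verts X \<subseteq> verts G \<and>
     (\<forall>x\<in>verts X. \<forall>y\<in>verts X. adj X x y \<longleftrightarrow> adj G (f x) (f y))"

lemma graph_iso_iff_embedding: "G \<cong> X \<longleftrightarrow> (\<exists>f. embedding f X G \<and> f ` verts X = verts G)"
proof
  assume "G \<cong> X"
  then obtain g where g: "bij_betw g (verts G) (verts X)"
    "\<forall>x\<in>verts G. \<forall>y\<in>verts G. adj G x y \<longleftrightarrow> adj X (g x) (g y)"
    unfolding graph_iso_def by blast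
  define f where "f = the_inv_into (verts G) g"
  have f: "bij_betw f (verts X) (verts G)" unfolding f_def using g(1) by (rule bij_betw_the_inv_into)
  have gf: "g (f x) = x" if "x \<in> verts X" for x
    unfolding f_def using g(1) that by (simp add: f_the_inv_into_f_bij_betw)
  have fV: "f x \<in> verts G" if "x \<in> verts X" for x using f that by (rule bij_betwE[THEN bspec])
  have "embedding f X G"
    unfolding embedding_def using f g(2) gf fV by (auto simp: bij_betw_def)
  then show "\<exists>f. embedding f X G \<and> f ` verts X = verts G" using f by (auto simp: bij_betw_def)
next
  assume "\<exists>f. embedding f X G \<and> f ` verts X = verts G"
  then obtain f where f: "embedding f X G" "f ` verts X = verts G" by blast
  then have bij: "bij_betw f (verts X) (verts G)" unfolding embedding_def bij_betw_def by simp
  define g where "g = the_inv_into (verts X) f"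
  have g: "bij_betw g (verts G) (verts X)" unfolding g_def using bij by (rule bij_betw_the_inv_into)
  have fg: "f (g x) = x" if "x \<in> verts G" for x
    unfolding g_def using bij that by (simp add: f_the_inv_into_f_bij_betw)
  have gV: "g x \<in> verts X" if "x \<in> verts G" for x using g that by (rule bij_betwE[THEN bspec])
  have "adj G x y \<longleftrightarrow> adj X (g x) (g y)" if "x \<in> verts G" "y \<in> verts G" for x y
    using f(1) gV[OF that(1)] gV[OF that(2)] fg that unfolding embedding_def by metis
  then show "G \<cong> X" unfolding graph_iso_def using g by blast
qed

lemma contains_induced_iff_embedding: "contains_induced G X \<longleftrightarrow> (\<exists>f. embedding f X G)"
proof
  assume "contains_induced G X"
  then obtain S f where S: "S \<subseteq> verts G" "embedding f X (induced_graph G S)"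
    unfolding contains_induced_def graph_iso_iff_embedding by blast
  then have "embedding f X G" unfolding embedding_def adj_induced verts_induced by (simp add: image_subset_iff subset_iff)
  then show "\<exists>f. embedding f X G" by blast
next
  assume "\<exists>f. embedding f X G"
  then obtain f where f: "embedding f X G" by blast
  then have "embedding f X (induced_graph G (f ` verts X))" "f ` verts X \<subseteq> verts G"
    unfolding embedding_def adj_induced by auto
  then show "contains_induced G X"
    unfolding contains_induced_def graph_iso_iff_embedding by auto
qed

lemma contains_induced_complement:
  assumes "\<And>x. \<not> adj X x x" "\<And>x. \<not> adj G x x"
  shows "contains_induced G (graph_complement X) \<longleftrightarrow> contains_induced (graph_complement G) X"
proof -
  have "embedding f (graph_complement X) G \<longleftrightarrow> embedding f X (graph_complement G)" for f
    unfolding embedding_def adj_complement verts_complement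
    using assms by (auto simp: inj_on_def image_subset_iff)
  then show ?thesis unfolding contains_induced_iff_embedding by simp
qed

text \<open>
  A star with centre \<open>z\<close>; a single vertex counts as one.
\<close>

definition star_on :: "('a \<Rightarrow> 'a \<Rightarrow> bool) \<Rightarrow> 'a set \<Rightarrow> 'a \<Rightarrow> bool" where
  "star_on R C z \<longleftrightarrow> z \<in> C \<and> (\<forall>x\<in>C. \<forall>y\<in>C. x \<noteq> y \<longrightarrow> (R x y \<longleftrightarrow> x = z \<or> y = z))"

text \<open>
  The graph on \<open>C\<close> is complete bipartite with parts \<open>X\<close> and \<open>Y\<close>. For the complement relation
  this says that it is the disjoint union of the cliques \<open>X\<close> and \<open>Y\<close>.
\<close>

definition bipartition :: "('a \<Rightarrow> 'a \<Rightarrow> bool) \<Rightarrow> 'a set \<Rightarrow> 'a set \<Rightarrow> 'a set \<Rightarrow> bool" where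
  "bipartition R C X Y \<longleftrightarrow> X \<noteq> {} \<and> Y \<noteq> {} \<and> X \<inter> Y = {} \<and> C = X \<union> Y \<and>
     (\<forall>x\<in>C. \<forall>y\<in>C. x \<noteq> y \<longrightarrow> (R x y \<longleftrightarrow> (x \<in> X) \<noteq> (y \<in> X)))"

text \<open>
  The six conditions already make the four vertices distinct; see \<open>induces_P4_distinct\<close>.
\<close>

definition induces_P4 :: "'a graph \<Rightarrow> 'a \<Rightarrow> 'a \<Rightarrow> 'a \<Rightarrow> 'a \<Rightarrow> bool" where
  "induces_P4 G a b c d \<longleftrightarrow> adj G a b \<and> adj G b c \<and> adj G c d \<and>
     \<not> adj G a c \<and> \<not> adj G b d \<and> \<not> adj G a d"

definition induces_C5 :: "'a graph \<Rightarrow> 'a \<Rightarrow> 'a \<Rightarrow> 'a \<Rightarrow> 'a \<Rightarrow> 'a \<Rightarrow> bool" where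
  "induces_C5 G a b c d e \<longleftrightarrow> induces_P4 G a b c d \<and> adj G d e \<and> adj G e a \<and>
     \<not> adj G e b \<and> \<not> adj G e c"

lemma iso_complete_graph_iff:
  assumes "simple_graph G"
  shows "G \<cong> complete_graph n \<longleftrightarrow> card (verts G) = n \<and> clique_on (adj G) (verts G)"
proof -
  have X: "adj (complete_graph n) i j \<longleftrightarrow> i < n \<and> j < n \<and> i \<noteq> j" for i j
    unfolding complete_graph_def by (auto simp: doubleton_eq_iff)
  have V: "verts (complete_graph n) = {..<n}" unfolding complete_graph_def by simp
  show ?thesis
  proof
    assume "G \<cong> complete_graph n"
    then obtain f where f: "bij_betw f (verts G) {..<n}"
      "\<forall>x\<in>verts G. \<forall>y\<in>verts G. adj G x y \<longleftrightarrow> f x < n \<and> f y < n \<and> f x \<noteq> f y"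
      unfolding graph_iso_def X V by blast
    then show "card (verts G) = n \<and> clique_on (adj G) (verts G)"
      using bij_betw_same_card[OF f(1)] unfolding clique_on_def bij_betw_def inj_on_def by auto
  next
    assume *: "card (verts G) = n \<and> clique_on (adj G) (verts G)"
    then obtain f where f: "bij_betw f (verts G) {..<n}"
      using ex_bij_betw_finite_nat[OF simple_graph_finite[OF assms]] by (auto simp: lessThan_atLeast0)
    have "adj G x y \<longleftrightarrow> f x < n \<and> f y < n \<and> f x \<noteq> f y" if "x \<in> verts G" "y \<in> verts G" for x y
      using f * that simple_graph_adjD(3)[OF assms, of x y]
      unfolding clique_on_def bij_betw_def inj_on_def by auto
    then show "G \<cong> complete_graph n" unfolding graph_iso_def X V using f by blast
  qed
qed

lemma iso_edgeless_graph_iff: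
  assumes "simple_graph G"
  shows "G \<cong> edgeless_graph n \<longleftrightarrow> card (verts G) = n \<and> edges G = {}"
proof
  assume "G \<cong> edgeless_graph n"
  then obtain f where f: "bij_betw f (verts G) {..<n}" "\<forall>x\<in>verts G. \<forall>y\<in>verts G. \<not> adj G x y"
    unfolding graph_iso_def edgeless_graph_def by auto
  then show "card (verts G) = n \<and> edges G = {}"
    using bij_betw_same_card[OF f(1)] simple_graph_edgesE[OF assms] by (metis card_lessThan equals0I)
next
  assume *: "card (verts G) = n \<and> edges G = {}"
  then obtain f where f: "bij_betw f (verts G) {..<n}"
    using ex_bij_betw_finite_nat[OF simple_graph_finite[OF assms]] by (auto simp: lessThan_atLeast0)
  then show "G \<cong> edgeless_graph n" unfolding graph_iso_def edgeless_graph_def using * by auto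
qed

lemma iso_complete_bipartite_iff:
  assumes "simple_graph G" "m \<ge> 1" "n \<ge> 1"
  shows "G \<cong> complete_bipartite_graph m n \<longleftrightarrow>
    (\<exists>X Y. bipartition (adj G) (verts G) X Y \<and> card X = m \<and> card Y = n)"
proof -
  have E: "adj (complete_bipartite_graph m n) u v \<longleftrightarrow>
      u \<in> {..<m} <+> {..<n} \<and> v \<in> {..<m} <+> {..<n} \<and> isl u \<noteq> isl v" for u v
    unfolding complete_bipartite_graph_def by (cases u; cases v) (auto simp: doubleton_eq_iff)
  have V: "verts (complete_bipartite_graph m n) = {..<m} <+> {..<n}"
    unfolding complete_bipartite_graph_def by simp
  show ?thesis
  proof
    assume "G \<cong> complete_bipartite_graph m n"
    then obtain f where f: "inj_on f ({..<m} <+> {..<n})" "f ` ({..<m} <+> {..<n}) = verts G"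
      "\<And>u v. u \<in> {..<m} <+> {..<n} \<Longrightarrow> v \<in> {..<m} <+> {..<n} \<Longrightarrow> adj G (f u) (f v) \<longleftrightarrow> isl u \<noteq> isl v"
      unfolding graph_iso_iff_embedding embedding_def E V by auto
    define X Y where "X = f ` Inl ` {..<m}" and "Y = f ` Inr ` {..<n}"
    have "inj_on f (Inl ` {..<m})" "inj_on f (Inr ` {..<n})"
      using f(1) by (rule inj_on_subset; auto)+
    then have "card X = m" "card Y = n"
      unfolding X_def Y_def by (simp_all add: card_image)
    moreover have "bipartition (adj G) (verts G) X Y"
      unfolding bipartition_def
    proof (intro conjI ballI impI)
      show "X \<noteq> {}" "Y \<noteq> {}" using assms unfolding X_def Y_def by (auto simp: lessThan_empty_iff)
      have mem: "f u \<in> X \<longleftrightarrow> isl u" if "u \<in> {..<m} <+> {..<n}" for u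
        using that f(1) unfolding X_def inj_on_def by auto
      show "X \<inter> Y = {}" using mem[of "Inr _"] unfolding Y_def by auto
      show "verts G = X \<union> Y" using f(2) unfolding X_def Y_def Plus_def by (simp add: image_Un)
      fix x y assume "x \<in> verts G" "y \<in> verts G"
      then obtain u v where uv: "u \<in> {..<m} <+> {..<n}" "v \<in> {..<m} <+> {..<n}" "x = f u" "y = f v"
        unfolding f(2)[symmetric] by blast
      show "adj G x y \<longleftrightarrow> (x \<in> X) \<noteq> (y \<in> X)"
        unfolding uv(3,4) f(3)[OF uv(1,2)] mem[OF uv(1)] mem[OF uv(2)] by simp
    qed
    ultimately show "\<exists>X Y. bipartition (adj G) (verts G) X Y \<and> card X = m \<and> card Y = n" by blast
  next
    assume "\<exists>X Y. bipartition (adj G) (verts G) X Y \<and> card X = m \<and> card Y = n"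
    then obtain X Y where XY: "bipartition (adj G) (verts G) X Y" "card X = m" "card Y = n" by blast
    then have un: "verts G = X \<union> Y" "X \<inter> Y = {}" unfolding bipartition_def by auto
    then have "finite X" "finite Y" using simple_graph_finite[OF assms(1)] by auto
    then obtain g h where g: "bij_betw g X {..<m}" and h: "bij_betw h Y {..<n}"
      using ex_bij_betw_finite_nat XY(2,3) by (metis lessThan_atLeast0)
    define f where "f x = (if x \<in> X then Inl (g x) else Inr (h x))" for x
    have fX: "f x = Inl (g x) \<and> g x < m" if "x \<in> X" for x using that bij_betwE[OF g] unfolding f_def by auto
    have fY: "f x = Inr (h x) \<and> h x < n" if "x \<in> Y" for x
      using that un(2) bij_betwE[OF h] unfolding f_def by auto
    have "inj_on f (verts G)"
      using g h fX fY unfolding un(1) bij_betw_def inj_on_def by (metis Un_iff sum.distinct(1) sum.inject)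
    moreover have "f ` verts G = {..<m} <+> {..<n}"
    proof -
      have "f ` X = Inl ` g ` X" "f ` Y = Inr ` h ` Y" using fX fY by (auto simp: image_iff)
      then show ?thesis using g h unfolding un(1) bij_betw_def Plus_def by (simp add: image_Un)
    qed
    ultimately have bij: "bij_betw f (verts G) ({..<m} <+> {..<n})" unfolding bij_betw_def by blast
    have isl: "isl (f x) \<longleftrightarrow> x \<in> X" for x unfolding f_def by simp
    have "adj G x y \<longleftrightarrow> f x \<in> {..<m} <+> {..<n} \<and> f y \<in> {..<m} <+> {..<n} \<and> isl (f x) \<noteq> isl (f y)"
      if xy: "x \<in> verts G" "y \<in> verts G" for x y
    proof (cases "x = y")
      case True
      then show ?thesis using simple_graph_adjD(3)[OF assms(1), of x y] by auto
    next
      case False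
      then show ?thesis
        using XY(1) xy bij_betwE[OF bij] unfolding isl bipartition_def by simp
    qed
    then show "G \<cong> complete_bipartite_graph m n" unfolding graph_iso_def E V using bij by (intro exI[of _ f]) simp
  qed
qed


text \<open>
  One and the same bijection serves on both sides.
\<close>

lemma iso_two_cliques_iff:
  assumes "simple_graph G"
  shows "G \<cong> complete_graph r \<uplus> complete_graph s \<longleftrightarrow> graph_complement G \<cong> complete_bipartite_graph r s"
proof -
  have E: "adj (complete_graph r \<uplus> complete_graph s) u v \<longleftrightarrow>
      u \<in> {..<r} <+> {..<s} \<and> v \<in> {..<r} <+> {..<s} \<and> u \<noteq> v \<and> (isl u \<longleftrightarrow> isl v)" for u v
  proof -
    have 1: "{u, v} = Inl ` e \<longleftrightarrow> (\<exists>x y. e = {x, y} \<and> u = Inl x \<and> v = Inl y)" for e :: "nat set" and u v :: "nat + nat"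
    proof
      assume eq: "{u, v} = Inl ` e"
      then have "u \<in> Inl ` e" "v \<in> Inl ` e" by auto
      then obtain x y where xy: "u = Inl x" "v = Inl y" by blast
      then have "Inl ` e = (Inl ` {x, y} :: (nat + nat) set)" using eq by simp
      then have "e = {x, y}" by (simp only: inj_image_eq_iff[OF inj_Inl])
      then show "\<exists>x y. e = {x, y} \<and> u = Inl x \<and> v = Inl y" using xy by blast
    qed auto
    have 2: "{u, v} = Inr ` e \<longleftrightarrow> (\<exists>x y. e = {x, y} \<and> u = Inr x \<and> v = Inr y)" for e :: "nat set" and u v :: "nat + nat"
    proof
      assume eq: "{u, v} = Inr ` e"
      then have "u \<in> Inr ` e" "v \<in> Inr ` e" by auto
      then obtain x y where xy: "u = Inr x" "v = Inr y" by blast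
      then have "Inr ` e = (Inr ` {x, y} :: (nat + nat) set)" using eq by simp
      then have "e = {x, y}" by (simp only: inj_image_eq_iff[OF inj_Inr])
      then show "\<exists>x y. e = {x, y} \<and> u = Inr x \<and> v = Inr y" using xy by blast
    qed auto
    have 3: "{x, y} \<in> edges (complete_graph n) \<longleftrightarrow> x < n \<and> y < n \<and> x \<noteq> y" for x y n
      unfolding complete_graph_def by (auto simp: doubleton_eq_iff)
    have "adj (complete_graph r \<uplus> complete_graph s) u v \<longleftrightarrow>
        (\<exists>e\<in>edges (complete_graph r). {u, v} = Inl ` e) \<or> (\<exists>e\<in>edges (complete_graph s). {u, v} = Inr ` e)"
      unfolding disjoint_union_def by auto
    also have "\<dots> \<longleftrightarrow> (\<exists>x y. {x, y} \<in> edges (complete_graph r) \<and> u = Inl x \<and> v = Inl y) \<or>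
        (\<exists>x y. {x, y} \<in> edges (complete_graph s) \<and> u = Inr x \<and> v = Inr y)"
      unfolding 1 2 by blast
    also have "\<dots> \<longleftrightarrow> u \<in> {..<r} <+> {..<s} \<and> v \<in> {..<r} <+> {..<s} \<and> u \<noteq> v \<and> (isl u \<longleftrightarrow> isl v)"
      unfolding 3 by (cases u; cases v) auto
    finally show ?thesis .
  qed
  have V: "verts (complete_graph r \<uplus> complete_graph s) = {..<r} <+> {..<s}"
    unfolding disjoint_union_def complete_graph_def by simp
  have E': "adj (complete_bipartite_graph r s) u v \<longleftrightarrow>
      u \<in> {..<r} <+> {..<s} \<and> v \<in> {..<r} <+> {..<s} \<and> isl u \<noteq> isl v" for u v
    unfolding complete_bipartite_graph_def by (cases u; cases v) (auto simp: doubleton_eq_iff)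
  have V': "verts (complete_bipartite_graph r s) = {..<r} <+> {..<s}"
    unfolding complete_bipartite_graph_def by simp
  have "(adj G x y \<longleftrightarrow> adj (complete_graph r \<uplus> complete_graph s) (f x) (f y)) \<longleftrightarrow>
      (adj (graph_complement G) x y \<longleftrightarrow> adj (complete_bipartite_graph r s) (f x) (f y))"
    if f: "bij_betw f (verts G) ({..<r} <+> {..<s})" and xy: "x \<in> verts G" "y \<in> verts G" for f x y
  proof -
    have "f x \<in> {..<r} <+> {..<s}" "f y \<in> {..<r} <+> {..<s}" using f xy bij_betwE by auto
    moreover have "f x = f y \<longleftrightarrow> x = y" using f xy by (auto simp: bij_betw_def inj_on_def)
    ultimately show ?thesis
      unfolding E E' adj_complement using xy simple_graph_adjD(3)[OF assms, of x y] by auto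
  qed
  then show ?thesis unfolding graph_iso_def V V' verts_complement by (intro ex_cong1 conj_cong ball_cong) auto
qed

lemma iso_two_cliques_bipartition:
  assumes "simple_graph G" "r \<ge> 1" "s \<ge> 1"
  shows "G \<cong> complete_graph r \<uplus> complete_graph s \<longleftrightarrow>
    (\<exists>X Y. bipartition (adj (graph_complement G)) (verts G) X Y \<and> card X = r \<and> card Y = s)"
  using iso_complete_bipartite_iff[OF simple_graph_complement[OF assms(1)] assms(2,3)]
  by (simp add: iso_two_cliques_iff[OF assms(1)])

lemma bipartition_sides_nonempty:
  assumes "bipartition R C X Y" "finite C"
  shows "card X \<ge> 1" "card Y \<ge> 1"
proof -
  have "finite X" "finite Y" "X \<noteq> {}" "Y \<noteq> {}" using assms unfolding bipartition_def by auto
  then show "card X \<ge> 1" "card Y \<ge> 1" by (simp_all add: Suc_leI card_gt_0_iff)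
qed

lemma adj_path_graph: "adj (path_graph n) i j \<longleftrightarrow> (j = Suc i \<and> j < n) \<or> (i = Suc j \<and> i < n)"
  unfolding path_graph_def by (auto simp: doubleton_eq_iff)

lemma adj_cycle_graph:
  "adj (cycle_graph n) i j \<longleftrightarrow> i < n \<and> j = Suc i mod n \<or> j < n \<and> i = Suc j mod n"
  unfolding cycle_graph_def by (auto simp: doubleton_eq_iff)

lemma induces_P4_distinct:
  assumes "simple_graph G" "induces_P4 G a b c d"
  shows "distinct [a, b, c, d]" "{a, b, c, d} \<subseteq> verts G"
  using assms(2) simple_graph_adjD[OF assms(1)] unfolding induces_P4_def
  by (auto simp: adj_commute)

lemma induces_C5_distinct:
  assumes "simple_graph G" "induces_C5 G a b c d e"
  shows "distinct [a, b, c, d, e]" "{a, b, c, d, e} \<subseteq> verts G"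
proof -
  have "induces_P4 G a b c d" using assms(2) unfolding induces_C5_def by simp
  note P = induces_P4_distinct[OF assms(1) this]
  have e: "adj G d e" "adj G e a" "\<not> adj G e b" "\<not> adj G e c" "adj G a b" "adj G c d"
    using assms(2) unfolding induces_C5_def induces_P4_def by auto
  then have "e \<noteq> a" "e \<noteq> d" using simple_graph_adjD(3)[OF assms(1)] by blast+
  moreover have "e \<noteq> b" "e \<noteq> c"
    using e(3-6) assms(2) unfolding induces_C5_def induces_P4_def by (auto simp: adj_commute)
  moreover have "e \<in> verts G" using simple_graph_adjD(2)[OF assms(1) e(1)] .
  ultimately show "distinct [a, b, c, d, e]" "{a, b, c, d, e} \<subseteq> verts G" using P by auto
qed

lemma lessThan_4: "{..<4 :: nat} = {0, 1, 2, 3}" and lessThan_5: "{..<5 :: nat} = {0, 1, 2, 3, 4}"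
  and lessThan_3: "{..<3 :: nat} = {0, 1, 2}"
  by auto

lemma induces_P4_embedding:
  assumes "simple_graph G" "induces_P4 G a b c d"
  shows "embedding (\<lambda>i. [a, b, c, d] ! i) (path_graph 4) G"
  unfolding embedding_def adj_path_graph
  using assms(2) adj_irrefl[OF assms(1)] induces_P4_distinct[OF assms]
  by (simp add: path_graph_def lessThan_4 induces_P4_def adj_commute)

lemma contains_P4_iff:
  assumes "simple_graph G"
  shows "contains_induced G (path_graph 4) \<longleftrightarrow> (\<exists>a b c d. induces_P4 G a b c d)"
proof
  assume "contains_induced G (path_graph 4)"
  then obtain f :: "nat \<Rightarrow> 'a"
    where f: "\<forall>i\<in>{..<4}. \<forall>j\<in>{..<4}. adj (path_graph 4) i j \<longleftrightarrow> adj G (f i) (f j)"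
    unfolding contains_induced_iff_embedding embedding_def by (auto simp: path_graph_def)
  then have "induces_P4 G (f 0) (f 1) (f 2) (f 3)"
    unfolding induces_P4_def adj_path_graph lessThan_4 by auto
  then show "\<exists>a b c d. induces_P4 G a b c d" by blast
next
  assume "\<exists>a b c d. induces_P4 G a b c d"
  then show "contains_induced G (path_graph 4)"
    unfolding contains_induced_iff_embedding using induces_P4_embedding[OF assms] by blast
qed

lemma iso_path_4_iff:
  assumes "simple_graph G"
  shows "G \<cong> path_graph 4 \<longleftrightarrow> (\<exists>a b c d. induces_P4 G a b c d \<and> verts G = {a, b, c, d})"
proof
  assume "G \<cong> path_graph 4"
  then obtain f :: "nat \<Rightarrow> 'a" where f: "f ` {..<4} = verts G"
    "\<forall>i\<in>{..<4}. \<forall>j\<in>{..<4}. adj (path_graph 4) i j \<longleftrightarrow> adj G (f i) (f j)"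
    unfolding graph_iso_iff_embedding embedding_def by (auto simp: path_graph_def)
  then have "induces_P4 G (f 0) (f 1) (f 2) (f 3)" "verts G = {f 0, f 1, f 2, f 3}"
    unfolding induces_P4_def adj_path_graph lessThan_4 by auto
  then show "\<exists>a b c d. induces_P4 G a b c d \<and> verts G = {a, b, c, d}" by blast
next
  assume "\<exists>a b c d. induces_P4 G a b c d \<and> verts G = {a, b, c, d}"
  then obtain a b c d where P: "induces_P4 G a b c d" and V: "verts G = {a, b, c, d}" by blast
  have "(\<lambda>i. [a, b, c, d] ! i) ` verts (path_graph 4) = verts G"
    by (simp add: path_graph_def lessThan_4 V)
  then show "G \<cong> path_graph 4"
    unfolding graph_iso_iff_embedding using induces_P4_embedding[OF assms P] by blast
qed

lemma iso_cycle_5_iff: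
  assumes "simple_graph G"
  shows "G \<cong> cycle_graph 5 \<longleftrightarrow> (\<exists>a b c d e. induces_C5 G a b c d e \<and> verts G = {a, b, c, d, e})"
proof
  assume "G \<cong> cycle_graph 5"
  then obtain f :: "nat \<Rightarrow> 'a" where f: "f ` {..<5} = verts G"
    "\<forall>i\<in>{..<5}. \<forall>j\<in>{..<5}. adj (cycle_graph 5) i j \<longleftrightarrow> adj G (f i) (f j)"
    unfolding graph_iso_iff_embedding embedding_def by (auto simp: cycle_graph_def)
  then have "adj G (f i) (f j) \<longleftrightarrow> j = Suc i mod 5 \<or> i = Suc j mod 5" if "i < 5" "j < 5" for i j
    using that by (simp add: adj_cycle_graph)
  then have "induces_C5 G (f 0) (f 1) (f 2) (f 3) (f 4)"
    unfolding induces_C5_def induces_P4_def by simp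
  moreover have "verts G = {f 0, f 1, f 2, f 3, f 4}" using f(1) by (simp add: lessThan_5)
  ultimately show "\<exists>a b c d e. induces_C5 G a b c d e \<and> verts G = {a, b, c, d, e}" by blast
next
  assume "\<exists>a b c d e. induces_C5 G a b c d e \<and> verts G = {a, b, c, d, e}"
  then obtain a b c d e where P: "induces_C5 G a b c d e" and V: "verts G = {a, b, c, d, e}" by blast
  note ir = adj_irrefl[OF assms]
  define f where "f i = [a, b, c, d, e] ! i" for i
  have "embedding f (cycle_graph 5) G"
    unfolding embedding_def adj_cycle_graph
    using P V ir induces_C5_distinct[OF assms P]
    by (simp add: cycle_graph_def lessThan_5 f_def induces_C5_def induces_P4_def adj_commute)
  moreover have "f ` verts (cycle_graph 5) = verts G"
    by (simp add: cycle_graph_def lessThan_5 f_def V)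
  ultimately show "G \<cong> cycle_graph 5" unfolding graph_iso_iff_embedding by blast
qed

lemma iso_path_3_iff:
  assumes "simple_graph G"
  shows "G \<cong> path_graph 3 \<longleftrightarrow>
    (\<exists>a b c. adj G a b \<and> adj G b c \<and> \<not> adj G a c \<and> a \<noteq> c \<and> verts G = {a, b, c})"
proof
  assume "G \<cong> path_graph 3"
  then obtain f :: "nat \<Rightarrow> 'a" where f: "f ` {..<3} = verts G" "inj_on f {..<3}"
    "\<forall>i\<in>{..<3}. \<forall>j\<in>{..<3}. adj (path_graph 3) i j \<longleftrightarrow> adj G (f i) (f j)"
    unfolding graph_iso_iff_embedding embedding_def by (auto simp: path_graph_def)
  then have "adj G (f 0) (f 1) \<and> adj G (f 1) (f 2) \<and> \<not> adj G (f 0) (f 2) \<and> f 0 \<noteq> f 2 \<and> verts G = {f 0, f 1, f 2}"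
    unfolding adj_path_graph lessThan_3 by (auto simp: inj_on_def)
  then show "\<exists>a b c. adj G a b \<and> adj G b c \<and> \<not> adj G a c \<and> a \<noteq> c \<and> verts G = {a, b, c}" by blast
next
  assume "\<exists>a b c. adj G a b \<and> adj G b c \<and> \<not> adj G a c \<and> a \<noteq> c \<and> verts G = {a, b, c}"
  then obtain a b c where P: "adj G a b" "adj G b c" "\<not> adj G a c" "a \<noteq> c" and V: "verts G = {a, b, c}" by blast
  note ir = adj_irrefl[OF assms]
  define f where "f i = [a, b, c] ! i" for i
  have "a \<noteq> b" "b \<noteq> c" using P ir by auto
  then have "embedding f (path_graph 3) G"
    unfolding embedding_def adj_path_graph
    using P V ir by (simp add: path_graph_def lessThan_3 f_def adj_commute)
  moreover have "f ` verts (path_graph 3) = verts G"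
    by (simp add: path_graph_def lessThan_3 f_def V)
  ultimately show "G \<cong> path_graph 3" unfolding graph_iso_iff_embedding by blast
qed

section \<open>Components\<close>

definition component :: "'a graph \<Rightarrow> 'a \<Rightarrow> 'a set" where
  "component G x = {y \<in> verts G. (x, y) \<in> reachable G}"

lemma reachable_sym: "(x, y) \<in> reachable G \<Longrightarrow> (y, x) \<in> reachable G"
  unfolding reachable_def
  by (rule symD[OF sym_rtrancl]) (auto simp: sym_def insert_commute)

lemma reachable_trans: "(x, y) \<in> reachable G \<Longrightarrow> (y, z) \<in> reachable G \<Longrightarrow> (x, z) \<in> reachable G"
  unfolding reachable_def by (rule rtrancl_trans)

lemma adj_reachable: "adj G x y \<Longrightarrow> (x, y) \<in> reachable G"
  unfolding reachable_def by auto

lemma component_self: "x \<in> verts G \<Longrightarrow> x \<in> component G x"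
  unfolding component_def reachable_def by simp

lemma component_adj:
  assumes "simple_graph G" "y \<in> component G x" "adj G y z"
  shows "z \<in> component G x"
  using assms(2) simple_graph_adjD(2)[OF assms(1,3)] reachable_trans[OF _ adj_reachable[OF assms(3)]]
  unfolding component_def by simp

text \<open>
  Induction along the paths that start in \<open>x\<close>.
\<close>

lemma component_subset_closed:
  assumes "x \<in> S" "\<And>y z. y \<in> S \<Longrightarrow> adj G y z \<Longrightarrow> z \<in> S"
  shows "component G x \<subseteq> S"
proof
  fix y assume "y \<in> component G x"
  then have "(x, y) \<in> {(x, y). adj G x y}\<^sup>*" unfolding component_def reachable_def by simp
  then show "y \<in> S" by (induction rule: rtrancl_induct) (use assms in auto)
qed

lemma component_eq:
  assumes "y \<in> component G x"
  shows "component G y = component G x"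
proof -
  have xy: "(x, y) \<in> reachable G" using assms unfolding component_def by simp
  have "(y, z) \<in> reachable G \<longleftrightarrow> (x, z) \<in> reachable G" for z
    using reachable_trans[OF xy] reachable_trans[OF reachable_sym[OF xy]] by metis
  then show ?thesis unfolding component_def by simp
qed

lemma component_subset: "component G x \<subseteq> verts G"
  unfolding component_def by blast

lemma components_eq: "components G = (\<lambda>x. induced_graph G (component G x)) ` verts G"
  unfolding components_def component_def by auto

lemma simple_graph_induced:
  assumes "simple_graph G" "S \<subseteq> verts G" "S \<noteq> {}"
  shows "simple_graph (induced_graph G S)"
  unfolding simple_graph_def
proof (intro conjI subsetI)
  show "finite (verts (induced_graph G S))"
    using finite_subset[OF assms(2) simple_graph_finite[OF assms(1)]] by simp
  fix e assume "e \<in> edges (induced_graph G S)"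
  then have e: "e \<in> edges G" "e \<subseteq> S" unfolding induced_graph_def by auto
  obtain x y where "e = {x, y}" "x \<noteq> y" using simple_graph_edgesE[OF assms(1) e(1)] by metis
  then show "e \<in> {{x, y} |x y. x \<in> verts (induced_graph G S) \<and> y \<in> verts (induced_graph G S) \<and> x \<noteq> y}"
    using e(2) by auto
qed (use assms in simp)

lemma is_complete_induced_iff:
  assumes "simple_graph G" "S \<subseteq> verts G" "S \<noteq> {}"
  shows "is_complete (induced_graph G S) \<longleftrightarrow> clique_on (adj G) S"
proof -
  have "card S \<ge> 1"
    using assms finite_subset[OF assms(2) simple_graph_finite[OF assms(1)]] by (simp add: Suc_leI card_gt_0_iff)
  moreover have "clique_on (adj (induced_graph G S)) S \<longleftrightarrow> clique_on (adj G) S"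
    unfolding clique_on_def adj_induced by auto
  ultimately show ?thesis
    unfolding is_complete_def iso_complete_graph_iff[OF simple_graph_induced[OF assms]] by auto
qed

lemma is_star_induced_imp_star_on:
  assumes "simple_graph G" "S \<subseteq> verts G" "S \<noteq> {}" "is_star (induced_graph G S)"
  shows "\<exists>z. star_on (adj G) S z"
proof -
  obtain m n where mn: "m \<ge> 1" "n \<ge> 1" "m = 1 \<or> n = 1" "induced_graph G S \<cong> complete_bipartite_graph m n"
    using assms(4) unfolding is_star_def by blast
  obtain X Y where XY: "bipartition (adj (induced_graph G S)) S X Y" "card X = m" "card Y = n"
    using mn(4) unfolding iso_complete_bipartite_iff[OF simple_graph_induced[OF assms(1-3)] mn(1,2)] by auto
  from mn(3) XY have "\<exists>z. X = {z} \<or> Y = {z}" by (metis card_1_singletonE)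
  then obtain z where z: "X = {z} \<or> Y = {z}" by blast
  have "star_on (adj G) S z"
    using XY(1) z unfolding star_on_def bipartition_def adj_induced by auto
  then show ?thesis by blast
qed

lemma star_on_imp_bipartition:
  assumes "star_on R S z" "\<not> clique_on R S"
  shows "bipartition R S {z} (S - {z})"
proof -
  have "S \<noteq> {z}" using assms(2) unfolding clique_on_def by auto
  then show ?thesis using assms(1) unfolding star_on_def bipartition_def by auto
qed

lemma star_on_imp_is_star:
  assumes "simple_graph G" "S \<subseteq> verts G" "star_on (adj G) S z" "\<not> clique_on (adj G) S"
  shows "is_star (induced_graph G S)"
proof -
  have S: "S \<noteq> {}" using assms(3) unfolding star_on_def by auto
  note simple = simple_graph_induced[OF assms(1,2) S]
  have fin: "finite S" using finite_subset[OF assms(2) simple_graph_finite[OF assms(1)]] .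
  have bip: "bipartition (adj G) S {z} (S - {z})" using assms(3,4) by (rule star_on_imp_bipartition)
  then have "bipartition (adj (induced_graph G S)) S {z} (S - {z})"
    unfolding bipartition_def adj_induced by auto
  moreover have "card (S - {z}) \<ge> 1" using bipartition_sides_nonempty(2)[OF bip fin] .
  ultimately have "induced_graph G S \<cong> complete_bipartite_graph 1 (card (S - {z}))"
    unfolding iso_complete_bipartite_iff[OF simple order_refl \<open>card (S - {z}) \<ge> 1\<close>] verts_induced
    by (intro exI[of _ "{z}"] exI[of _ "S - {z}"]) simp
  then show ?thesis unfolding is_star_def using \<open>card (S - {z}) \<ge> 1\<close> by blast
qed

text \<open>
  A single vertex is a clique but not a star in the sense of \<open>is_star\<close>, whereas \<open>star_on\<close> admits
  it; the disjunction hides the difference.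
\<close>

lemma union_of_stars_and_cliques_iff:
  assumes "simple_graph G"
  shows "union_of_stars_and_cliques G \<longleftrightarrow>
    (\<forall>x\<in>verts G. clique_on (adj G) (component G x) \<or> (\<exists>z. star_on (adj G) (component G x) z))"
proof -
  have "is_star (induced_graph G (component G x)) \<or> is_complete (induced_graph G (component G x)) \<longleftrightarrow>
      clique_on (adj G) (component G x) \<or> (\<exists>z. star_on (adj G) (component G x) z)" if "x \<in> verts G" for x
  proof -
    have ne: "component G x \<noteq> {}" using component_self[OF that] by blast
    show ?thesis
      using is_complete_induced_iff[OF assms component_subset ne]
        is_star_induced_imp_star_on[OF assms component_subset ne]
        star_on_imp_is_star[OF assms component_subset] by blast
  qed
  then show ?thesis unfolding union_of_stars_and_cliques_def components_eq by simp
qed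

text \<open>
  Absence of an induced path with three vertices means that adjacency is transitive, hence that
  the graph is a disjoint union of cliques.
\<close>

definition has_P3 :: "'a graph \<Rightarrow> bool" where
  "has_P3 G \<longleftrightarrow> (\<exists>x y z. adj G x y \<and> adj G y z \<and> \<not> adj G x z \<and> x \<noteq> z)"

lemma component_P3_free:
  assumes "simple_graph G" "\<not> has_P3 G" "x \<in> verts G"
  shows "component G x = insert x {y. adj G x y}"
proof
  show "component G x \<subseteq> insert x {y. adj G x y}"
  proof (rule component_subset_closed)
    fix y z assume yz: "y \<in> insert x {y. adj G x y}" "adj G y z"
    show "z \<in> insert x {y. adj G x y}"
    proof (cases "z = x \<or> y = x")
      case False
      then have "adj G x y" using yz by simp
      then show ?thesis using assms(2) yz(2) False unfolding has_P3_def by auto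
    qed (use yz in auto)
  qed simp
  show "insert x {y. adj G x y} \<subseteq> component G x"
    using component_self[OF assms(3)] component_adj[OF assms(1)] by auto
qed

lemma union_of_cliques_iff_components:
  assumes "simple_graph G"
  shows "union_of_cliques G \<longleftrightarrow> (\<forall>x\<in>verts G. clique_on (adj G) (component G x))"
proof -
  have "is_complete (induced_graph G (component G x)) \<longleftrightarrow> clique_on (adj G) (component G x)"
    if "x \<in> verts G" for x
    using is_complete_induced_iff[OF assms component_subset, of x] component_self[OF that] by auto
  then show ?thesis unfolding union_of_cliques_def components_eq by simp
qed

lemma union_of_cliques_iff:
  assumes "simple_graph G"
  shows "union_of_cliques G \<longleftrightarrow> \<not> has_P3 G"
proof
  assume "union_of_cliques G"
  then have cl: "clique_on (adj G) (component G x)" if "x \<in> verts G" for x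
    using that unfolding union_of_cliques_iff_components[OF assms] by simp
  show "\<not> has_P3 G"
  proof
    assume "has_P3 G"
    then obtain x y z where xyz: "adj G x y" "adj G y z" "\<not> adj G x z" "x \<noteq> z" unfolding has_P3_def by blast
    have "x \<in> component G x" "y \<in> component G x" "z \<in> component G x"
      using component_self[OF simple_graph_adjD(1)[OF assms xyz(1)]] component_adj[OF assms] xyz by blast+
    then show False
      using cl[OF simple_graph_adjD(1)[OF assms xyz(1)]] xyz unfolding clique_on_def by blast
  qed
next
  assume *: "\<not> has_P3 G"
  have "clique_on (adj G) (component G x)" if "x \<in> verts G" for x
    unfolding component_P3_free[OF assms * that] clique_on_def
    using * unfolding has_P3_def by (auto simp: adj_commute) (metis adj_commute)
  then show "union_of_cliques G" unfolding union_of_cliques_iff_components[OF assms] by simp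
qed

text \<open>
  An edge with an isolated vertex, the complement of the path with three vertices.
\<close>

definition induces_coP3 :: "'a graph \<Rightarrow> 'a \<Rightarrow> 'a \<Rightarrow> 'a \<Rightarrow> bool" where
  "induces_coP3 G x y z \<longleftrightarrow> z \<in> verts G \<and> adj G x y \<and> \<not> adj G x z \<and> \<not> adj G y z \<and> z \<noteq> x \<and> z \<noteq> y"

lemma has_P3_complement:
  assumes "simple_graph G"
  shows "has_P3 (graph_complement G) \<longleftrightarrow> (\<exists>x y z. induces_coP3 G x y z)"
proof
  assume "has_P3 (graph_complement G)"
  then obtain x z y where "adj (graph_complement G) x z" "adj (graph_complement G) z y"
    "\<not> adj (graph_complement G) x y" "x \<noteq> y" unfolding has_P3_def by blast
  then have "induces_coP3 G x y z"
    unfolding adj_complement induces_coP3_def by (auto simp: adj_commute)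
  then show "\<exists>x y z. induces_coP3 G x y z" by blast
next
  assume "\<exists>x y z. induces_coP3 G x y z"
  then obtain x y z where *: "z \<in> verts G" "adj G x y" "\<not> adj G x z" "\<not> adj G y z" "z \<noteq> x" "z \<noteq> y"
    unfolding induces_coP3_def by blast
  then have "adj (graph_complement G) x z" "adj (graph_complement G) z y"
    "\<not> adj (graph_complement G) x y" "x \<noteq> y"
    using simple_graph_adjD[OF assms *(2)] unfolding adj_complement by (auto simp: adj_commute)
  then show "has_P3 (graph_complement G)" unfolding has_P3_def by blast
qed

lemma complete_multipartite_imp:
  assumes "complete_multipartite G"
  shows "\<exists>g :: 'a \<Rightarrow> 'a set. \<forall>x\<in>verts G. \<forall>y\<in>verts G. adj G x y \<longleftrightarrow> g x \<noteq> g y"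
proof -
  from assms[unfolded complete_multipartite_def] obtain P where P: "partition_on (verts G) P"
    "edges G = {{x, y} | x y. \<exists>A\<in>P. \<exists>B\<in>P. A \<noteq> B \<and> x \<in> A \<and> y \<in> B}"
    by (elim exE conjE) (rule that)
  define g where "g x = (THE A. A \<in> P \<and> x \<in> A)" for x
  have uniq: "A = B" if "A \<in> P" "B \<in> P" "x \<in> A" "x \<in> B" for A B x
    using P(1) that unfolding partition_on_def disjoint_def by blast
  have g: "g x = A" if "A \<in> P" "x \<in> A" for x A
    unfolding g_def by (rule the_equality) (use that uniq in auto)
  have ex: "\<exists>A\<in>P. x \<in> A" if "x \<in> verts G" for x
    using P(1) that unfolding partition_on_def by blast
  have "adj G x y \<longleftrightarrow> g x \<noteq> g y" if xy: "x \<in> verts G" "y \<in> verts G" for x y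
  proof
    assume "adj G x y"
    then obtain u v A B where "{x, y} = {u, v}" "A \<in> P" "B \<in> P" "A \<noteq> B" "u \<in> A" "v \<in> B"
      unfolding P(2) by blast
    then show "g x \<noteq> g y" using g[of A u] g[of B v] by (auto simp: doubleton_eq_iff)
  next
    assume neq: "g x \<noteq> g y"
    obtain A B where "A \<in> P" "x \<in> A" "B \<in> P" "y \<in> B" using ex xy by blast
    then show "adj G x y" using neq g unfolding P(2) by blast
  qed
  then show ?thesis by blast
qed

text \<open>
  Nonadjacency is an equivalence relation, and an edge provides two classes.
\<close>

lemma complete_multipartiteI:
  assumes G: "simple_graph G" and no: "\<not> has_P3 (graph_complement G)" and e: "edges G \<noteq> {}"
  shows "complete_multipartite G"
proof -
  define g where "g x = {y\<in>verts G. \<not> adj G x y}" for x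
  have self: "x \<in> g x" if "x \<in> verts G" for x
    using that simple_graph_adjD(3)[OF G, of x x] unfolding g_def by auto
  have gsym: "x \<in> g y" if "y \<in> g x" "x \<in> verts G" for x y using that unfolding g_def by (auto simp: adj_commute)
  have trans: "\<not> adj G x y" if "\<not> adj G x z" "\<not> adj G z y" "x \<in> verts G" "y \<in> verts G" "z \<in> verts G" for x y z
  proof
    assume "adj G x y"
    moreover from this have "z \<noteq> x" "z \<noteq> y" using that by (auto simp: adj_commute)
    ultimately show False using no that unfolding has_P3_complement[OF G] induces_coP3_def by (auto simp: adj_commute)
  qed
  have eq: "g x = g y" if "y \<in> g x" "x \<in> verts G" for x y
  proof -
    have "y \<in> verts G" "\<not> adj G x y" "\<not> adj G y x" using that unfolding g_def by (auto simp: adj_commute)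
    then show ?thesis using trans[of y x] trans[of x y] that(2) unfolding g_def by blast
  qed
  have adj: "adj G x y \<longleftrightarrow> g x \<noteq> g y" if "x \<in> verts G" "y \<in> verts G" for x y
    using eq[of y x] self[of y] that unfolding g_def by blast
  obtain x y where xy: "adj G x y" "x \<in> verts G" "y \<in> verts G"
    using e simple_graph_edgesE[OF G] by (metis ex_in_conv)
  have "partition_on (verts G) (g ` verts G)"
  proof (rule partition_onI)
    show "\<Union> (g ` verts G) = verts G" using self unfolding g_def by auto
    show "{} \<notin> g ` verts G" using self by auto
    fix p q assume "p \<in> g ` verts G" "q \<in> g ` verts G" "p \<noteq> q"
    then obtain u v where uv: "u \<in> verts G" "v \<in> verts G" "p = g u" "q = g v" "g u \<noteq> g v" by blast
    show "disjnt p q"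
      unfolding disjnt_def uv(3,4)
    proof (rule ccontr)
      assume "g u \<inter> g v \<noteq> {}"
      then obtain w where "w \<in> g u" "w \<in> g v" by blast
      then show False using eq[of w u] eq[of w v] uv by simp
    qed
  qed
  moreover have "card (g ` verts G) \<ge> 2"
  proof -
    have "card {g x, g y} = 2" using adj[OF xy(2,3)] xy(1) by simp
    moreover have "card {g x, g y} \<le> card (g ` verts G)"
      using xy simple_graph_finite[OF G] by (intro card_mono) auto
    ultimately show ?thesis by simp
  qed
  moreover have "edges G = {{x, y} | x y. \<exists>A\<in>g ` verts G. \<exists>B\<in>g ` verts G. A \<noteq> B \<and> x \<in> A \<and> y \<in> B}"
    (is "_ = ?E")
  proof (intro set_eqI iffI)
    fix e assume "e \<in> edges G"
    then obtain u v where "e = {u, v}" "u \<in> verts G" "v \<in> verts G" using simple_graph_edgesE[OF G] by metis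
    then show "e \<in> ?E" using adj[of u v] self[of u] self[of v] \<open>e \<in> edges G\<close> by blast
  next
    fix e assume "e \<in> ?E"
    then obtain u v a b where *: "e = {u, v}" "a \<in> verts G" "b \<in> verts G" "g a \<noteq> g b" "u \<in> g a" "v \<in> g b" by blast
    then have "u \<in> verts G" "v \<in> verts G" unfolding g_def by auto
    moreover have "g u \<noteq> g v" using eq[of u a] eq[of v b] * by simp
    ultimately show "e \<in> edges G" using adj * by simp
  qed
  ultimately show ?thesis unfolding complete_multipartite_def by blast
qed

section \<open>Structure of components\<close>

text \<open>
  The triangle is \<open>a\<close>, \<open>b\<close>, \<open>c\<close>, and \<open>d\<close> is the pendant vertex at \<open>a\<close>.
\<close>

definition induces_paw :: "'a graph \<Rightarrow> 'a \<Rightarrow> 'a \<Rightarrow> 'a \<Rightarrow> 'a \<Rightarrow> bool" where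
  "induces_paw G a b c d \<longleftrightarrow>
     adj G a b \<and> adj G a c \<and> adj G b c \<and> adj G a d \<and> \<not> adj G b d \<and> \<not> adj G c d"

text \<open>
  The nonadjacent vertices are \<open>c\<close> and \<open>d\<close>.
\<close>

definition induces_diamond :: "'a graph \<Rightarrow> 'a \<Rightarrow> 'a \<Rightarrow> 'a \<Rightarrow> 'a \<Rightarrow> bool" where
  "induces_diamond G a b c d \<longleftrightarrow>
     adj G a b \<and> adj G a c \<and> adj G a d \<and> adj G b c \<and> adj G b d \<and> \<not> adj G c d \<and> c \<noteq> d"

text \<open>
  If the component has a triangle \<open>a\<close>, \<open>b\<close>, \<open>c\<close>, then every further neighbour of one of its
  vertices is adjacent to the other two, since otherwise a paw or a diamond appears; so the
  closed neighbourhood of \<open>a\<close> is a clique that no edge leaves. If it has no triangle but an edge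
  \<open>x\<close>, \<open>y\<close>, then the neighbourhoods of \<open>y\<close> and \<open>x\<close> are stable for lack of triangles; they are
  completely joined, and no edge leaves their union, for lack of induced paths with four
  vertices.
\<close>

lemma component_clique_or_complete_bipartite:
  assumes G: "simple_graph G" and x: "x \<in> verts G"
    and no_P4: "\<And>a b c d. a \<in> component G x \<Longrightarrow> \<not> induces_P4 G a b c d"
    and no_paw: "\<And>a b c d. a \<in> component G x \<Longrightarrow> \<not> induces_paw G a b c d"
    and no_diamond: "\<And>a b c d. a \<in> component G x \<Longrightarrow> \<not> induces_diamond G a b c d"
  shows "clique_on (adj G) (component G x) \<or> (\<exists>X Y. bipartition (adj G) (component G x) X Y)"
proof (cases "\<exists>a b c. a \<in> component G x \<and> adj G a b \<and> adj G a c \<and> adj G b c")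
  case True
  then obtain a b c where abc: "a \<in> component G x" "adj G a b" "adj G a c" "adj G b c" by blast
  have com: "adj G v u" if "adj G u v" for u v using that by (simp only: adj_commute)
  have absorb: "adj G w v" if "u \<in> component G x" "adj G u v" "adj G u t" "adj G v t" "adj G u w" "w \<noteq> v" for u v t w
  proof -
    have "t \<noteq> w \<or> adj G w v" using that com by blast
    moreover have "v \<in> component G x" using component_adj[OF G that(1,2)] .
    ultimately show ?thesis
      using no_paw[OF that(1), of v t w] no_diamond[OF that(1), of t v w] that com
      unfolding induces_paw_def induces_diamond_def by blast
  qed
  let ?S = "insert a {y. adj G a y}"
  have tri: "\<exists>t. adj G a t \<and> adj G y t" if "adj G a y" for y
    using absorb[of a b c y] abc that com by (cases "y = b") blast+
  have "clique_on (adj G) ?S"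
    unfolding clique_on_def
  proof (intro ballI impI)
    fix y z assume yz: "y \<in> ?S" "z \<in> ?S" "y \<noteq> z"
    show "adj G y z"
    proof (cases "y = a \<or> z = a")
      case False
      then obtain t where "adj G a t" "adj G z t" using tri yz by blast
      then show ?thesis using absorb[of a z t y] abc yz False by auto
    qed (use yz com in blast)
  qed
  moreover have "component G a \<subseteq> ?S"
  proof (rule component_subset_closed)
    fix y z assume yz: "y \<in> ?S" "adj G y z"
    show "z \<in> ?S"
    proof (cases "y = a \<or> z = a")
      case False
      then have ay: "adj G a y" using yz by simp
      then obtain t where t: "adj G a t" "adj G y t" using tri by blast
      have "y \<in> component G x" using component_adj[OF G abc(1) ay] .
      then have "adj G z a" using absorb[of y a t z] t ay yz False com by blast
      then show ?thesis using com by blast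
    qed (use yz in auto)
  qed simp
  ultimately have "clique_on (adj G) (component G x)"
    using component_eq[OF abc(1)] clique_on_subset[of "adj G" ?S] by simp
  then show ?thesis ..
next
  case no_tri: False
  show ?thesis
  proof (cases "\<exists>y. adj G x y")
    case False
    then have "component G x \<subseteq> {x}" by (intro component_subset_closed) auto
    then have "clique_on (adj G) (component G x)" unfolding clique_on_def by auto
    then show ?thesis ..
  next
    case True
    then obtain y where xy: "adj G x y" by blast
    have com: "adj G v u" if "adj G u v" for u v using that by (simp only: adj_commute)
    have xC: "x \<in> component G x" using component_self[OF x] .
    have yC: "y \<in> component G x" using component_adj[OF G xC xy] .
    define X Y where "X = {a. adj G y a}" and "Y = {b. adj G x b}"
    have tri: False if "a \<in> component G x" "adj G a b" "adj G b c" "adj G a c" for a b c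
      using no_tri that by blast
    have sub: "X \<subseteq> component G x" "Y \<subseteq> component G x"
      using component_adj[OF G yC] component_adj[OF G xC] unfolding X_def Y_def by auto
    have XX: "\<not> adj G a a'" if "a \<in> X" "a' \<in> X" for a a' using tri[OF yC] that unfolding X_def by blast
    have YY: "\<not> adj G b b'" if "b \<in> Y" "b' \<in> Y" for b b' using tri[OF xC] that unfolding Y_def by blast
    have xX: "x \<in> X" and yY: "y \<in> Y" using xy com[OF xy] unfolding X_def Y_def by simp_all
    have XY: "adj G a b" if "a \<in> X" "b \<in> Y" for a b
    proof (rule ccontr)
      assume nab: "\<not> adj G a b"
      have "adj G y a" "adj G x b" using that unfolding X_def Y_def by auto
      then have "induces_P4 G b x y a"
        using nab xy XX[OF xX that(1)] YY[OF that(2) yY] com unfolding induces_P4_def by blast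
      then show False using no_P4 that sub by blast
    qed
    have "component G x \<subseteq> X \<union> Y"
    proof (rule component_subset_closed)
      fix a w assume aw: "a \<in> X \<union> Y" "adj G a w"
      show "w \<in> X \<union> Y"
      proof (rule ccontr)
        assume w: "w \<notin> X \<union> Y"
        then have nw: "\<not> adj G x w" "\<not> adj G y w" unfolding X_def Y_def by auto
        have "a \<in> component G x" using aw sub by blast
        then have wC: "w \<in> component G x" using component_adj[OF G _ aw(2)] by blast
        show False
        proof (cases "a \<in> X")
          case True
          then have "induces_P4 G w a y x"
            using aw(2) nw xy XX[OF xX True] com unfolding induces_P4_def X_def by blast
          then show ?thesis using no_P4 wC by blast
        next
          case False
          then have "a \<in> Y" using aw by blast
          then have "induces_P4 G w a x y"
            using aw(2) nw xy YY[OF yY \<open>a \<in> Y\<close>] com unfolding induces_P4_def Y_def by blast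
          then show ?thesis using no_P4 wC by blast
        qed
      qed
    qed (use xX in blast)
    then have C: "component G x = X \<union> Y" using sub by blast
    have disj: "X \<inter> Y = {}"
    proof (rule ccontr)
      assume "X \<inter> Y \<noteq> {}"
      then obtain a where "a \<in> X" "a \<in> Y" by blast
      then show False using XX[OF xX, of a] unfolding Y_def by blast
    qed
    have "bipartition (adj G) (component G x) X Y"
      unfolding bipartition_def C
    proof (intro conjI ballI impI)
      fix a b assume "a \<in> X \<union> Y" "b \<in> X \<union> Y"
      then show "adj G a b \<longleftrightarrow> (a \<in> X) \<noteq> (b \<in> X)"
        using XX[of a b] YY[of a b] XY[of a b] XY[of b a] disj com[of a b] com[of b a] by blast
    qed (use xX yY disj in auto)
    then show ?thesis by blast
  qed
qed

text \<open>
  Olariu's theorem: a connected paw-free graph with a triangle is complete multipartite. Among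
  the sets of vertices of the component that contain the triangle and on which nonadjacency is
  transitive, take a largest one, \<open>M\<close>. A vertex \<open>v\<close> outside \<open>M\<close> with a neighbour in \<open>M\<close> could be
  added to \<open>M\<close>: its nonneighbours in \<open>M\<close> are pairwise nonadjacent, and they form a whole part of
  \<open>M\<close>.
\<close>

lemma paw_free_component:
  assumes G: "simple_graph G" and x: "x \<in> verts G"
    and no_paw: "\<And>a b c d. \<not> induces_paw G a b c d"
    and tri: "a \<in> component G x" "adj G a b" "adj G a c" "adj G b c"
  shows "\<exists>g :: 'a \<Rightarrow> 'a set. \<forall>y\<in>component G x. \<forall>z\<in>component G x. y \<noteq> z \<longrightarrow> adj G y z \<longleftrightarrow> g y \<noteq> g z"
proof -
  have com: "adj G v u" if "adj G u v" for u v using that by (simp only: adj_commute)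
  \<comment> \<open>The sets on which the graph is complete multipartite, by transitivity of nonadjacency.\<close>
  define good where "good M \<longleftrightarrow> {a, b, c} \<subseteq> M \<and> M \<subseteq> component G x \<and>
    (\<forall>u\<in>M. \<forall>v\<in>M. \<forall>w\<in>M. \<not> adj G u v \<longrightarrow> \<not> adj G v w \<longrightarrow> \<not> adj G u w)" for M
  have irr: "\<not> adj G u u" for u using simple_graph_adjD(3)[OF G, of u u] by blast
  have "{a, b, c} \<subseteq> component G x" using component_adj[OF G tri(1)] tri by blast
  then have "good {a, b, c}" unfolding good_def using tri irr com by blast
  moreover have "finite (component G x)"
    using finite_subset[OF component_subset simple_graph_finite[OF G]] .
  then have "finite {M. good M}"
    by (rule finite_subset[rotated, OF finite_Pow_iff[THEN iffD2]]) (auto simp: good_def)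
  ultimately obtain M where M: "M \<in> {M. good M}" "\<And>N. N \<in> {M. good M} \<Longrightarrow> card N \<le> card M"
    using finite_obtain_max[of "{M. good M}" card] by blast
  have goodM: "good M" using M(1) by simp
  have trM: "\<not> adj G u w" if "u \<in> M" "v \<in> M" "w \<in> M" "\<not> adj G u v" "\<not> adj G v w" for u v w
    using goodM that unfolding good_def by blast
  have MC: "M \<subseteq> component G x" "a \<in> M" "b \<in> M" "c \<in> M" using goodM unfolding good_def by auto
  have no: False if "adj G p q" "adj G p r" "adj G q r" "adj G p s" "\<not> adj G q s" "\<not> adj G r s" for p q r s
    using no_paw[of p q r s] that unfolding induces_paw_def by blast
  have "component G a \<subseteq> M"
  proof (rule component_subset_closed)
    fix y v assume yv: "y \<in> M" "adj G y v"
    show "v \<in> M"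
    proof (rule ccontr)
      assume vM: "v \<notin> M"
      \<comment> \<open>There are at least three parts in \<open>M\<close>.\<close>
      have third: "\<exists>r\<in>M. adj G p r \<and> adj G q r" if "p \<in> M" "q \<in> M" "adj G p q" for p q
      proof -
        have "adj G p r \<or> adj G q r" if "r \<in> M" for r
          using trM[of p r q] that \<open>p \<in> M\<close> \<open>q \<in> M\<close> \<open>adj G p q\<close> com by blast
        moreover have "adj G p b \<and> adj G p c \<or> adj G p a \<and> adj G p b \<or> adj G p a \<and> adj G p c"
          using trM[of a p b] trM[of a p c] trM[of b p c] that(1) MC tri com by blast
        moreover have "adj G q b \<and> adj G q c \<or> adj G q a \<and> adj G q b \<or> adj G q a \<and> adj G q c"
          using trM[of a q b] trM[of a q c] trM[of b q c] that(2) MC tri com by blast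
        ultimately show ?thesis using MC by blast
      qed
      \<comment> \<open>Two nonneighbours of \<open>v\<close> in \<open>M\<close> are not adjacent.\<close>
      have nn: "\<not> adj G p q" if pq: "p \<in> M" "q \<in> M" "\<not> adj G v p" "\<not> adj G v q" for p q
      proof
        assume adj_pq: "adj G p q"
        have r: False if "r \<in> M" "adj G v r" "adj G p r" "adj G q r" for r
          using no[of r p q v] that adj_pq pq com by blast
        show False
        proof (cases "adj G p y \<and> adj G q y")
          case True
          then show False using r[OF yv(1)] yv com by blast
        next
          case False
          obtain s where s: "s \<in> M" "adj G p s" "adj G q s" using third[OF pq(1,2) adj_pq] by blast
          have sv: "\<not> adj G v s" using r[OF s(1)] s by blast
          have "adj G p y \<or> adj G q y" using trM[of p y q] pq yv(1) adj_pq com by blast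
          moreover have "adj G s y"
            using trM[of p y s] trM[of q y s] False pq(1,2) s yv(1) com by blast
          ultimately show False
            using no[of y p s v] no[of y q s v] s sv pq yv com by blast
        qed
      qed
      \<comment> \<open>A nonneighbour and a neighbour of \<open>v\<close> in \<open>M\<close> are adjacent.\<close>
      have na: False if pq: "p \<in> M" "q \<in> M" "\<not> adj G p q" "\<not> adj G v p" "adj G v q" for p q
      proof -
        have "p \<noteq> q" using pq by blast
        obtain r where r: "r \<in> M" "adj G p r"
          using trM[of a p b] pq(1) MC tri com by blast
        have "adj G q r" using trM[of p q r] r pq com by blast
        moreover have "adj G v r" using nn[OF pq(1) r(1) pq(4)] r by blast
        ultimately show False using no[of r q v p] pq r com by blast
      qed
      have "good (insert v M)"
        unfolding good_def
      proof (intro conjI ballI impI)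
        show "{a, b, c} \<subseteq> insert v M" using MC by blast
        show "insert v M \<subseteq> component G x" using MC(1) component_adj[OF G _ yv(2)] yv(1) by blast
        fix p q r assume pqr: "p \<in> insert v M" "q \<in> insert v M" "r \<in> insert v M" "\<not> adj G p q" "\<not> adj G q r"
        show "\<not> adj G p r"
          using pqr trM[of p q r] nn[of p r] na[of q r] na[of q p] na[of p q] na[of r q] irr com
          by (elim insertE) (metis | blast)+
      qed
      moreover have "finite M" using finite_subset[OF MC(1) \<open>finite (component G x)\<close>] .
      ultimately show False using M(2)[of "insert v M"] vM by simp
    qed
  qed (use MC in blast)
  then have CM: "component G x = M" using MC component_eq[OF tri(1)] by blast
  define g where "g u = {v\<in>M. \<not> adj G u v}" for u
  have "adj G y z \<longleftrightarrow> g y \<noteq> g z" if "y \<in> M" "z \<in> M" for y z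
  proof
    assume "adj G y z"
    then show "g y \<noteq> g z" using irr that unfolding g_def by blast
  next
    assume "g y \<noteq> g z"
    show "adj G y z"
    proof (rule ccontr)
      assume "\<not> adj G y z"
      then have "g y = g z" using trM that com unfolding g_def by blast
      then show False using \<open>g y \<noteq> g z\<close> by simp
    qed
  qed
  then show ?thesis unfolding CM by blast
qed

text \<open>
  A shortest odd closed walk is an induced cycle: a repeated vertex or a chord splits it into
  two closed walks, one of which is odd and shorter.
\<close>

lemma odd_closed_walk_imp_odd_hole:
  fixes R :: "'a \<Rightarrow> 'a \<Rightarrow> bool"
  assumes sym: "\<And>x y. R x y \<Longrightarrow> R y x" and irrefl: "\<And>x. \<not> R x x"
    and walk: "(x, x) \<in> {(u, v). R u v} ^^ n" "odd n"
    and no_triangle: "\<And>a b c. R a b \<Longrightarrow> R b c \<Longrightarrow> R a c \<Longrightarrow> False"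
  shows "\<exists>k f. odd k \<and> k \<ge> 5 \<and> inj_on f {..<k} \<and>
    (\<forall>i<k. \<forall>j<k. R (f i) (f j) \<longleftrightarrow> j = Suc i mod k \<or> i = Suc j mod k)"
proof -
  let ?E = "{(u, v). R u v}"
  define k where "k = (LEAST k. odd k \<and> (\<exists>x. (x, x) \<in> ?E ^^ k))"
  have k: "odd k" "\<exists>x. (x, x) \<in> ?E ^^ k"
    using LeastI[of "\<lambda>k. odd k \<and> (\<exists>x. (x, x) \<in> ?E ^^ k)" n] walk unfolding k_def by blast+
  have least: "k \<le> l" if "odd l" "(y, y) \<in> ?E ^^ l" for l y
    unfolding k_def by (rule Least_le) (use that in blast)
  obtain y where "(y, y) \<in> ?E ^^ k" using k(2) by blast
  then obtain f where f: "f 0 = y" "f k = y" "\<And>i. i < k \<Longrightarrow> R (f i) (f (Suc i))"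
    unfolding relpow_fun_conv by auto
  have sub: "(f i, f j) \<in> ?E ^^ (j - i)" if "i \<le> j" "j \<le> k" for i j
    unfolding relpow_fun_conv by (rule exI[of _ "\<lambda>m. f (i + m)"]) (use f(3) that in auto)
  have around: "(f j, f i) \<in> ?E ^^ (k - j + i)" if "i \<le> j" "j \<le> k" for i j
  proof -
    have "(f j, f 0) \<in> ?E ^^ (k - j)" using sub[of j k] that f(1,2) by simp
    moreover have "(f 0, f i) \<in> ?E ^^ i" using sub[of 0 i] that by simp
    ultimately show ?thesis unfolding relpow_add by blast
  qed
  have inj: "f i \<noteq> f j" if "i < j" "j < k" for i j
  proof
    assume eq: "f i = f j"
    have "(f i, f i) \<in> ?E ^^ (j - i)" "(f i, f i) \<in> ?E ^^ (k - j + i)"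
      using sub[of i j] around[of i j] that eq by simp_all
    moreover have "odd (j - i) \<or> odd (k - j + i)" using k(1) that by presburger
    ultimately have "k \<le> j - i \<or> k \<le> k - j + i" using least by blast
    then show False using that by linarith
  qed
  \<comment> \<open>The chord closes both arcs of the walk, whose lengths then add up to the odd number \<open>k + 2\<close>.\<close>
  have chord: "j = Suc i \<or> i = 0 \<and> j = k - 1" if "i < j" "j < k" "R (f i) (f j)" for i j
  proof -
    have "(f j, f j) \<in> ?E ^^ Suc (j - i)"
      using relpow_Suc_I2[of "f j" "f i" ?E "f j" "j - i"] sub[of i j] that sym by simp
    moreover have "(f j, f j) \<in> ?E ^^ Suc (k - j + i)"
      using relpow_Suc_I[of "f j" "f i" "k - j + i" ?E "f j"] around[of i j] that by simp
    moreover have "odd (Suc (j - i)) \<or> odd (Suc (k - j + i))" using k(1) that by presburger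
    ultimately have "k \<le> Suc (j - i) \<or> k \<le> Suc (k - j + i)" using least by blast
    then show ?thesis using that by linarith
  qed
  have last: "R (f (k - 1)) (f 0)" if "k \<ge> 1" using f(3)[of "k - 1"] that f(1,2) by simp
  have "k \<noteq> 1" using f(3)[of 0] f(1,2) irrefl by auto
  moreover have "k \<noteq> 3"
  proof
    assume "k = 3"
    then have "R (f 0) (f 1)" "R (f 1) (f 2)" "R (f 2) (f 0)"
      using f(3)[of 0] f(3)[of 1] last by (simp_all add: numeral_2_eq_2)
    then show False using no_triangle sym by blast
  qed
  ultimately have "k \<ge> 5" using k(1) by presburger
  moreover have "inj_on f {..<k}" using inj by (metis inj_onI lessThan_iff linorder_neqE_nat)
  moreover have "R (f i) (f j) \<longleftrightarrow> j = Suc i mod k \<or> i = Suc j mod k" if ij: "i < k" "j < k" for i j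
  proof -
    have Suc_mod: "Suc m mod k = (if m = k - 1 then 0 else Suc m)" if "m < k" for m
      using that by (auto simp: mod_Suc)
    have succ: "R (f m) (f (Suc m mod k))" if "m < k" for m
      using f(3)[OF that] last that unfolding Suc_mod[OF that] by auto
    show ?thesis
    proof
      assume R: "R (f i) (f j)"
      then have "i \<noteq> j" using irrefl by auto
      then show "j = Suc i mod k \<or> i = Suc j mod k"
      proof (cases "i < j")
        case True
        then show ?thesis
          using chord[of i j] R ij unfolding Suc_mod[OF ij(1)] Suc_mod[OF ij(2)] by auto
      next
        case False
        then have "j < i" using \<open>i \<noteq> j\<close> by simp
        then show ?thesis
          using chord[of j i] sym[OF R] ij unfolding Suc_mod[OF ij(1)] Suc_mod[OF ij(2)] by auto
      qed
    next
      assume "j = Suc i mod k \<or> i = Suc j mod k"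
      then show "R (f i) (f j)" using succ ij sym by blast
    qed
  qed
  ultimately show ?thesis using k(1) by blast
qed

lemma relpow_sym:
  assumes "\<And>x y. R x y \<Longrightarrow> R y x" "(x, y) \<in> {(u, v). R u v} ^^ n"
  shows "(y, x) \<in> {(u, v). R u v} ^^ n"
  using assms(2)
proof (induction n arbitrary: y)
  case (Suc n)
  then obtain z where "(x, z) \<in> {(u, v). R u v} ^^ n" "R z y" by auto
  then show ?case using Suc.IH assms(1) by (intro relpow_Suc_I2[of y z]) auto
qed simp

text \<open>
  Without odd closed walks, the parity of the length of a walk from \<open>x\<close> is a 2-colouring.
\<close>

lemma odd_hole_free_component:
  assumes G: "simple_graph G" and hole: "odd_hole_free G" and x: "x \<in> verts G"
    and no_triangle: "\<And>a b c. a \<in> component G x \<Longrightarrow> adj G a b \<Longrightarrow> adj G b c \<Longrightarrow> adj G a c \<Longrightarrow> False"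
  shows "\<exists>p :: 'a \<Rightarrow> bool. \<forall>y\<in>component G x. \<forall>z\<in>component G x. adj G y z \<longrightarrow> p y \<noteq> p z"
proof -
  define R where "R u v \<longleftrightarrow> adj G u v \<and> u \<in> component G x \<and> v \<in> component G x" for u v
  have sym: "R v u" if "R u v" for u v using that unfolding R_def by (auto simp: adj_commute)
  have irrefl: "\<not> R u u" for u using simple_graph_adjD(3)[OF G, of u u] unfolding R_def by blast
  let ?E = "{(u, v). R u v}"
  have no_odd: False if walk: "(y, y) \<in> ?E ^^ n" "odd n" for y n
  proof -
    have "\<exists>k f. odd k \<and> k \<ge> 5 \<and> inj_on f {..<k} \<and>
        (\<forall>i<k. \<forall>j<k. R (f i) (f j) \<longleftrightarrow> j = Suc i mod k \<or> i = Suc j mod k)"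
    proof (rule odd_closed_walk_imp_odd_hole)
      show False if "R a b" "R b c" "R a c" for a b c using no_triangle that unfolding R_def by blast
    qed (fact sym irrefl walk)+
    then obtain k f where k: "odd k" "k \<ge> 5" and f: "inj_on f {..<k}"
      "\<And>i j. i < k \<Longrightarrow> j < k \<Longrightarrow> R (f i) (f j) \<longleftrightarrow> j = Suc i mod k \<or> i = Suc j mod k"
      by blast
    have fC: "f i \<in> component G x" if "i < k" for i
      using f(2)[of i "Suc i mod k"] that unfolding R_def by auto
    have "embedding f (cycle_graph k) G"
      unfolding embedding_def
    proof (intro conjI ballI)
      have V: "verts (cycle_graph k) = {..<k}" by (simp add: cycle_graph_def)
      show "inj_on f (verts (cycle_graph k))" using f(1) V by simp
      show "f ` verts (cycle_graph k) \<subseteq> verts G" using fC component_subset[of G x] V by auto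
      fix i j assume "i \<in> verts (cycle_graph k)" "j \<in> verts (cycle_graph k)"
      then have ij: "i < k" "j < k" using V by auto
      then show "adj (cycle_graph k) i j \<longleftrightarrow> adj G (f i) (f j)"
        using f(2)[OF ij] fC unfolding adj_cycle_graph R_def by auto
    qed
    then show False
      using hole k unfolding odd_hole_free_def contains_induced_iff_embedding by blast
  qed
  have reach: "\<exists>n. (x, y) \<in> ?E ^^ n" if "y \<in> component G x" for y
  proof -
    have "component G x \<subseteq> {y. y \<in> component G x \<and> (x, y) \<in> ?E\<^sup>*}"
    proof (rule component_subset_closed)
      fix y z assume "y \<in> {y. y \<in> component G x \<and> (x, y) \<in> ?E\<^sup>*}" "adj G y z"
      then show "z \<in> {y. y \<in> component G x \<and> (x, y) \<in> ?E\<^sup>*}"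
        using component_adj[OF G, of y x z] unfolding R_def by (auto intro: rtrancl_into_rtrancl)
    qed (use component_self[OF x] in simp)
    then show ?thesis using that rtrancl_imp_relpow by blast
  qed
  define p where "p y \<longleftrightarrow> (\<exists>n. even n \<and> (x, y) \<in> ?E ^^ n)" for y
  have "p y \<noteq> p z" if "y \<in> component G x" "z \<in> component G x" "adj G y z" for y z
  proof -
    have R: "R y z" using that unfolding R_def by simp
    have step: "(x, z) \<in> ?E ^^ Suc n" if "(x, y) \<in> ?E ^^ n" for n
      using relpow_Suc_I[OF that, of z] R by simp
    have "\<not> (p y \<and> p z)"
    proof
      assume "p y \<and> p z"
      then obtain m n where mn: "even m" "(x, y) \<in> ?E ^^ m" "even n" "(x, z) \<in> ?E ^^ n" unfolding p_def by blast
      have "(x, x) \<in> ?E ^^ (Suc m + n)"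
        using step[OF mn(2)] relpow_sym[of R, OF sym mn(4)] unfolding relpow_add by blast
      then show False using no_odd[of x "Suc m + n"] mn by simp
    qed
    moreover have "p y \<or> p z"
    proof -
      obtain n where "(x, y) \<in> ?E ^^ n" using reach \<open>y \<in> component G x\<close> by blast
      then have n: "(x, y) \<in> ?E ^^ n" "(x, z) \<in> ?E ^^ Suc n" using step by blast+
      show ?thesis
      proof (cases "even n")
        case True
        then show ?thesis using n(1) unfolding p_def by blast
      next
        case False
        then have "even (Suc n)" by simp
        then show ?thesis using n(2) unfolding p_def by blast
      qed
    qed
    ultimately show ?thesis by blast
  qed
  then show ?thesis by blast
qed

section \<open>Splitting of P4-free graphs\<close>

text \<open>
  Distinctness is required because \<open>R\<close> is also used negated, and then it need not be
  irreflexive.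
\<close>

definition P4_on :: "('a \<Rightarrow> 'a \<Rightarrow> bool) \<Rightarrow> 'a \<Rightarrow> 'a \<Rightarrow> 'a \<Rightarrow> 'a \<Rightarrow> bool" where
  "P4_on R a b c d \<longleftrightarrow> distinct [a, b, c, d] \<and>
     R a b \<and> R b c \<and> R c d \<and> \<not> R a c \<and> \<not> R b d \<and> \<not> R a d"

definition P4_free_on :: "('a \<Rightarrow> 'a \<Rightarrow> bool) \<Rightarrow> 'a set \<Rightarrow> bool" where
  "P4_free_on R S \<longleftrightarrow> (\<forall>a\<in>S. \<forall>b\<in>S. \<forall>c\<in>S. \<forall>d\<in>S. \<not> P4_on R a b c d)"

text \<open>
  The graph on \<open>S\<close> is disconnected. For the negated relation this says that the complement is
  disconnected.
\<close>

definition splits :: "('a \<Rightarrow> 'a \<Rightarrow> bool) \<Rightarrow> 'a set \<Rightarrow> bool" where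
  "splits R S \<longleftrightarrow> (\<exists>X Y. X \<noteq> {} \<and> Y \<noteq> {} \<and> X \<inter> Y = {} \<and> S = X \<union> Y \<and> (\<forall>x\<in>X. \<forall>y\<in>Y. \<not> R x y))"

lemma splitsI:
  "X \<noteq> {} \<Longrightarrow> Y \<noteq> {} \<Longrightarrow> X \<inter> Y = {} \<Longrightarrow> S = X \<union> Y \<Longrightarrow> (\<And>x y. x \<in> X \<Longrightarrow> y \<in> Y \<Longrightarrow> \<not> R x y) \<Longrightarrow> splits R S"
  unfolding splits_def by metis

text \<open>
  The nonneighbours \<open>M\<close> of \<open>v\<close> in \<open>X\<close> can be split off: an edge from \<open>M\<close> to a neighbour \<open>y\<close> of
  \<open>v\<close> in \<open>X\<close> would give the induced path with the two further vertices \<open>v\<close> and \<open>d\<close>.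
\<close>

lemma P4_free_splits_partial_neighbour:
  assumes sym: "symp R" and v: "v \<notin> X" "v \<notin> Y"
    and XY: "X \<inter> Y = {}" "\<And>x y. x \<in> X \<Longrightarrow> y \<in> Y \<Longrightarrow> \<not> R x y"
    and P4_free: "P4_free_on R (insert v (X \<union> Y))"
    and w: "w \<in> X" "\<not> R v w" and d: "d \<in> Y" "R v d"
  shows "splits R (insert v (X \<union> Y))"
proof (rule splitsI)
  define M N where "M = {x\<in>X. \<not> R v x}" and "N = insert v (X \<union> Y) - M"
  show "M \<noteq> {}" "N \<noteq> {}" using w v unfolding M_def N_def by auto
  show "insert v (X \<union> Y) = M \<union> N" "M \<inter> N = {}" unfolding M_def N_def by auto
  fix x y assume xy: "x \<in> M" "y \<in> N"
  show "\<not> R x y"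
  proof
    assume R: "R x y"
    have com: "R q p" if "R p q" for p q using that sym by (simp add: symp_def)
    have x: "x \<in> X" "\<not> R v x" using xy(1) unfolding M_def by auto
    have "y \<noteq> v" using x(2) com[OF R] by blast
    moreover have "y \<notin> Y" using XY(2) x R by blast
    ultimately have y: "y \<in> X" "R v y" using xy(2) unfolding M_def N_def by auto
    have "distinct [x, y, v, d]" using x y d v XY(1) by auto
    then have "P4_on R x y v d"
      unfolding P4_on_def using R com[OF y(2)] d(2) com[of x v] x(2) XY(2)[OF x(1) d(1)] XY(2)[OF y(1) d(1)] by blast
    then show False using P4_free x y d unfolding P4_free_on_def by blast
  qed
qed

lemma P4_free_splits_insert:
  assumes sym: "symp R" and v: "v \<notin> S" and S: "splits R S"
    and P4_free: "P4_free_on R (insert v S)"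
  shows "splits R (insert v S) \<or> splits (\<lambda>x y. \<not> R x y) (insert v S)"
proof -
  obtain X Y where XY: "X \<noteq> {}" "Y \<noteq> {}" "X \<inter> Y = {}" "S = X \<union> Y" "\<And>x y. x \<in> X \<Longrightarrow> y \<in> Y \<Longrightarrow> \<not> R x y"
    using S unfolding splits_def by metis
  have YX: "\<not> R y x" if "x \<in> X" "y \<in> Y" for x y using XY(5)[OF that] sym by (auto simp: symp_def)
  have v': "v \<notin> X" "v \<notin> Y" using v XY(4) by auto
  consider "\<forall>x\<in>X. \<not> R v x" | "\<forall>y\<in>Y. \<not> R v y" | "\<forall>x\<in>X \<union> Y. R v x"
    | w d where "w \<in> X" "\<not> R v w" "d \<in> Y" "R v d"
    | w d where "w \<in> Y" "\<not> R v w" "d \<in> X" "R v d" by blast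
  then show ?thesis
  proof cases
    case 1
    have "splits R (insert v S)"
      by (rule splitsI[of "insert v Y" X]) (use XY YX v' 1 in auto)
    then show ?thesis ..
  next
    case 2
    have "splits R (insert v S)"
      by (rule splitsI[of "insert v X" Y]) (use XY v' 2 in auto)
    then show ?thesis ..
  next
    case 3
    have "splits (\<lambda>x y. \<not> R x y) (insert v S)"
      by (rule splitsI[of "{v}" S]) (use XY v 3 in auto)
    then show ?thesis ..
  next
    case 4
    have "splits R (insert v S)"
      using P4_free_splits_partial_neighbour[OF sym v' XY(3,5) _ 4] P4_free unfolding XY(4) by blast
    then show ?thesis ..
  next
    case 5
    have "Y \<inter> X = {}" "insert v (Y \<union> X) = insert v S" using XY by auto
    then have "splits R (insert v S)"
      using P4_free_splits_partial_neighbour[OF sym v'(2,1) _ YX _ 5] P4_free by simp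
    then show ?thesis ..
  qed
qed

text \<open>
  The path with four vertices is isomorphic to its complement.
\<close>

lemma P4_free_on_complement:
  assumes "symp R" "P4_free_on R S"
  shows "P4_free_on (\<lambda>x y. \<not> R x y) S"
proof -
  have "P4_on R c a d b" if "P4_on (\<lambda>x y. \<not> R x y) a b c d" for a b c d
    using that assms(1) unfolding P4_on_def symp_def by auto
  then show ?thesis using assms(2) unfolding P4_free_on_def by blast
qed

text \<open>
  Seinsche's theorem: a graph with at least two vertices and without induced paths on four
  vertices is disconnected, or its complement is. Induction on the vertices, with the complement
  treated by the same step.
\<close>

lemma P4_free_splits:
  assumes "finite S" "card S \<ge> 2" "symp R" "P4_free_on R S"
  shows "splits R S \<or> splits (\<lambda>x y. \<not> R x y) S"
  using assms(1,2,4)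
proof (induction S rule: finite_induct)
  case (insert v S)
  show ?case
  proof (cases "card S \<ge> 2")
    case False
    then have "card S = 1" using insert by simp
    then obtain u where u: "S = {u}" by (rule card_1_singletonE)
    then have uv: "{v} \<inter> {u} = {}" "insert v S = {v} \<union> {u}" using insert.hyps by auto
    show ?thesis
    proof (cases "R v u")
      case True
      have "splits (\<lambda>x y. \<not> R x y) (insert v S)" by (rule splitsI[OF _ _ uv]) (use True in auto)
      then show ?thesis ..
    next
      case False
      have "splits R (insert v S)" by (rule splitsI[OF _ _ uv]) (use False in auto)
      then show ?thesis ..
    qed
  next
    case True
    have "P4_free_on R S" using insert.prems(2) unfolding P4_free_on_def by blast
    from insert.IH[OF True this] show ?thesis
    proof
      assume "splits R S"
      then show ?thesis using P4_free_splits_insert[OF assms(3) insert.hyps(2) _ insert.prems(2)] by blast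
    next
      assume "splits (\<lambda>x y. \<not> R x y) S"
      moreover have "symp (\<lambda>x y. \<not> R x y)" using assms(3) by (auto simp: symp_def)
      ultimately show ?thesis
        using P4_free_splits_insert[OF _ insert.hyps(2) _ P4_free_on_complement[OF assms(3) insert.prems(2)]] by auto
    qed
  qed
qed simp

section \<open>The listed pairs have perfect products\<close>

lemma contains_paw_iff:
  assumes "simple_graph G"
  shows "contains_induced G paw \<longleftrightarrow> (\<exists>a b c d. induces_paw G a b c d)"
proof
  assume "contains_induced G paw"
  then obtain f :: "nat \<Rightarrow> 'a"
    where f: "\<forall>i\<in>{..<4}. \<forall>j\<in>{..<4}. adj paw i j \<longleftrightarrow> adj G (f i) (f j)"
    unfolding contains_induced_iff_embedding embedding_def by (auto simp: paw_def)
  have "induces_paw G (f 0) (f 1) (f 2) (f 3)"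
    using f unfolding induces_paw_def lessThan_4 by (simp add: paw_def doubleton_eq_iff)
  then show "\<exists>a b c d. induces_paw G a b c d" by blast
next
  assume "\<exists>a b c d. induces_paw G a b c d"
  then obtain a b c d where P: "induces_paw G a b c d" by blast
  then have adj: "adj G a b" "adj G a c" "adj G b c" "adj G a d" "\<not> adj G b d" "\<not> adj G c d"
    unfolding induces_paw_def by auto
  have V: "{a, b, c, d} \<subseteq> verts G"
    using simple_graph_adjD(1,2)[OF assms adj(1)] simple_graph_adjD(2)[OF assms adj(2)]
      simple_graph_adjD(2)[OF assms adj(4)] by blast
  have "a \<noteq> b" "a \<noteq> c" "b \<noteq> c" "a \<noteq> d"
    using simple_graph_adjD(3)[OF assms] adj(1-4) by blast+
  moreover have "b \<noteq> d" "c \<noteq> d" using adj(3,5,6) by (auto simp: adj_commute)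
  ultimately have "embedding (\<lambda>i. [a, b, c, d] ! i) paw G"
    unfolding embedding_def
    using adj V adj_irrefl[OF assms] by (simp add: paw_def lessThan_4 adj_commute doubleton_eq_iff)
  then show "contains_induced G paw" unfolding contains_induced_iff_embedding by blast
qed

lemma induces_P4_complement:
  assumes "simple_graph G" "induces_P4 G a b c d"
  shows "induces_P4 (graph_complement G) b d a c"
  using assms induces_P4_distinct[OF assms] unfolding induces_P4_def adj_complement
  by (auto simp: adj_commute)

lemma induces_C5_complement:
  assumes "simple_graph G" "induces_C5 G a b c d e"
  shows "induces_C5 (graph_complement G) a c e b d"
  using assms(2) induces_C5_distinct[OF assms] unfolding induces_C5_def induces_P4_def adj_complement
  by (auto simp: adj_commute)

lemma C5_embedding_path_3:
  assumes G: "simple_graph G" and "adj G a b" "adj G b c" "\<not> adj G a c" "a \<noteq> c" and V: "verts G = {a, b, c}"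
  shows "C5_embedding (verts G) (adj G) (\<lambda>x. if x = a then 0 else if x = b then 1 else 2)"
proof -
  have "a \<noteq> b" "b \<noteq> c" using assms(2,3) simple_graph_adjD(3)[OF G] by blast+
  then show ?thesis
    unfolding C5_embedding_def V using assms(2-5) adj_irrefl[OF G] by (simp add: adj_commute)
qed

lemma C5_embedding_P4:
  assumes G: "simple_graph G" and P: "induces_P4 G a b c d" and V: "verts G = {a, b, c, d}"
  shows "C5_embedding (verts G) (adj G) (\<lambda>x. if x = a then 0 else if x = b then 1 else if x = c then 2 else 3)"
proof -
  have d: "a \<noteq> b" "a \<noteq> c" "a \<noteq> d" "b \<noteq> c" "b \<noteq> d" "c \<noteq> d"
    "b \<noteq> a" "c \<noteq> a" "d \<noteq> a" "c \<noteq> b" "d \<noteq> b" "d \<noteq> c"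
    using induces_P4_distinct(1)[OF G P] by auto
  have "adj G a b" "adj G b c" "adj G c d" "\<not> adj G a c" "\<not> adj G b d" "\<not> adj G a d"
    "adj G b a" "adj G c b" "adj G d c" "\<not> adj G c a" "\<not> adj G d b" "\<not> adj G d a"
    using P unfolding induces_P4_def by (simp_all add: adj_commute)
  then show ?thesis
    unfolding C5_embedding_def V by (simp add: d no_loop[OF G])
qed

lemma C5_embedding_C5:
  assumes G: "simple_graph G" and P: "induces_C5 G a b c d e" and V: "verts G = {a, b, c, d, e}"
  shows "C5_embedding (verts G) (adj G)
    (\<lambda>x. if x = a then 0 else if x = b then 1 else if x = c then 2 else if x = d then 3 else 4)"
proof -
  have d: "a \<noteq> b" "a \<noteq> c" "a \<noteq> d" "a \<noteq> e" "b \<noteq> c" "b \<noteq> d" "b \<noteq> e" "c \<noteq> d" "c \<noteq> e" "d \<noteq> e"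
    "b \<noteq> a" "c \<noteq> a" "d \<noteq> a" "e \<noteq> a" "c \<noteq> b" "d \<noteq> b" "e \<noteq> b" "d \<noteq> c" "e \<noteq> c" "e \<noteq> d"
    using induces_C5_distinct(1)[OF G P] by auto
  have "adj G a b" "adj G b c" "adj G c d" "adj G d e" "adj G e a"
    "\<not> adj G a c" "\<not> adj G b d" "\<not> adj G a d" "\<not> adj G e b" "\<not> adj G e c"
    "adj G b a" "adj G c b" "adj G d c" "adj G e d" "adj G a e"
    "\<not> adj G c a" "\<not> adj G d b" "\<not> adj G d a" "\<not> adj G b e" "\<not> adj G c e"
    using P unfolding induces_C5_def induces_P4_def by (simp_all add: adj_commute)
  then show ?thesis
    unfolding C5_embedding_def V by (simp add: d no_loop[OF G])
qed

lemma perfect_product_C5: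
  assumes "simple_graph G" "simple_graph H"
    and "\<exists>f. C5_embedding (verts G) (adj G) f" "\<exists>f. C5_embedding (verts H) (adj H) f"
  shows "perfect (G \<nabla> H)"
  unfolding perfect_product_iff[OF assms(1,2)]
  using assms perfect_rel_C5_C5[OF simple_graph_finite simple_graph_finite] by blast

lemma bipartition_swap: "bipartition R C X Y \<Longrightarrow> bipartition R C Y X"
  unfolding bipartition_def by auto

lemma bipartition_star:
  assumes "bipartition R C X Y" "card X = 1"
  shows "\<exists>z. star_on R C z"
proof -
  obtain z where "X = {z}" using assms(2) by (rule card_1_singletonE)
  then have "star_on R C z" using assms(1) unfolding bipartition_def star_on_def by auto
  then show ?thesis ..
qed

lemma perfect_product_P4_star:
  assumes G: "simple_graph G" and H: "simple_graph H"
    and P: "induces_P4 G a b c d" "verts G = {a, b, c, d}" and Z: "star_on (adj H) (verts H) z"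
  shows "perfect (G \<nabla> H)"
  unfolding perfect_product_iff[OF G H]
proof (rule perfect_rel_P4_star)
  let ?f = "\<lambda>x. if x = a then 0 else if x = b then 1 else if x = c then 2 else 3 :: nat"
  note dist = induces_P4_distinct(1)[OF G P(1)]
  show "inj_on ?f (verts G)" "?f ` verts G \<subseteq> {0, 1, 2, 3}" using dist unfolding P(2) by (auto simp: inj_on_def)
  show "adj G x y \<longleftrightarrow> ?f x = Suc (?f y) \<or> ?f y = Suc (?f x)" if "x \<in> verts G" "y \<in> verts G" for x y
  proof -
    have d: "a \<noteq> b" "a \<noteq> c" "a \<noteq> d" "b \<noteq> c" "b \<noteq> d" "c \<noteq> d"
      "b \<noteq> a" "c \<noteq> a" "d \<noteq> a" "c \<noteq> b" "d \<noteq> b" "d \<noteq> c"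
      using dist by auto
    have "adj G a b" "adj G b c" "adj G c d" "\<not> adj G a c" "\<not> adj G b d" "\<not> adj G a d"
      "adj G b a" "adj G c b" "adj G d c" "\<not> adj G c a" "\<not> adj G d b" "\<not> adj G d a"
      using P(1) unfolding induces_P4_def by (simp_all add: adj_commute)
    then show ?thesis
      using that unfolding P(2) by (elim insertE emptyE) (simp_all add: d no_loop[OF G])
  qed
  show "adj H x y \<longleftrightarrow> x \<noteq> y \<and> (x = z \<or> y = z)" if "x \<in> verts H" "y \<in> verts H" for x y
    using Z that adj_irrefl[OF H, of x] unfolding star_on_def by (cases "x = y") auto
qed (use G H simple_graph_finite symp_adj in auto)

lemma bipartition_complement_adj:
  assumes "simple_graph G" "bipartition (adj (graph_complement G)) (verts G) X Y"
    "x \<in> verts G" "y \<in> verts G" "x \<noteq> y"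
  shows "adj G x y \<longleftrightarrow> (x \<in> X) = (y \<in> X)"
proof -
  have "adj (graph_complement G) x y \<longleftrightarrow> (x \<in> X) \<noteq> (y \<in> X)"
    using assms(2-5) unfolding bipartition_def by blast
  then show ?thesis using assms(3-5) unfolding adj_complement by auto
qed

lemma perfect_product_two_cliques_stars_cliques:
  assumes G: "simple_graph G" and H: "simple_graph H"
    and XY: "bipartition (adj (graph_complement G)) (verts G) X Y"
    and U: "union_of_stars_and_cliques H"
  shows "perfect (G \<nabla> H)"
  unfolding perfect_product_iff[OF G H]
proof (rule perfect_rel_two_cliques_stars_cliques)
  show "adj G x y \<longleftrightarrow> (x \<in> X) = (y \<in> X)" if "x \<in> verts G" "y \<in> verts G" "x \<noteq> y" for x y
    using bipartition_complement_adj[OF G XY that] .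
  show "component H x = component H y" if "x \<in> verts H" "y \<in> verts H" "adj H x y" for x y
    using component_eq[OF component_adj[OF H component_self that(3)]] that by simp
  fix i
  show "(\<forall>x\<in>verts H. \<forall>y\<in>verts H. component H x = i \<longrightarrow> component H y = i \<longrightarrow> x \<noteq> y \<longrightarrow> adj H x y) \<or>
    (\<exists>z. \<forall>x\<in>verts H. \<forall>y\<in>verts H. component H x = i \<longrightarrow> component H y = i \<longrightarrow> x \<noteq> y \<longrightarrow>
      (adj H x y \<longleftrightarrow> x = z \<or> y = z))"
  proof (cases "\<exists>x\<in>verts H. component H x = i")
    case True
    have mem: "y \<in> i" if "y \<in> verts H" "component H y = i" for y
      using component_self[OF that(1)] that(2) by simp
    have "clique_on (adj H) i \<or> (\<exists>z. star_on (adj H) i z)"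
      using U True unfolding union_of_stars_and_cliques_iff[OF H] by blast
    then show ?thesis using mem unfolding clique_on_def star_on_def by metis
  qed auto
qed (use G H simple_graph_finite symp_adj in auto)

text \<open>
  \<open>paw_free_component\<close> and \<open>odd_hole_free_component\<close> provide the two kinds of components that
  \<open>perfect_rel_complete_factor\<close> admits.
\<close>

lemma perfect_product_complete:
  assumes G: "simple_graph G" and H: "simple_graph H"
    and K: "clique_on (adj G) (verts G)" and hole: "odd_hole_free H" and paw: "\<not> contains_induced H paw"
  shows "perfect (G \<nabla> H)"
  unfolding perfect_product_iff[OF G H]
proof (rule perfect_rel_complete_factor)
  show "adj G x y" if "x \<in> verts G" "y \<in> verts G" "x \<noteq> y" for x y
    using K that unfolding clique_on_def by blast
  show "component H x = component H y" if "x \<in> verts H" "y \<in> verts H" "adj H x y" for x y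
    using component_eq[OF component_adj[OF H component_self that(3)]] that by simp
  fix i assume "i \<in> component H ` verts H"
  then obtain x where x: "x \<in> verts H" "i = component H x" by blast
  have mem: "y \<in> component H x" if "y \<in> verts H" "component H y = i" for y
    using component_self[OF that(1)] that(2) x(2) by simp
  show "(\<exists>p :: 'b \<Rightarrow> bool. \<forall>x\<in>verts H. \<forall>y\<in>verts H. component H x = i \<longrightarrow> component H y = i \<longrightarrow> adj H x y \<longrightarrow> p x \<noteq> p y) \<or>
    (\<exists>g :: 'b \<Rightarrow> 'b set. \<forall>x\<in>verts H. \<forall>y\<in>verts H. component H x = i \<longrightarrow> component H y = i \<longrightarrow> x \<noteq> y \<longrightarrow> adj H x y \<longleftrightarrow> g x \<noteq> g y)"
  proof (cases "\<exists>a b c. a \<in> component H x \<and> adj H a b \<and> adj H b c \<and> adj H a c")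
    case True
    then obtain a b c where abc: "a \<in> component H x" "adj H a b" "adj H b c" "adj H a c" by blast
    have no_paw: "\<not> induces_paw H a b c d" for a b c d using paw contains_paw_iff[OF H] by blast
    have "\<exists>g :: 'b \<Rightarrow> 'b set. \<forall>y\<in>component H x. \<forall>z\<in>component H x. y \<noteq> z \<longrightarrow> adj H y z \<longleftrightarrow> g y \<noteq> g z"
      using paw_free_component[OF H x(1) no_paw abc(1,2,4,3)] .
    then show ?thesis using mem by (intro disjI2) metis
  next
    case False
    then have no_triangle: "False" if "a \<in> component H x" "adj H a b" "adj H b c" "adj H a c" for a b c
      using that by blast
    have "\<exists>p :: 'b \<Rightarrow> bool. \<forall>y\<in>component H x. \<forall>z\<in>component H x. adj H y z \<longrightarrow> p y \<noteq> p z"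
      by (rule odd_hole_free_component[OF H hole x(1) no_triangle])
    then show ?thesis using mem by (intro disjI1) metis
  qed
qed (use G H simple_graph_finite symp_adj in auto)

lemma connected_graph_component:
  assumes "connected_graph G" "x \<in> verts G"
  shows "component G x = verts G"
  using assms unfolding connected_graph_def component_def by auto

lemma embedding_five_vertices:
  fixes X :: "nat graph"
  assumes "verts X = {..<5}" "distinct [a, b, c, d, e]" "{a, b, c, d, e} \<subseteq> verts G"
    and "\<And>i j. i < 5 \<Longrightarrow> j < 5 \<Longrightarrow> adj X i j \<longleftrightarrow> adj G ([a, b, c, d, e] ! i) ([a, b, c, d, e] ! j)"
  shows "contains_induced G X"
proof -
  have "embedding (\<lambda>i. [a, b, c, d, e] ! i) X G"
    unfolding embedding_def
  proof (intro conjI ballI)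
    show "inj_on ((!) [a, b, c, d, e]) (verts X)"
      using assms(2) unfolding assms(1) by (intro inj_onI) (simp add: nth_eq_iff_index_eq)
    show "(!) [a, b, c, d, e] ` verts X \<subseteq> verts G" using assms(3) unfolding assms(1) lessThan_5 by simp
  qed (use assms in simp)
  then show ?thesis unfolding contains_induced_iff_embedding by blast
qed

lemma all_less_5: "(\<forall>i<5 :: nat. P i) \<longleftrightarrow> P 0 \<and> P 1 \<and> P 2 \<and> P 3 \<and> P 4"
proof -
  have "(\<forall>i<5 :: nat. P i) \<longleftrightarrow> (\<forall>i\<in>{..<5}. P i)" by auto
  then show ?thesis unfolding lessThan_5 by simp
qed

text \<open>
  Unless \<open>H\<close> is a single vertex, its complement is disconnected by Seinsche's theorem, so every
  component of it has a vertex \<open>v\<close> outside, which is adjacent in \<open>H\<close> to the whole component. A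
  diamond, a paw or a four-cycle in the component would give a cricket, a dart or an hourglass
  in \<open>H\<close>, with \<open>v\<close> as the vertex of degree four. A clique or a complete bipartite graph is left,
  and without four-cycles the latter is a star.
\<close>

lemma complement_union_of_stars_and_cliques:
  assumes H: "simple_graph H" and con: "connected_graph H"
    and free: "\<not> contains_induced H (path_graph 4)" "\<not> contains_induced H cricket"
      "\<not> contains_induced H dart" "\<not> contains_induced H hourglass"
  shows "union_of_stars_and_cliques (graph_complement H)"
  unfolding union_of_stars_and_cliques_iff[OF simple_graph_complement[OF H]]
proof
  fix x assume x: "x \<in> verts (graph_complement H)"
  let ?K = "graph_complement H"
  have K: "simple_graph ?K" using H by simp
  have V: "verts ?K = verts H" by simp
  have com: "adj H v u" if "adj H u v" for u v using that by (simp only: adj_commute)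
  have comK: "adj ?K v u" if "adj ?K u v" for u v using that by (simp only: adj_commute)
  let ?C = "component ?K x"
  show "clique_on (adj ?K) ?C \<or> (\<exists>z. star_on (adj ?K) ?C z)"
  proof (cases "card (verts H) \<ge> 2")
    case False
    have "is_singleton (verts H) \<or> verts H = {}"
      using False simple_graph_finite[OF H] by (simp add: is_singleton_altdef) (metis One_nat_def card_0_eq less_2_cases not_le)
    then have "clique_on (adj ?K) ?C"
      using component_subset[of ?K x] unfolding V clique_on_def is_singleton_def by (metis empty_iff insertE subsetD)
    then show ?thesis ..
  next
    case True
    have noP4: "\<not> induces_P4 H a b c d" for a b c d using free(1) contains_P4_iff[OF H] by blast
    then have "P4_free_on (adj H) (verts H)"
      unfolding P4_free_on_def P4_on_def induces_P4_def by blast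
    then have "splits (adj H) (verts H) \<or> splits (\<lambda>x y. \<not> adj H x y) (verts H)"
      by (rule P4_free_splits[OF simple_graph_finite[OF H] True symp_adj])
    moreover have "\<not> splits (adj H) (verts H)"
    proof
      assume "splits (adj H) (verts H)"
      then obtain X Y where XY: "X \<noteq> {}" "Y \<noteq> {}" "X \<inter> Y = {}" "verts H = X \<union> Y" "\<forall>x\<in>X. \<forall>y\<in>Y. \<not> adj H x y"
        unfolding splits_def by metis
      then obtain u where u: "u \<in> X" by blast
      have "component H u \<subseteq> X"
        by (rule component_subset_closed[OF u]) (use XY simple_graph_adjD(2)[OF H] in blast)
      then show False using connected_graph_component[OF con, of u] u XY by blast
    qed
    ultimately have "splits (\<lambda>x y. \<not> adj H x y) (verts H)" by blast
    then obtain X Y where XY: "X \<noteq> {}" "Y \<noteq> {}" "X \<inter> Y = {}" "verts H = X \<union> Y" "\<And>x y. x \<in> X \<Longrightarrow> y \<in> Y \<Longrightarrow> adj H x y"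
      unfolding splits_def by metis
    have in_part: "?C \<subseteq> Z" if "Z = X \<or> Z = Y" "x \<in> Z" for Z
      by (rule component_subset_closed[OF that(2)]) (use that XY com in \<open>unfold adj_complement, blast\<close>)
    obtain v where v: "v \<in> verts H" "v \<notin> ?C"
      using in_part[of X] in_part[of Y] x XY(1-4) unfolding V by blast
    have vC: "adj H v u" if "u \<in> ?C" for u
    proof (rule ccontr)
      assume n: "\<not> adj H v u"
      have "u \<in> verts H" "u \<noteq> v" using that v component_subset[of ?K x] by auto
      then have "adj ?K u v" using n v(1) com unfolding adj_complement by blast
      then show False using component_adj[OF K that] v(2) by blast
    qed
    have CV: "u \<in> verts H" "u \<noteq> v" if "u \<in> ?C" for u using that v component_subset[of ?K x] by auto
    have K_adj: "adj ?K u w \<longleftrightarrow> \<not> adj H u w" if "u \<in> ?C" "w \<in> ?C" "u \<noteq> w" for u w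
      using CV that unfolding adj_complement by blast
    note irr = adj_irrefl[OF H]
    have step: "w \<in> ?C" if "u \<in> ?C" "adj ?K u w" for u w using component_adj[OF K that] .
    have no_diamond: "\<not> induces_diamond ?K a b c d" if a: "a \<in> ?C" for a b c d
    proof
      assume D: "induces_diamond ?K a b c d"
      then have C: "b \<in> ?C" "c \<in> ?C" "d \<in> ?C" using step[OF a] unfolding induces_diamond_def by auto
      have dist: "distinct [v, c, d, a, b]"
        using D CV a C simple_graph_adjD(3)[OF K] unfolding induces_diamond_def by auto
      have adj: "adj H c d" "\<not> adj H a b" "\<not> adj H a c" "\<not> adj H a d" "\<not> adj H b c" "\<not> adj H b d"
        using D K_adj C dist unfolding induces_diamond_def by (auto simp: adj_complement)
      have "contains_induced H cricket"
      proof (rule embedding_five_vertices[OF _ dist])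
        show "verts cricket = {..<5}" by (simp add: cricket_def)
        show "{v, c, d, a, b} \<subseteq> verts H" using CV a C v by auto
        have "\<forall>i<5. \<forall>j<5. adj cricket i j \<longleftrightarrow> adj H ([v, c, d, a, b] ! i) ([v, c, d, a, b] ! j)"
          unfolding all_less_5 using adj irr vC[OF a] vC[OF C(1)] vC[OF C(2)] vC[OF C(3)]
          by (simp add: cricket_def adj_commute doubleton_eq_iff)
        then show "adj cricket i j \<longleftrightarrow> adj H ([v, c, d, a, b] ! i) ([v, c, d, a, b] ! j)" if "i < 5" "j < 5" for i j
          using that by blast
      qed
      then show False using free(2) by blast
    qed
    have no_paw: "\<not> induces_paw ?K a b c d" if a: "a \<in> ?C" for a b c d
    proof
      assume D: "induces_paw ?K a b c d"
      then have C: "b \<in> ?C" "c \<in> ?C" "d \<in> ?C" using step[OF a] unfolding induces_paw_def by auto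
      have "b \<noteq> d" "c \<noteq> d" using D unfolding induces_paw_def by (auto simp: adj_commute)
      then have dist: "distinct [v, d, b, c, a]"
        using D CV a C simple_graph_adjD(3)[OF K] unfolding induces_paw_def by auto
      have adj: "adj H b d" "adj H c d" "\<not> adj H a b" "\<not> adj H a c" "\<not> adj H a d" "\<not> adj H b c"
        using D K_adj C dist unfolding induces_paw_def by (auto simp: adj_complement)
      have "contains_induced H dart"
      proof (rule embedding_five_vertices[OF _ dist])
        show "verts dart = {..<5}" by (simp add: dart_def)
        show "{v, d, b, c, a} \<subseteq> verts H" using CV a C v by auto
        have "\<forall>i<5. \<forall>j<5. adj dart i j \<longleftrightarrow> adj H ([v, d, b, c, a] ! i) ([v, d, b, c, a] ! j)"
          unfolding all_less_5 using adj irr vC[OF a] vC[OF C(1)] vC[OF C(2)] vC[OF C(3)]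
          by (simp add: dart_def adj_commute doubleton_eq_iff)
        then show "adj dart i j \<longleftrightarrow> adj H ([v, d, b, c, a] ! i) ([v, d, b, c, a] ! j)" if "i < 5" "j < 5" for i j
          using that by blast
      qed
      then show False using free(3) by blast
    qed
    have no_P4: "\<not> induces_P4 ?K a b c d" for a b c d
      using induces_P4_complement[OF K] noP4 unfolding graph_complement_complement[OF H] by blast
    have "clique_on (adj ?K) ?C \<or> (\<exists>X Y. bipartition (adj ?K) ?C X Y)"
      by (rule component_clique_or_complete_bipartite[OF K x no_P4 no_paw no_diamond])
    then show ?thesis
    proof
      assume "\<exists>X Y. bipartition (adj ?K) ?C X Y"
      then obtain X Y where B: "bipartition (adj ?K) ?C X Y" by blast
      have fin: "finite X" "finite Y"
        using B finite_subset[OF component_subset simple_graph_finite[OF K]] unfolding bipartition_def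
        by (metis finite_Un)+
      show ?thesis
      proof (cases "card X = 1 \<or> card Y = 1")
        case True
        then show ?thesis using bipartition_star[OF B] bipartition_star[OF bipartition_swap[OF B]] by blast
      next
        case False
        have "X \<noteq> {}" "Y \<noteq> {}" using B unfolding bipartition_def by auto
        then obtain a c b d where "a \<in> X" "c \<in> X" "a \<noteq> c" "b \<in> Y" "d \<in> Y" "b \<noteq> d"
          using False fin by (metis card_1_singleton_iff is_singletonI' is_singleton_altdef One_nat_def)
        then have m: "a \<in> X" "c \<in> X" "b \<notin> X" "d \<notin> X" "a \<in> ?C" "c \<in> ?C" "b \<in> ?C" "d \<in> ?C"
          and dist: "distinct [v, a, c, b, d]"
          using B CV unfolding bipartition_def by auto
        have Kab: "adj ?K p q \<longleftrightarrow> (p \<in> X) \<noteq> (q \<in> X)" if "p \<in> ?C" "q \<in> ?C" "p \<noteq> q" for p q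
          using B that unfolding bipartition_def by blast
        have adj: "adj H a c" "adj H b d" "\<not> adj H a b" "\<not> adj H a d" "\<not> adj H c b" "\<not> adj H c d"
          using Kab[of a c] Kab[of b d] Kab[of a b] Kab[of a d] Kab[of c b] Kab[of c d] K_adj m dist by auto
        have "contains_induced H hourglass"
        proof (rule embedding_five_vertices[OF _ dist])
          show "verts hourglass = {..<5}" by (simp add: hourglass_def)
          show "{v, a, c, b, d} \<subseteq> verts H" using CV m v by auto
          have "\<forall>i<5. \<forall>j<5. adj hourglass i j \<longleftrightarrow> adj H ([v, a, c, b, d] ! i) ([v, a, c, b, d] ! j)"
            unfolding all_less_5 using adj irr vC[OF m(5)] vC[OF m(6)] vC[OF m(7)] vC[OF m(8)]
            by (simp add: hourglass_def adj_commute doubleton_eq_iff)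
          then show "adj hourglass i j \<longleftrightarrow> adj H ([v, a, c, b, d] ! i) ([v, a, c, b, d] ! j)" if "i < 5" "j < 5" for i j
            using that by blast
        qed
        then show ?thesis using free(4) by blast
      qed
    qed blast
  qed
qed

lemma odd_hole_free_complement_iff:
  assumes "simple_graph H"
  shows "odd_hole_free (graph_complement H) \<longleftrightarrow> odd_antihole_free H"
proof -
  have "\<not> adj (cycle_graph k) i i" if "k \<ge> 5" for k i
    using that unfolding adj_cycle_graph by (auto simp: mod_Suc)
  then have "contains_induced H (graph_complement (cycle_graph k)) \<longleftrightarrow>
      contains_induced (graph_complement H) (cycle_graph k)" if "k \<ge> 5" for k
    using that by (intro contains_induced_complement adj_irrefl[OF assms])
  then show ?thesis unfolding odd_antihole_free_def odd_hole_free_def by auto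
qed

lemma adj_paw_irrefl: "\<not> adj paw i i"
  unfolding paw_def by (auto simp: doubleton_eq_iff)

lemma contains_co_paw_iff:
  assumes "simple_graph H"
  shows "contains_induced H co_paw \<longleftrightarrow> contains_induced (graph_complement H) paw"
  unfolding co_paw_def by (intro contains_induced_complement adj_paw_irrefl adj_irrefl[OF assms])

lemma P3_free_partition:
  assumes "simple_graph G" "\<not> has_P3 G" "x \<in> verts G" "y \<in> verts G" "x \<noteq> y"
  shows "adj G x y \<longleftrightarrow> component G x = component G y"
proof
  assume "adj G x y"
  then have "y \<in> component G x" using component_adj[OF assms(1) component_self[OF assms(3)]] by blast
  then show "component G x = component G y" by (simp add: component_eq)
next
  assume "component G x = component G y"
  then have "y \<in> component G x" using component_self[OF assms(4)] by simp
  then show "adj G x y" using component_P3_free[OF assms(1-3)] assms(5) by auto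
qed

text \<open>
  The cases \<open>K_r \<uplus> K_1\<close>, \<open>K_2 \<uplus> E_1\<close>, complete bipartite and edgeless are reduced
  to their duals.
\<close>

lemma perfect_pair_imp_perfect_product:
  assumes G: "simple_graph G" and H: "simple_graph H"
    and mnrs: "m \<ge> 1" "n \<ge> 1" "r \<ge> 1" "s \<ge> 1" and pair: "perfect_pair G H m n r s"
  shows "perfect (G \<nabla> H)"
proof -
  note cG = simple_graph_complement[OF G] and cH = simple_graph_complement[OF H]
  have dual: "perfect (graph_complement G \<nabla> graph_complement H) \<Longrightarrow> perfect (G \<nabla> H)"
    using perfect_product_complement[OF G H] by blast
  note fin = simple_graph_finite[OF G] simple_graph_finite[OF H]
  have two: "\<exists>X Y. bipartition (adj (graph_complement K)) (verts K) X Y"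
    if "simple_graph K" "K \<cong> complete_graph p \<uplus> complete_graph q" "p \<ge> 1" "q \<ge> 1" for K :: "'c graph" and p q
    using that iso_two_cliques_bipartition by blast
  have bip: "\<exists>X Y. bipartition (adj K) (verts K) X Y"
    if "simple_graph K" "K \<cong> complete_bipartite_graph p q" "p \<ge> 1" "q \<ge> 1" for K :: "'c graph" and p q
    using that iso_complete_bipartite_iff by blast
  from pair show ?thesis
    unfolding perfect_pair_def
  proof (elim disjE conjE)
    assume "G \<cong> complete_graph 1"
    then have "card (verts G) \<le> 2" unfolding iso_complete_graph_iff[OF G] by simp
    then show ?thesis
      unfolding perfect_product_iff[OF G H] using fin by (intro perfect_rel_two_vertices symp_adj)
  next
    assume "G \<cong> complete_graph 2"
    then have "card (verts G) \<le> 2" unfolding iso_complete_graph_iff[OF G] by simp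
    then show ?thesis
      unfolding perfect_product_iff[OF G H] using fin by (intro perfect_rel_two_vertices symp_adj)
  next
    assume "G \<cong> edgeless_graph 2"
    then have "card (verts G) \<le> 2" unfolding iso_edgeless_graph_iff[OF G] by simp
    then show ?thesis
      unfolding perfect_product_iff[OF G H] using fin by (intro perfect_rel_two_vertices symp_adj)
  next
    assume 1: "G \<cong> path_graph 4" and 2: "H \<cong> complete_bipartite_graph 1 r"
    obtain a b c d where P: "induces_P4 G a b c d" "verts G = {a, b, c, d}"
      using 1 unfolding iso_path_4_iff[OF G] by blast
    obtain X Y where "bipartition (adj H) (verts H) X Y" "card X = 1"
      using 2 unfolding iso_complete_bipartite_iff[OF H order_refl mnrs(3)] by blast
    then show ?thesis using bipartition_star perfect_product_P4_star[OF G H P] by blast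
  next
    assume 1: "G \<cong> path_graph 4" and 2: "H \<cong> complete_graph r \<uplus> complete_graph 1"
    obtain a b c d where P: "induces_P4 G a b c d" "verts G = {a, b, c, d}"
      using 1 unfolding iso_path_4_iff[OF G] by blast
    obtain X Y where B: "bipartition (adj (graph_complement H)) (verts (graph_complement H)) X Y" "card Y = 1"
      using 2 unfolding iso_two_cliques_bipartition[OF H mnrs(3) order_refl] by auto
    have "verts (graph_complement G) = {b, d, a, c}" using P(2) by auto
    then show ?thesis
      using bipartition_star[OF bipartition_swap[OF B(1)] B(2)]
        perfect_product_P4_star[OF cG cH induces_P4_complement[OF G P(1)]] dual by blast
  next
    assume 1: "G \<cong> path_graph 4" and 2: "H \<cong> path_graph 4"
    have "\<exists>f. C5_embedding (verts G) (adj G) f"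
      using 1 C5_embedding_P4[OF G] unfolding iso_path_4_iff[OF G] by blast
    moreover have "\<exists>f. C5_embedding (verts H) (adj H) f"
      using 2 C5_embedding_P4[OF H] unfolding iso_path_4_iff[OF H] by blast
    ultimately show ?thesis by (rule perfect_product_C5[OF G H])
  next
    assume 1: "G \<cong> cycle_graph 5" and 2: "H \<cong> path_graph 3"
    have "\<exists>f. C5_embedding (verts G) (adj G) f"
      using 1 C5_embedding_C5[OF G] unfolding iso_cycle_5_iff[OF G] by blast
    moreover have "\<exists>f. C5_embedding (verts H) (adj H) f"
      using 2 C5_embedding_path_3[OF H] unfolding iso_path_3_iff[OF H] by blast
    ultimately show ?thesis by (rule perfect_product_C5[OF G H])
  next
    assume 1: "G \<cong> cycle_graph 5" and 2: "H \<cong> complete_graph 2 \<uplus> edgeless_graph 1"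
    have "edgeless_graph 1 = complete_graph 1" unfolding edgeless_graph_def complete_graph_def by auto
    then have "\<exists>X Y. bipartition (adj (graph_complement H)) (verts H) X Y \<and> card X = 2 \<and> card Y = 1"
      using 2 iso_two_cliques_bipartition[OF H, of 2 1] by simp
    then obtain X Y where B: "bipartition (adj (graph_complement H)) (verts H) X Y" "card X = 2" "card Y = 1" by blast
    obtain a c b where ac: "X = {a, c}" "a \<noteq> c" "Y = {b}"
      using B(2,3) by (metis card_2_iff card_1_singletonE)
    have V: "verts (graph_complement H) = {a, b, c}" using B(1) ac unfolding bipartition_def by auto
    have "a \<noteq> b" "c \<noteq> b" using B(1) ac unfolding bipartition_def by auto
    then have "adj (graph_complement H) a b" "adj (graph_complement H) b c" "\<not> adj (graph_complement H) a c"
      using B(1) ac unfolding bipartition_def by auto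
    then have "\<exists>f. C5_embedding (verts (graph_complement H)) (adj (graph_complement H)) f"
      using C5_embedding_path_3[OF cH _ _ _ ac(2) V] by blast
    moreover obtain p q t u v where C: "induces_C5 G p q t u v" "verts G = {p, q, t, u, v}"
      using 1 unfolding iso_cycle_5_iff[OF G] by blast
    have "verts (graph_complement G) = {p, t, v, q, u}" using C(2) by auto
    then have "\<exists>f. C5_embedding (verts (graph_complement G)) (adj (graph_complement G)) f"
      using C5_embedding_C5[OF cG induces_C5_complement[OF G C(1)]] by blast
    ultimately show ?thesis using dual perfect_product_C5[OF cG cH] by blast
  next
    assume 1: "G \<cong> cycle_graph 5" and 2: "H \<cong> path_graph 4"
    have "\<exists>f. C5_embedding (verts G) (adj G) f"
      using 1 C5_embedding_C5[OF G] unfolding iso_cycle_5_iff[OF G] by blast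
    moreover have "\<exists>f. C5_embedding (verts H) (adj H) f"
      using 2 C5_embedding_P4[OF H] unfolding iso_path_4_iff[OF H] by blast
    ultimately show ?thesis by (rule perfect_product_C5[OF G H])
  next
    assume 1: "G \<cong> cycle_graph 5" and 2: "H \<cong> cycle_graph 5"
    have "\<exists>f. C5_embedding (verts G) (adj G) f"
      using 1 C5_embedding_C5[OF G] unfolding iso_cycle_5_iff[OF G] by blast
    moreover have "\<exists>f. C5_embedding (verts H) (adj H) f"
      using 2 C5_embedding_C5[OF H] unfolding iso_cycle_5_iff[OF H] by blast
    ultimately show ?thesis by (rule perfect_product_C5[OF G H])
  next
    assume 1: "G \<cong> complete_graph r \<uplus> complete_graph s" and 2: "union_of_stars_and_cliques H"
    then show ?thesis
      using two[OF G 1 mnrs(3,4)] perfect_product_two_cliques_stars_cliques[OF G H] by blast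
  next
    assume 1: "G \<cong> complete_bipartite_graph m n" and 2: "connected_graph H"
      "\<not> contains_induced H (path_graph 4)" "\<not> contains_induced H cricket"
      "\<not> contains_induced H dart" "\<not> contains_induced H hourglass"
    have "\<exists>X Y. bipartition (adj (graph_complement (graph_complement G))) (verts (graph_complement G)) X Y"
      using bip[OF G 1 mnrs(1,2)] graph_complement_complement[OF G] by simp
    then show ?thesis
      using complement_union_of_stars_and_cliques[OF H 2]
        perfect_product_two_cliques_stars_cliques[OF cG cH] dual by blast
  next
    assume 1: "G \<cong> complete_graph n" and 2: "odd_hole_free H" "\<not> contains_induced H paw"
    then show ?thesis using perfect_product_complete[OF G H _ 2] iso_complete_graph_iff[OF G] by blast
  next
    assume 1: "G \<cong> edgeless_graph n" and 2: "odd_antihole_free H" "\<not> contains_induced H co_paw"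
    have "clique_on (adj (graph_complement G)) (verts (graph_complement G))"
      using 1 unfolding iso_edgeless_graph_iff[OF G] clique_on_def adj_complement by simp
    moreover have "\<not> contains_induced (graph_complement H) paw"
      using 2(2) contains_co_paw_iff[OF H] by blast
    moreover have "odd_hole_free (graph_complement H)"
      using 2(1) odd_hole_free_complement_iff[OF H] by blast
    ultimately show ?thesis using perfect_product_complete[OF cG cH] dual by blast
  next
    assume 1: "complete_multipartite G" and 2: "complete_multipartite H"
    obtain f where f: "\<forall>x\<in>verts G. \<forall>y\<in>verts G. adj G x y \<longleftrightarrow> (f x :: 'a set) \<noteq> f y"
      using complete_multipartite_imp[OF 1] by blast
    obtain g where g: "\<forall>x\<in>verts H. \<forall>y\<in>verts H. adj H x y \<longleftrightarrow> (g x :: 'b set) \<noteq> g y"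
      using complete_multipartite_imp[OF 2] by blast
    show ?thesis
      unfolding perfect_product_iff[OF G H]
      by (rule perfect_rel_copartitions[of _ _ _ f _ g]) (use fin f g in auto)
  next
    assume 1: "union_of_cliques G" and 2: "union_of_cliques H"
    show ?thesis
      unfolding perfect_product_iff[OF G H]
      by (rule perfect_rel_partitions[OF fin P3_free_partition[OF G] P3_free_partition[OF H]])
        (use 1 2 union_of_cliques_iff G H in auto)
  next
    assume 1: "G \<cong> complete_graph r \<uplus> complete_graph s" and 2: "H \<cong> complete_bipartite_graph m n"
    obtain X Y where X: "bipartition (adj (graph_complement G)) (verts G) X Y" using two[OF G 1 mnrs(3,4)] by blast
    obtain X' Y' where X': "bipartition (adj H) (verts H) X' Y'" using bip[OF H 2 mnrs(1,2)] by blast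
    show ?thesis
      unfolding perfect_product_iff[OF G H]
    proof (rule perfect_rel_two_cliques_bipartite[OF fin symp_adj symp_adj])
      show "adj G x y \<longleftrightarrow> (x \<in> X) = (y \<in> X)" if "x \<in> verts G" "y \<in> verts G" "x \<noteq> y" for x y
        using bipartition_complement_adj[OF G X that] .
      show "adj H x y \<longleftrightarrow> (x \<in> X') \<noteq> (y \<in> X')" if "x \<in> verts H" "y \<in> verts H" "x \<noteq> y" for x y
        using X' that unfolding bipartition_def by blast
    qed
  qed
qed

section \<open>Odd holes in products\<close>

text \<open>
  A cycle of length at least five has no triangle, so its cliques allow two colours only; these
  would have to alternate, which fails on an odd cycle.
\<close>

lemma odd_hole_not_perfect_rel:
  assumes perf: "perfect_rel R S" and k: "odd k" "k \<ge> 5"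
    and v: "\<And>i. i < k \<Longrightarrow> v i \<in> S"
    and R: "\<And>i j. i < k \<Longrightarrow> j < k \<Longrightarrow> R (v i) (v j) \<longleftrightarrow> j = Suc i mod k \<or> i = Suc j mod k"
  shows False
proof -
  have Suc_mod: "Suc m mod k = (if Suc m = k then 0 else Suc m)" if "m < k" for m
    using that by (simp add: mod_Suc)
  have "v ` {..<k} \<subseteq> S" using v by auto
  with perf have "clique_colourable R (v ` {..<k})" by (rule perfect_relD)
  then obtain C c where C: "C \<subseteq> v ` {..<k}" "clique_on R C"
    and c: "proper_colouring R (v ` {..<k}) (card C) c"
    unfolding clique_colourable_def by blast
  have "card C \<le> 2"
  proof (rule ccontr)
    assume "\<not> card C \<le> 2"
    then have "3 \<le> card C" by simp
    then obtain D where "D \<subseteq> C" "card D = 3" by (rule obtain_subset_with_card_n)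
    then obtain x y z where "D = {x, y, z}" "x \<noteq> y" "y \<noteq> z" "x \<noteq> z" by (auto simp: card_3_iff)
    then have xyz: "R x y" "R y z" "R x z" "x \<in> C" "y \<in> C" "z \<in> C"
      using \<open>D \<subseteq> C\<close> C(2) unfolding clique_on_def by auto
    have "\<exists>i<k. u = v i" if "u \<in> C" for u using C(1) that by blast
    then obtain i j l where "i < k" "j < k" "l < k" "x = v i" "y = v j" "z = v l"
      using xyz(4-6) by metis
    then show False
      using xyz(1-3) k(2) by (auto simp: R Suc_mod split: if_splits)
  qed
  moreover have "c (v i) < card C" if "i < k" for i
    using c that unfolding proper_colouring_def by simp
  ultimately have c2: "c (v i) < 2" if "i < k" for i using that by (meson less_le_trans)
  have neq: "c (v i) \<noteq> c (v j)" if "i < k" "j < k" "j = Suc i mod k" for i j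
    using c R[of i j] that unfolding proper_colouring_def by simp
  \<comment> \<open>Two colours have to alternate along the cycle.\<close>
  have par: "c (v i) = (c (v 0) + i) mod 2" if "i < k" for i
    using that
  proof (induction i)
    case 0
    then show ?case using c2[of 0] by simp
  next
    case (Suc i)
    then have "c (v i) \<noteq> c (v (Suc i))" using neq[of i "Suc i"] by simp
    then show ?case using Suc c2[of i] c2[of "Suc i"] by (simp add: mod_Suc)
  qed
  have "k - 1 < k" "0 < k" "Suc (k - 1) mod k = 0" using k by auto
  then have "c (v (k - 1)) \<noteq> c (v 0)" using neq[of "k - 1" 0] by simp
  moreover have "even (k - 1)" using k by simp
  then obtain h where "k - 1 = 2 * h" by (rule evenE)
  ultimately show False using par[of "k - 1"] c2[of 0] k by simp
qed

lemma all_less_7: "(\<forall>i<7 :: nat. P i) \<longleftrightarrow> P 0 \<and> P 1 \<and> P 2 \<and> P 3 \<and> P 4 \<and> P 5 \<and> P 6"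
proof -
  have "(\<forall>i<7 :: nat. P i) \<longleftrightarrow> (\<forall>i\<in>{..<7}. P i)" by auto
  moreover have "{..<7 :: nat} = {0, 1, 2, 3, 4, 5, 6}" by auto
  ultimately show ?thesis by simp
qed

lemma five_hole_not_perfect_rel:
  assumes perf: "perfect_rel R S" and sym: "symp R" and S: "{p0, p1, p2, p3, p4} \<subseteq> S"
    and R: "R p0 p1" "R p1 p2" "R p2 p3" "R p3 p4" "R p4 p0"
    and nR: "\<not> R p0 p2" "\<not> R p1 p3" "\<not> R p2 p4" "\<not> R p3 p0" "\<not> R p4 p1"
  shows False
proof -
  define v where "v i = [p0, p1, p2, p3, p4] ! i" for i
  have com: "R x y \<longleftrightarrow> R y x" for x y using sym by (auto simp: symp_def)
  have irr: "\<not> R x x" if "x \<in> S" for x using perfect_rel_irrefl[OF perf that] .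
  have "\<forall>i<5. \<forall>j<5. R (v i) (v j) \<longleftrightarrow> j = Suc i mod 5 \<or> i = Suc j mod 5"
    using R nR S irr R[THEN com[THEN iffD1]] nR[unfolded com[of p0 p2] com[of p1 p3] com[of p2 p4] com[of p3 p0] com[of p4 p1]]
    unfolding all_less_5 v_def by simp
  moreover have "\<forall>i<5. v i \<in> S" using S unfolding all_less_5 v_def by simp
  ultimately show False by (intro odd_hole_not_perfect_rel[OF perf, of 5 v]) simp_all
qed

lemma seven_hole_not_perfect_rel:
  assumes perf: "perfect_rel R S" and sym: "symp R" and S: "{p0, p1, p2, p3, p4, p5, p6} \<subseteq> S"
    and R: "R p0 p1" "R p1 p2" "R p2 p3" "R p3 p4" "R p4 p5" "R p5 p6" "R p6 p0"
    and nR: "\<not> R p0 p2" "\<not> R p1 p3" "\<not> R p2 p4" "\<not> R p3 p5" "\<not> R p4 p6" "\<not> R p5 p0" "\<not> R p6 p1"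
      "\<not> R p0 p3" "\<not> R p1 p4" "\<not> R p2 p5" "\<not> R p3 p6" "\<not> R p4 p0" "\<not> R p5 p1" "\<not> R p6 p2"
  shows False
proof -
  define v where "v i = [p0, p1, p2, p3, p4, p5, p6] ! i" for i
  have com: "R x y \<Longrightarrow> R y x" for x y using sym by (auto simp: symp_def)
  have ncom: "\<not> R x y \<Longrightarrow> \<not> R y x" for x y using sym by (auto simp: symp_def)
  have irr: "\<not> R x x" if "x \<in> S" for x using perfect_rel_irrefl[OF perf that] .
  have "\<forall>i<7. \<forall>j<7. R (v i) (v j) \<longleftrightarrow> j = Suc i mod 7 \<or> i = Suc j mod 7"
    using R nR S irr R[THEN com] nR[THEN ncom]
    unfolding all_less_7 v_def by simp
  moreover have "\<forall>i<7. v i \<in> S" using S unfolding all_less_7 v_def by simp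
  ultimately show False by (intro odd_hole_not_perfect_rel[OF perf, of 7 v]) simp_all
qed

lemma symp_wprod: "symp A \<Longrightarrow> symp B \<Longrightarrow> symp (wprod A B)"
  using wprod_sym unfolding symp_def by metis

text \<open>
  The lemmas in this locale give configurations that cannot occur in the two factors of a
  perfect product. They all exhibit an explicit odd hole in the product, mostly of length five
  or seven.
\<close>

locale perfect_product =
  fixes G :: "'a graph" and H :: "'b graph"
  assumes simple: "simple_graph G" "simple_graph H"
    and perfect: "perfect (G \<nabla> H)"
begin

lemma rel: "perfect_rel (wprod (adj G) (adj H)) (verts G \<times> verts H)"
  using perfect perfect_product_iff[OF simple] by blast

lemmas no_five_hole = five_hole_not_perfect_rel[OF rel symp_wprod[OF symp_adj symp_adj]]
lemmas no_seven_hole = seven_hole_not_perfect_rel[OF rel symp_wprod[OF symp_adj symp_adj]]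

lemma adjG: "adj G x y \<Longrightarrow> x \<in> verts G \<and> y \<in> verts G \<and> x \<noteq> y \<and> y \<noteq> x \<and> adj G x y \<and> adj G y x"
  using simple_graph_adjD[OF simple(1), of x y] by (auto simp: adj_commute)

lemma adjH: "adj H x y \<Longrightarrow> x \<in> verts H \<and> y \<in> verts H \<and> x \<noteq> y \<and> y \<noteq> x \<and> adj H x y \<and> adj H y x"
  using simple_graph_adjD[OF simple(2), of x y] by (auto simp: adj_commute)

lemma nadjG: "\<not> adj G x y \<Longrightarrow> \<not> adj G y x" by (simp add: adj_commute)
lemma nadjH: "\<not> adj H x y \<Longrightarrow> \<not> adj H y x" by (simp add: adj_commute)

lemma triangle_paw_free:
  assumes "adj G a b" "adj G b c" "adj G a c" "induces_paw H x y z w"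
  shows False
proof -
  have H: "adj H x y" "adj H x z" "adj H y z" "adj H x w" "\<not> adj H y w" "\<not> adj H z w"
    using assms(4) unfolding induces_paw_def by auto
  have "y \<noteq> w" "z \<noteq> w" using H by (auto simp: adj_commute)
  then show False
    using no_five_hole[of "(a, x)" "(b, y)" "(a, z)" "(b, x)" "(c, w)"]
      assms(1-3)[THEN adjG] H(1-4)[THEN adjH] H(5,6) H(5,6)[THEN nadjH]
    by (auto simp: wprod_def)
qed

lemma diamond_free:
  assumes "induces_coP3 H x y z" "induces_diamond G a b c d"
  shows False
proof -
  have H: "z \<in> verts H" "adj H x y" "\<not> adj H x z" "\<not> adj H y z" "z \<noteq> x" "z \<noteq> y"
    using assms(1) unfolding induces_coP3_def by auto
  have G: "adj G a b" "adj G a c" "adj G a d" "adj G b c" "adj G b d" "\<not> adj G c d" "c \<noteq> d"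
    using assms(2) unfolding induces_diamond_def by auto
  show False
    using no_five_hole[of "(a, x)" "(b, y)" "(c, x)" "(d, z)" "(c, y)"]
      G(1-5)[THEN adjG] G(6,7) G(6)[THEN nadjG] H(2)[THEN adjH] H(1,3-6) H(3,4)[THEN nadjH]
    by (auto simp: wprod_def)
qed

lemma paw_free:
  assumes "induces_coP3 H x y z" "induces_paw G a b c d"
  shows False
proof -
  have H: "z \<in> verts H" "adj H x y" "\<not> adj H x z" "\<not> adj H y z" "z \<noteq> x" "z \<noteq> y"
    using assms(1) unfolding induces_coP3_def by auto
  have G: "adj G a b" "adj G a c" "adj G b c" "adj G a d" "\<not> adj G b d" "\<not> adj G c d"
    using assms(2) unfolding induces_paw_def by auto
  have "b \<noteq> d" "c \<noteq> d" using G by (auto simp: adj_commute)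
  then show False
    using no_seven_hole[of "(a, x)" "(b, y)" "(c, x)" "(a, y)" "(d, x)" "(b, z)" "(d, y)"]
      G(1-4)[THEN adjG] G(5,6) G(5,6)[THEN nadjG] H(2)[THEN adjH] H(1,3-6) H(3,4)[THEN nadjH]
    by (auto simp: wprod_def)
qed

lemma isolated_vertex_C4_free:
  assumes "induces_coP3 H x y z"
    and G: "adj G a b" "adj G b c" "adj G c d" "adj G d a" "\<not> adj G a c" "\<not> adj G b d" "a \<noteq> c" "b \<noteq> d"
    and e: "e \<in> verts G" "\<not> adj G a e" "\<not> adj G b e" "\<not> adj G c e" "\<not> adj G d e" "e \<notin> {a, b, c, d}"
  shows False
proof -
  have H: "z \<in> verts H" "adj H x y" "\<not> adj H x z" "\<not> adj H y z" "z \<noteq> x" "z \<noteq> y"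
    using assms(1) unfolding induces_coP3_def by auto
  show False
    using no_five_hole[of "(a, x)" "(b, y)" "(d, z)" "(e, x)" "(c, z)"]
      G(1-4)[THEN adjG] G(5-8) G(5,6)[THEN nadjG] e e(2-5)[THEN nadjG] H(2)[THEN adjH] H(1,3-6) H(3,4)[THEN nadjH]
    by (auto simp: wprod_def)
qed

text \<open>
  Every other set of neighbours of \<open>v\<close> on the path gives a paw, a diamond, or one of four
  bipartite graphs: the path with an isolated vertex, the path with five vertices, a fork (a
  leaf added at an inner vertex), or a banner (a four-cycle with a pendant vertex).
\<close>

lemma P4_extension:
  assumes "induces_coP3 H x y z" and P: "induces_P4 G a b c d"
    and v: "v \<in> verts G" "v \<notin> {a, b, c, d}"
  shows "adj G v a \<and> adj G v d \<and> \<not> adj G v b \<and> \<not> adj G v c"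
proof -
  have H: "z \<in> verts H" "adj H x y" "\<not> adj H x z" "\<not> adj H y z" "z \<noteq> x" "z \<noteq> y"
    using assms(1) unfolding induces_coP3_def by auto
  note Hs = H(2)[THEN adjH] H(1,3-6) H(3,4)[THEN nadjH]
  have rev: "induces_P4 G d c b a" "v \<notin> {d, c, b, a}"
    if "induces_P4 G a b c d" "v \<notin> {a, b, c, d}" for a b c d
    using that unfolding induces_P4_def by (auto simp: adj_commute)
  have P4_E1: False
    if P: "induces_P4 G a b c d" and n: "v \<notin> {a, b, c, d}" "\<not> adj G a v" "\<not> adj G b v" "\<not> adj G c v" "\<not> adj G d v" for a b c d
  proof -
    have G: "adj G a b" "adj G b c" "adj G c d" "\<not> adj G a c" "\<not> adj G b d" "\<not> adj G a d"
      using P unfolding induces_P4_def by auto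
    show False
      using no_five_hole[of "(a, z)" "(c, x)" "(b, y)" "(d, z)" "(v, x)"] induces_P4_distinct(1)[OF simple(1) P]
        G(1-3)[THEN adjG] G(4-6) G(4-6)[THEN nadjG] v(1) n n(2-5)[THEN nadjG] Hs
      by (auto simp: wprod_def)
  qed
  have P5: False
    if P: "induces_P4 G a b c d" and n: "v \<notin> {a, b, c, d}" "\<not> adj G a v" "\<not> adj G b v" "\<not> adj G c v" "adj G d v" for a b c d
  proof -
    have G: "adj G a b" "adj G b c" "adj G c d" "\<not> adj G a c" "\<not> adj G b d" "\<not> adj G a d"
      using P unfolding induces_P4_def by auto
    show False
      using no_seven_hole[of "(a, x)" "(b, y)" "(c, x)" "(d, y)" "(b, z)" "(v, y)" "(c, z)"] induces_P4_distinct(1)[OF simple(1) P]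
        G(1-3)[THEN adjG] G(4-6) G(4-6)[THEN nadjG] v(1) n n(2-4)[THEN nadjG] n(5)[THEN adjG] Hs
      by (auto simp: wprod_def)
  qed
  have fork: False
    if P: "induces_P4 G a b c d" and n: "v \<notin> {a, b, c, d}" "\<not> adj G a v" "adj G b v" "\<not> adj G c v" "\<not> adj G d v" for a b c d
  proof -
    have G: "adj G a b" "adj G b c" "adj G c d" "\<not> adj G a c" "\<not> adj G b d" "\<not> adj G a d"
      using P unfolding induces_P4_def by auto
    show False
      using no_five_hole[of "(a, x)" "(d, z)" "(b, x)" "(c, y)" "(v, z)"] induces_P4_distinct(1)[OF simple(1) P]
        G(1-3)[THEN adjG] G(4-6) G(4-6)[THEN nadjG] v(1) n n(2,4,5)[THEN nadjG] n(3)[THEN adjG] Hs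
      by (auto simp: wprod_def)
  qed
  have banner: False
    if P: "induces_P4 G a b c d" and n: "v \<notin> {a, b, c, d}" "adj G a v" "\<not> adj G b v" "adj G c v" "\<not> adj G d v" for a b c d
  proof -
    have G: "adj G a b" "adj G b c" "adj G c d" "\<not> adj G a c" "\<not> adj G b d" "\<not> adj G a d"
      using P unfolding induces_P4_def by auto
    show False
      using no_five_hole[of "(a, z)" "(c, x)" "(b, y)" "(v, z)" "(d, x)"] induces_P4_distinct(1)[OF simple(1) P]
        G(1-3)[THEN adjG] G(4-6) G(4-6)[THEN nadjG] v(1) n n(3,5)[THEN nadjG] n(2,4)[THEN adjG] Hs
      by (auto simp: wprod_def)
  qed
  note paw = paw_free[OF assms(1)] and diamond = diamond_free[OF assms(1)]
  have G: "adj G a b" "adj G b c" "adj G c d" "\<not> adj G a c" "\<not> adj G b d" "\<not> adj G a d"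
    using P unfolding induces_P4_def by auto
  note G' = G G(1-3)[THEN adjG] G(4-6)[THEN nadjG]
  note R = rev[OF P v(2)]
  have vs: "adj G v a \<longleftrightarrow> adj G a v" "adj G v b \<longleftrightarrow> adj G b v" "adj G v c \<longleftrightarrow> adj G c v" "adj G v d \<longleftrightarrow> adj G d v"
    by (simp_all add: adj_commute)
  show ?thesis
  proof (cases "adj G a v"; cases "adj G b v"; cases "adj G c v"; cases "adj G d v")
    assume "adj G a v" "adj G b v" "adj G c v" "adj G d v"
    then show ?thesis using diamond[of v b a c] G' vs induces_P4_distinct(1)[OF simple(1) P] unfolding induces_diamond_def by auto
  next
    assume "adj G a v" "adj G b v" "adj G c v" "\<not> adj G d v"
    then show ?thesis using diamond[of v b a c] G' vs induces_P4_distinct(1)[OF simple(1) P] unfolding induces_diamond_def by auto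
  next
    assume "adj G a v" "adj G b v" "\<not> adj G c v" "adj G d v"
    then show ?thesis using paw[of v a b d] G' vs unfolding induces_paw_def by auto
  next
    assume "adj G a v" "adj G b v" "\<not> adj G c v" "\<not> adj G d v"
    then show ?thesis using paw[of b a v c] G' vs unfolding induces_paw_def by auto
  next
    assume "adj G a v" "\<not> adj G b v" "adj G c v" "adj G d v"
    then show ?thesis using paw[of v c d a] G' vs unfolding induces_paw_def by auto
  next
    assume "adj G a v" "\<not> adj G b v" "adj G c v" "\<not> adj G d v"
    then show ?thesis using banner[OF P v(2)] by blast
  next
    assume "adj G a v" "\<not> adj G b v" "\<not> adj G c v" "adj G d v"
    then show ?thesis using vs by blast
  next
    assume "adj G a v" "\<not> adj G b v" "\<not> adj G c v" "\<not> adj G d v"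
    then show ?thesis using P5[OF R] by blast
  next
    assume "\<not> adj G a v" "adj G b v" "adj G c v" "adj G d v"
    then show ?thesis using diamond[of v c b d] G' vs induces_P4_distinct(1)[OF simple(1) P] unfolding induces_diamond_def by auto
  next
    assume "\<not> adj G a v" "adj G b v" "adj G c v" "\<not> adj G d v"
    then show ?thesis using paw[of b c v a] G' vs unfolding induces_paw_def by auto
  next
    assume "\<not> adj G a v" "adj G b v" "\<not> adj G c v" "adj G d v"
    then show ?thesis using banner[OF R] by blast
  next
    assume "\<not> adj G a v" "adj G b v" "\<not> adj G c v" "\<not> adj G d v"
    then show ?thesis using fork[OF P v(2)] by blast
  next
    assume "\<not> adj G a v" "\<not> adj G b v" "adj G c v" "adj G d v"
    then show ?thesis using paw[of c d v b] G' vs unfolding induces_paw_def by auto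
  next
    assume "\<not> adj G a v" "\<not> adj G b v" "adj G c v" "\<not> adj G d v"
    then show ?thesis using fork[OF R] by blast
  next
    assume "\<not> adj G a v" "\<not> adj G b v" "\<not> adj G c v" "adj G d v"
    then show ?thesis using P5[OF P v(2)] by blast
  next
    assume "\<not> adj G a v" "\<not> adj G b v" "\<not> adj G c v" "\<not> adj G d v"
    then show ?thesis using P4_E1[OF P v(2)] by blast
  qed
qed

lemma two_edges_P4_free:
  assumes G: "adj G a b" "adj G c d" "\<not> adj G a c" "\<not> adj G a d" "\<not> adj G b c" "\<not> adj G b d"
      "a \<noteq> c" "a \<noteq> d" "b \<noteq> c" "b \<noteq> d"
    and P: "induces_P4 H x y z w"
  shows False
proof -
  have H: "adj H x y" "adj H y z" "adj H z w" "\<not> adj H x z" "\<not> adj H y w" "\<not> adj H x w"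
    using P unfolding induces_P4_def by auto
  show False
    using no_seven_hole[of "(a, x)" "(b, y)" "(a, z)" "(c, x)" "(a, w)" "(c, y)" "(d, z)"] induces_P4_distinct(1)[OF simple(2) P]
      H(1-3)[THEN adjH] H(4-6) H(4-6)[THEN nadjH] G(1,2)[THEN adjG] G(3-10) G(3-6)[THEN nadjG]
    by (auto simp: wprod_def)
qed

text \<open>
  The hole is lifted to the product by running along it while alternating between two vertices
  of the triangle; the third vertex is used once, because the length is odd.
\<close>

lemma triangle_odd_hole_free:
  assumes tri: "adj G a b" "adj G b c" "adj G a c"
  shows "odd_hole_free H"
  unfolding odd_hole_free_def contains_induced_iff_embedding
proof (intro allI impI notI)
  fix k :: nat
  assume k: "5 \<le> k" "odd k" and "\<exists>f. embedding f (cycle_graph k) H"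
  then obtain f where f: "embedding f (cycle_graph k) H" by blast
  have V: "verts (cycle_graph k) = {..<k}" by (simp add: cycle_graph_def)
  have fV: "f i \<in> verts H" if "i < k" for i using f that unfolding embedding_def V by auto
  have f_eq: "f i = f j \<longleftrightarrow> i = j" if "i < k" "j < k" for i j
    using f that unfolding embedding_def V inj_on_def by auto
  have f_adj: "adj H (f i) (f j) \<longleftrightarrow> j = Suc i mod k \<or> i = Suc j mod k" if "i < k" "j < k" for i j
    using f that unfolding embedding_def V by (simp add: adj_cycle_graph)
  \<comment> \<open>The last vertex of the hole takes the third vertex of the triangle.\<close>
  define g where "g i = (if i = k - 1 then c else if even i then a else b)" for i
  have gG: "g i \<in> verts G" for i using tri[THEN adjG] unfolding g_def by auto
  have g_adj: "adj G (g i) (g j)" if "g i \<noteq> g j" for i j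
    using that tri[THEN adjG] unfolding g_def by (cases "i = k - 1"; cases "j = k - 1") auto
  have Suc_mod: "Suc m mod k = (if m = k - 1 then 0 else Suc m)" if "m < k" for m
    using that by (auto simp: mod_Suc)
  have g_neq: "g i \<noteq> g (Suc i mod k)" if "i < k" for i
  proof -
    have "a \<noteq> b" "b \<noteq> c" "a \<noteq> c" using tri[THEN adjG] by auto
    then show ?thesis using k unfolding Suc_mod[OF that] g_def by auto
  qed
  show False
  proof (rule odd_hole_not_perfect_rel[OF rel k(2,1)])
    show "(g i, f i) \<in> verts G \<times> verts H" if "i < k" for i using gG fV[OF that] by simp
    fix i j assume ij: "i < k" "j < k"
    have "g i \<noteq> g j" if "j = Suc i mod k \<or> i = Suc j mod k"
      using that g_neq[OF ij(1)] g_neq[OF ij(2)] by auto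
    moreover have "i \<noteq> j" if "j = Suc i mod k \<or> i = Suc j mod k"
      using calculation that by blast
    ultimately show "wprod (adj G) (adj H) (g i, f i) (g j, f j) \<longleftrightarrow> j = Suc i mod k \<or> i = Suc j mod k"
      unfolding wprod_def fst_conv snd_conv f_eq[OF ij] f_adj[OF ij] using g_adj[of i j] by blast
  qed
qed

end

section \<open>Factors of a perfect product\<close>

lemma perfect_product_swap: "perfect_product G H \<Longrightarrow> perfect_product H G"
  unfolding perfect_product_def using perfect_product_commute by blast

lemma perfect_product_dual: "perfect_product G H \<Longrightarrow> perfect_product (graph_complement G) (graph_complement H)"
  unfolding perfect_product_def by (simp add: perfect_product_complement)

text \<open>
  The graphs whose product with the complement of the path with three vertices is perfect.
\<close>

definition in_factor_class :: "'a graph \<Rightarrow> bool" where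
  "in_factor_class G \<longleftrightarrow> union_of_stars_and_cliques G \<or> (\<exists>X Y. bipartition (adj G) (verts G) X Y) \<or>
     G \<cong> path_graph 4 \<or> G \<cong> cycle_graph 5"

lemma bipartition_not_star_obtain:
  assumes "bipartition R C X Y" "finite C" "\<not> (\<exists>z. star_on R C z)"
  obtains a b c d where "a \<in> X" "c \<in> X" "a \<noteq> c" "b \<in> Y" "d \<in> Y" "b \<noteq> d"
proof -
  have fin: "finite X" "finite Y" and ne: "X \<noteq> {}" "Y \<noteq> {}" using assms(1,2) unfolding bipartition_def by auto
  have "card X \<noteq> 1" "card Y \<noteq> 1"
    using assms(3) bipartition_star[OF assms(1)] bipartition_star[OF bipartition_swap[OF assms(1)]] by blast+
  then have "\<not> is_singleton X" "\<not> is_singleton Y" by (simp_all add: is_singleton_altdef)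
  then show ?thesis using that ne by (metis ex_in_conv is_singletonI')
qed

context perfect_product
begin

text \<open>
  An induced path with four vertices fills \<open>G\<close>, or together with one more vertex it forms a
  five-cycle. A sixth vertex would have to be adjacent to an end vertex of one path in the cycle
  which is an inner vertex of another. Without such paths, the components are cliques or
  complete bipartite; one that is not a star contains a four-cycle, and then there is no vertex
  outside it.
\<close>

lemma factor_class:
  assumes "has_P3 (graph_complement H)"
  shows "in_factor_class G"
proof -
  obtain x y z where co: "induces_coP3 H x y z" using assms has_P3_complement[OF simple(2)] by blast
  show ?thesis
  proof (cases "\<exists>a b c d. induces_P4 G a b c d")
    case True
    then obtain a b c d where P: "induces_P4 G a b c d" by blast
    note V = induces_P4_distinct[OF simple(1) P]
    show ?thesis
    proof (cases "verts G = {a, b, c, d}")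
      case True
      then show ?thesis using P iso_path_4_iff[OF simple(1)] unfolding in_factor_class_def by blast
    next
      case False
      then obtain v where v: "v \<in> verts G" "v \<notin> {a, b, c, d}" using V(2) by blast
      note va = P4_extension[OF co P v]
      have C5: "induces_C5 G a b c d v"
        using P va unfolding induces_C5_def by (auto simp: adj_commute)
      \<comment> \<open>The cycle contains this path, in which \<open>b\<close> is an end vertex rather than an inner one.\<close>
      have P': "induces_P4 G b c d v"
        using P va unfolding induces_P4_def by (auto simp: adj_commute)
      have "w \<in> {a, b, c, d, v}" if "w \<in> verts G" for w
      proof (rule ccontr)
        assume w: "w \<notin> {a, b, c, d, v}"
        have "\<not> adj G w b" using P4_extension[OF co P that] w by blast
        moreover have "adj G w b" using P4_extension[OF co P' that] w by blast
        ultimately show False by blast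
      qed
      then have "verts G = {a, b, c, d, v}" using V(2) v by blast
      then show ?thesis using C5 iso_cycle_5_iff[OF simple(1)] unfolding in_factor_class_def by blast
    qed
  next
    case no_P4: False
    have comp: "clique_on (adj G) (component G x) \<or> (\<exists>X Y. bipartition (adj G) (component G x) X Y)"
      if "x \<in> verts G" for x
      by (rule component_clique_or_complete_bipartite[OF simple(1) that])
        (use no_P4 paw_free[OF co] diamond_free[OF co] in blast)+
    show ?thesis
    proof (cases "union_of_stars_and_cliques G")
      case False
      then obtain u where u: "u \<in> verts G" "\<not> clique_on (adj G) (component G u)"
        "\<not> (\<exists>z. star_on (adj G) (component G u) z)"
        unfolding union_of_stars_and_cliques_iff[OF simple(1)] by blast
      then obtain X Y where B: "bipartition (adj G) (component G u) X Y" using comp by blast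
      obtain a b c d where m: "a \<in> X" "c \<in> X" "a \<noteq> c" "b \<in> Y" "d \<in> Y" "b \<noteq> d"
        using bipartition_not_star_obtain[OF B _ u(3)] finite_subset[OF component_subset simple_graph_finite[OF simple(1)]] by metis
      have C: "a \<in> component G u" "b \<in> component G u" "c \<in> component G u" "d \<in> component G u"
        and n: "b \<notin> X" "d \<notin> X" using B m unfolding bipartition_def by auto
      have adj: "adj G p q \<longleftrightarrow> (p \<in> X) \<noteq> (q \<in> X)" if "p \<in> component G u" "q \<in> component G u" "p \<noteq> q" for p q
        using B that unfolding bipartition_def by blast
      have "a \<noteq> b" "b \<noteq> c" "c \<noteq> d" "d \<noteq> a" using m n by auto
      then have adjs: "adj G a b" "adj G b c" "adj G c d" "adj G d a" "\<not> adj G a c" "\<not> adj G b d"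
        using adj C m n by auto
      have "component G u = verts G"
      proof (rule ccontr)
        assume "component G u \<noteq> verts G"
        then obtain e where e: "e \<in> verts G" "e \<notin> component G u" using component_subset[of G u] by blast
        then have "\<not> adj G p e" if "p \<in> component G u" for p using component_adj[OF simple(1) that] by blast
        moreover have "e \<notin> {a, b, c, d}" using e(2) C by blast
        ultimately show False using isolated_vertex_C4_free[OF co adjs m(3,6) e(1)] C by blast
      qed
      then show ?thesis using B unfolding in_factor_class_def by auto
    qed (simp add: in_factor_class_def)
  qed
qed

text \<open>
  If \<open>H\<close> is a union of cliques, then it has at most two of them: from an edge and two isolated
  vertices, the complement of \<open>H\<close> has a diamond, and the complement of \<open>G\<close> contains an edge with
  an isolated vertex.
\<close>

lemma two_cliques_of_P3_free:
  assumes "has_P3 G" "\<not> has_P3 H" "induces_coP3 H x y z"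
  shows "bipartition (adj (graph_complement H)) (verts H) (component H x) (verts H - component H x)"
    "x \<in> component H x" "y \<in> component H x" "z \<notin> component H x"
proof -
  have co: "z \<in> verts H" "adj H x y" "\<not> adj H x z" "\<not> adj H y z" "z \<noteq> x" "z \<noteq> y"
    using assms(3) unfolding induces_coP3_def by auto
  have x: "x \<in> verts H" "y \<in> verts H" "x \<noteq> y" using simple_graph_adjD[OF simple(2) co(2)] by auto
  note adj = P3_free_partition[OF simple(2) assms(2)]
  show xx: "x \<in> component H x" using component_self[OF x(1)] .
  show xy: "y \<in> component H x" using component_adj[OF simple(2) xx co(2)] .
  show xz: "z \<notin> component H x" using component_eq[of z H x] adj[OF x(1) co(1)] co by auto
  obtain p q t where P: "adj G p q" "adj G q t" "\<not> adj G p t" "p \<noteq> t" using assms(1) unfolding has_P3_def by blast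
  interpret D: perfect_product "graph_complement H" "graph_complement G"
    using perfect_product_dual[OF perfect_product_swap] perfect_product_axioms by blast
  have coG: "induces_coP3 (graph_complement G) p t q"
    using P adjG[OF P(1)] adjG[OF P(2)] unfolding induces_coP3_def adj_complement by (auto simp: adj_commute)
  have rest: "adj H v w" if vw: "v \<in> verts H - component H x" "w \<in> verts H - component H x" "v \<noteq> w" for v w
  proof (rule ccontr)
    assume n: "\<not> adj H v w"
    have across: "\<not> adj H u w' \<and> \<not> adj H w' u \<and> w' \<noteq> u"
      if "u \<in> component H x" "w' \<in> verts H - component H x" for u w'
      using component_adj[OF simple(2) that(1)] that by (auto simp: adj_commute)
    note across[OF xx vw(1)] across[OF xx vw(2)] across[OF xy vw(1)] across[OF xy vw(2)]
    then have "induces_diamond (graph_complement H) v w x y"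
      using n vw x co(2) xx xy unfolding induces_diamond_def adj_complement by (auto simp: adj_commute)
    then show False using D.diamond_free[OF coG] by blast
  qed
  show "bipartition (adj (graph_complement H)) (verts H) (component H x) (verts H - component H x)"
    unfolding bipartition_def
  proof (intro conjI ballI impI)
    show "component H x \<noteq> {}" "verts H - component H x \<noteq> {}" using xx xz co(1) by auto
    show "verts H = component H x \<union> (verts H - component H x)" using component_subset[of H x] by blast
    fix u w assume uw: "u \<in> verts H" "w \<in> verts H" "u \<noteq> w"
    have in_x: "v \<in> component H x \<longleftrightarrow> component H v = component H x" if "v \<in> verts H" for v
      using component_eq[of v H x] component_self[OF that] by auto
    have "adj H u w \<longleftrightarrow> (u \<in> component H x) = (w \<in> component H x)"
      using adj[OF uw] in_x[OF uw(1)] in_x[OF uw(2)] rest[of u w] uw by auto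
    then show "adj (graph_complement H) u w \<longleftrightarrow> (u \<in> component H x) \<noteq> (w \<in> component H x)"
      using uw unfolding adj_complement by auto
  qed blast
qed

end

text \<open>
  A star has no path with four vertices, so the path lies in a clique.
\<close>

lemma union_of_stars_and_cliques_path:
  assumes K: "simple_graph K" and U: "union_of_stars_and_cliques K"
    and P: "adj K a b" "adj K b c" "adj K c d" "distinct [a, b, c, d]"
  shows "adj K a c" "adj K b d" "adj K a d"
proof -
  have a: "a \<in> verts K" using simple_graph_adjD(1)[OF K P(1)] .
  have C: "a \<in> component K a" "b \<in> component K a" "c \<in> component K a" "d \<in> component K a"
    using component_self[OF a] component_adj[OF K] P(1-3) by blast+
  have "clique_on (adj K) (component K a) \<or> (\<exists>z. star_on (adj K) (component K a) z)"
    using U a unfolding union_of_stars_and_cliques_iff[OF K] by blast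
  then have "clique_on (adj K) (component K a)"
  proof
    assume "\<exists>z. star_on (adj K) (component K a) z"
    then obtain z where "star_on (adj K) (component K a) z" by blast
    then have "a = z \<or> b = z" "c = z \<or> d = z" "b = z \<or> c = z"
      using P C unfolding star_on_def by auto
    then show ?thesis using P(4) by auto
  qed
  then show "adj K a c" "adj K b d" "adj K a d" using C P(4) unfolding clique_on_def by auto
qed

lemma embedding_complement_adj:
  assumes "embedding f X H" "i \<in> verts X" "j \<in> verts X" "i \<noteq> j" "\<not> adj X i j"
  shows "adj (graph_complement H) (f i) (f j)"
  using assms unfolding embedding_def adj_complement inj_on_def by auto

text \<open>
  Each of the four graphs contains an edge whose ends are joined by a path in the complement,
  where the path, or its extension by one vertex, has four vertices. In a union of stars and
  cliques this would make the ends adjacent.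
\<close>

lemma complement_union_of_stars_and_cliques_free:
  assumes H: "simple_graph H" and U: "union_of_stars_and_cliques (graph_complement H)"
  shows "\<not> contains_induced H (path_graph 4)" "\<not> contains_induced H cricket"
    "\<not> contains_induced H dart" "\<not> contains_induced H hourglass"
proof -
  note path = union_of_stars_and_cliques_path(1,3)[OF simple_graph_complement[OF H] U]
  have no: False
    if f: "embedding f X H" and V: "{i, j, k, l} \<subseteq> verts X" "distinct [i, j, k, l]"
      and X: "adj X i k \<or> adj X i l" "\<not> adj X i j" "\<not> adj X j k" "\<not> adj X k l"
    for f and X :: "nat graph" and i j k l
  proof -
    have "distinct [f i, f j, f k, f l]" using f V unfolding embedding_def inj_on_def by auto
    then have "adj (graph_complement H) (f i) (f k)" "adj (graph_complement H) (f i) (f l)"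
      using path[of "f i" "f j" "f k" "f l"] embedding_complement_adj[OF f] V X(2-4) by auto
    moreover have "adj H (f i) (f k) \<or> adj H (f i) (f l)" using f X(1) V unfolding embedding_def by auto
    ultimately show False unfolding adj_complement by blast
  qed
  show "\<not> contains_induced H (path_graph 4)"
    unfolding contains_induced_iff_embedding
    using no[of _ "path_graph 4" 1 3 0 2] by (auto simp: adj_path_graph) (auto simp: path_graph_def)
  show "\<not> contains_induced H cricket"
    unfolding contains_induced_iff_embedding
    using no[of _ cricket 1 3 4 2] by (auto simp: cricket_def doubleton_eq_iff)
  show "\<not> contains_induced H dart"
    unfolding contains_induced_iff_embedding
    using no[of _ dart 1 4 3 2] by (auto simp: dart_def doubleton_eq_iff)
  show "\<not> contains_induced H hourglass"
    unfolding contains_induced_iff_embedding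
    using no[of _ hourglass 1 3 2 4] by (auto simp: hourglass_def doubleton_eq_iff)
qed

lemma bipartition_no_coP3:
  assumes "simple_graph G" "bipartition (adj G) (verts G) X Y"
  shows "\<not> has_P3 (graph_complement G)"
proof
  assume "has_P3 (graph_complement G)"
  then obtain x y z where co: "z \<in> verts G" "adj G x y" "\<not> adj G x z" "\<not> adj G y z" "z \<noteq> x" "z \<noteq> y"
    unfolding has_P3_complement[OF assms(1)] induces_coP3_def by blast
  have "x \<in> verts G" "y \<in> verts G" "x \<noteq> y" using simple_graph_adjD[OF assms(1) co(2)] by auto
  moreover have "adj G u v \<longleftrightarrow> (u \<in> X) \<noteq> (v \<in> X)" if "u \<in> verts G" "v \<in> verts G" "u \<noteq> v" for u v
    using assms(2) that unfolding bipartition_def by simp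
  ultimately show False using co by blast
qed

lemma iso_path_4_complement:
  assumes "simple_graph G" "graph_complement G \<cong> path_graph 4"
  shows "G \<cong> path_graph 4"
proof -
  obtain a b c d where P: "induces_P4 (graph_complement G) a b c d" "verts G = {a, b, c, d}"
    using assms(2) unfolding iso_path_4_iff[OF simple_graph_complement[OF assms(1)]] by auto
  have "induces_P4 G b d a c"
    using induces_P4_complement[OF simple_graph_complement[OF assms(1)] P(1)]
    unfolding graph_complement_complement[OF assms(1)] .
  moreover have "verts G = {b, d, a, c}" using P(2) by auto
  ultimately show ?thesis unfolding iso_path_4_iff[OF assms(1)] by blast
qed

lemma iso_cycle_5_complement:
  assumes "simple_graph G" "graph_complement G \<cong> cycle_graph 5"
  shows "G \<cong> cycle_graph 5"
proof -
  obtain a b c d e where P: "induces_C5 (graph_complement G) a b c d e" "verts G = {a, b, c, d, e}"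
    using assms(2) unfolding iso_cycle_5_iff[OF simple_graph_complement[OF assms(1)]] by auto
  have "induces_C5 G a c e b d"
    using induces_C5_complement[OF simple_graph_complement[OF assms(1)] P(1)]
    unfolding graph_complement_complement[OF assms(1)] .
  moreover have "verts G = {a, c, e, b, d}" using P(2) by auto
  ultimately show ?thesis unfolding iso_cycle_5_iff[OF assms(1)] by blast
qed

text \<open>
  A complete bipartite graph contains no edge with an isolated vertex. So otherwise \<open>G\<close> and its
  complement would both be unions of stars and cliques. A path with three vertices in \<open>G\<close> lies
  in a star; a vertex outside the star gives a path with four vertices in the complement which
  is not inside a clique there, and a star alone contains no edge with an isolated vertex.
\<close>

lemma factor_class_both:
  assumes G: "simple_graph G" and P: "has_P3 G" "has_P3 (graph_complement G)"
    and L: "in_factor_class G" "in_factor_class (graph_complement G)"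
  shows "G \<cong> path_graph 4 \<or> G \<cong> cycle_graph 5"
proof (rule ccontr)
  assume no: "\<not> ?thesis"
  let ?K = "graph_complement G"
  have K: "simple_graph ?K" using G by simp
  have "\<not> (\<exists>X Y. bipartition (adj G) (verts G) X Y)" using bipartition_no_coP3[OF G] P(2) by blast
  then have U: "union_of_stars_and_cliques G" using L(1) no unfolding in_factor_class_def by blast
  have "\<not> (\<exists>X Y. bipartition (adj ?K) (verts ?K) X Y)"
    using bipartition_no_coP3[OF K] P(1) graph_complement_complement[OF G] by auto
  then have UK: "union_of_stars_and_cliques ?K"
    using L(2) no iso_path_4_complement[OF G] iso_cycle_5_complement[OF G] unfolding in_factor_class_def by blast
  obtain a b c where abc: "adj G a b" "adj G b c" "\<not> adj G a c" "a \<noteq> c" using P(1) unfolding has_P3_def by blast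
  have V: "a \<in> verts G" "b \<in> verts G" "c \<in> verts G" "a \<noteq> b" "b \<noteq> c"
    using simple_graph_adjD[OF G abc(1)] simple_graph_adjD[OF G abc(2)] by auto
  have C: "a \<in> component G a" "b \<in> component G a" "c \<in> component G a"
    using component_self[OF V(1)] component_adj[OF G] abc(1,2) by blast+
  have "\<not> clique_on (adj G) (component G a)" using C abc unfolding clique_on_def by blast
  then obtain z where z: "star_on (adj G) (component G a) z"
    using U V(1) unfolding union_of_stars_and_cliques_iff[OF G] by blast
  have "component G a = verts G"
  proof (rule ccontr)
    assume "component G a \<noteq> verts G"
    then obtain v where v: "v \<in> verts G" "v \<notin> component G a" using component_subset[of G a] by blast
    have "\<not> adj G u v" if "u \<in> component G a" for u using component_adj[OF G that] v(2) by blast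
    then have "adj ?K b v" "adj ?K v a" "adj ?K a c"
      using v C abc V unfolding adj_complement by (auto simp: adj_commute)
    moreover have "distinct [b, v, a, c]" using v C V abc by auto
    ultimately have "adj ?K b a" using union_of_stars_and_cliques_path(2,1)[OF K UK] by blast
    then show False using abc(1) unfolding adj_complement by (simp add: adj_commute)
  qed
  then have star: "star_on (adj G) (verts G) z" using z by simp
  obtain x y w where co: "w \<in> verts G" "adj G x y" "\<not> adj G x w" "\<not> adj G y w" "w \<noteq> x" "w \<noteq> y"
    using P(2) unfolding has_P3_complement[OF G] induces_coP3_def by blast
  have "x \<in> verts G" "y \<in> verts G" "x \<noteq> y" using simple_graph_adjD[OF G co(2)] by auto
  then show False using star co unfolding star_on_def by auto
qed

section \<open>Perfect products are listed\<close>

text \<open>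
  The right-hand side of the theorem, symmetric in the two graphs.
\<close>

definition listed :: "'a graph \<Rightarrow> 'b graph \<Rightarrow> bool" where
  "listed G H \<longleftrightarrow> (\<exists>m n r s. m \<ge> 1 \<and> n \<ge> 1 \<and> r \<ge> 1 \<and> s \<ge> 1 \<and>
     (perfect_pair G H m n r s \<or> perfect_pair H G m n r s))"

lemma listed_swap: "listed H G \<Longrightarrow> listed G H"
  unfolding listed_def by blast

lemma listedI:
  "perfect_pair G H m n r s \<Longrightarrow> m \<ge> 1 \<Longrightarrow> n \<ge> 1 \<Longrightarrow> r \<ge> 1 \<Longrightarrow> s \<ge> 1 \<Longrightarrow> listed G H"
  unfolding listed_def by blast

lemma listed_at_most_two_vertices:
  assumes G: "simple_graph G" and card: "card (verts G) \<le> 2"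
  shows "listed G H"
proof -
  have "card (verts G) \<noteq> 0" using G unfolding simple_graph_def by simp
  then consider "card (verts G) = 1" | "card (verts G) = 2" using card by linarith
  then have "G \<cong> complete_graph 1 \<or> G \<cong> complete_graph 2 \<or> G \<cong> edgeless_graph 2"
  proof cases
    case 1
    then obtain x where "verts G = {x}" by (rule card_1_singletonE)
    then show ?thesis using 1 iso_complete_graph_iff[OF G, of 1] by (simp add: clique_on_def)
  next
    case 2
    then obtain x y where xy: "verts G = {x, y}" "x \<noteq> y" by (auto simp: card_2_iff)
    show ?thesis
    proof (cases "adj G x y")
      case True
      then show ?thesis using 2 iso_complete_graph_iff[OF G, of 2] xy by (simp add: clique_on_def adj_commute)
    next
      case False
      have "e \<notin> edges G" for e
      proof
        assume e: "e \<in> edges G"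
        then obtain u v where uv: "e = {u, v}" "u \<in> verts G" "v \<in> verts G" "u \<noteq> v"
          using simple_graph_edgesE[OF G] by metis
        then have "e = {x, y}" using xy by auto
        then show False using e False by simp
      qed
      then have "edges G = {}" by blast
      then show ?thesis using 2 iso_edgeless_graph_iff[OF G, of 2] by simp
    qed
  qed
  then have "perfect_pair G H 1 1 1 1" unfolding perfect_pair_def by blast
  then show ?thesis by (rule listedI) simp_all
qed

lemma clique_on_obtain_triangle:
  assumes "clique_on R V" "card V \<ge> 3"
  obtains a b c where "R a b" "R b c" "R a c"
proof -
  obtain D where "D \<subseteq> V" "card D = 3" using assms(2) by (rule obtain_subset_with_card_n)
  then obtain a b c where "D = {a, b, c}" "a \<noteq> b" "b \<noteq> c" "a \<noteq> c" by (auto simp: card_3_iff)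
  then show ?thesis using that[of a b c] assms(1) \<open>D \<subseteq> V\<close> unfolding clique_on_def by auto
qed

context perfect_product
begin

lemma complete_imp_free:
  assumes "clique_on (adj G) (verts G)" "card (verts G) \<ge> 3"
  shows "odd_hole_free H" "\<not> contains_induced H paw"
proof -
  obtain a b c where tri: "adj G a b" "adj G b c" "adj G a c" using clique_on_obtain_triangle[OF assms] .
  show "odd_hole_free H" using triangle_odd_hole_free[OF tri] .
  show "\<not> contains_induced H paw"
    using triangle_paw_free[OF tri] contains_paw_iff[OF simple(2)] by blast
qed

lemma listed_complete:
  assumes "clique_on (adj G) (verts G)" "card (verts G) \<ge> 3"
  shows "listed G H"
proof -
  have "perfect_pair G H 1 (card (verts G)) 1 1"
    unfolding perfect_pair_def
    using complete_imp_free[OF assms] assms(1) iso_complete_graph_iff[OF simple(1)] by blast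
  then show ?thesis by (rule listedI) (use assms(2) in simp_all)
qed

lemma listed_edgeless:
  assumes "edges G = {}" "card (verts G) \<ge> 3"
  shows "listed G H"
proof -
  interpret D: perfect_product "graph_complement G" "graph_complement H"
    using perfect_product_dual perfect_product_axioms by blast
  have "clique_on (adj (graph_complement G)) (verts (graph_complement G))"
    using assms(1) unfolding clique_on_def adj_complement by simp
  then have "odd_hole_free (graph_complement H)" "\<not> contains_induced (graph_complement H) paw"
    using D.complete_imp_free assms(2) by simp_all
  then have "odd_antihole_free H" "\<not> contains_induced H co_paw"
    using odd_hole_free_complement_iff[OF simple(2)] contains_co_paw_iff[OF simple(2)] by auto
  then have "perfect_pair G H 1 (card (verts G)) 1 1"
    unfolding perfect_pair_def using assms(1) iso_edgeless_graph_iff[OF simple(1)] by blast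
  then show ?thesis by (rule listedI) (use assms(2) in simp_all)
qed

text \<open>
  If \<open>H\<close> also contains a path with three vertices, then \<open>factor_class_both\<close> applies, since \<open>G\<close>
  contains that path and its complement. Otherwise \<open>H\<close> is a union of two cliques, and the
  smaller one is a single vertex because two disjoint edges would give a hole of length seven.
\<close>

lemma P4_second_factor:
  assumes P4: "contains_induced G (path_graph 4)" and H: "has_P3 (graph_complement H)"
  shows "H \<cong> path_graph 4 \<or> H \<cong> cycle_graph 5 \<or> (\<exists>r\<ge>2. H \<cong> complete_graph r \<uplus> complete_graph 1)"
proof -
  interpret S: perfect_product H G using perfect_product_swap perfect_product_axioms by blast
  interpret D: perfect_product "graph_complement H" "graph_complement G"
    using perfect_product_dual S.perfect_product_axioms by blast
  obtain a b c d where P: "induces_P4 G a b c d" using P4 contains_P4_iff[OF simple(1)] by blast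
  have GP: "has_P3 G"
    using P induces_P4_distinct(1)[OF simple(1) P] unfolding has_P3_def induces_P4_def by auto
  have "has_P3 (graph_complement G)"
    using induces_P4_complement[OF simple(1) P] induces_P4_distinct(1)[OF simple(1) P]
    unfolding has_P3_def induces_P4_def by auto
  then have L: "in_factor_class H" by (rule S.factor_class)
  have L': "in_factor_class (graph_complement H)"
    using D.factor_class GP graph_complement_complement[OF simple(1)] by simp
  show ?thesis
  proof (cases "has_P3 H")
    case True
    then show ?thesis using factor_class_both[OF simple(2) True H L L'] by blast
  next
    case False
    obtain x y z where co: "induces_coP3 H x y z" using H has_P3_complement[OF simple(2)] by blast
    note two = two_cliques_of_P3_free[OF GP False co]
    let ?X = "component H x" and ?Y = "verts H - component H x"
    have fin: "finite (verts H)" using simple_graph_finite[OF simple(2)] .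
    have zH: "z \<in> ?Y" using co two(4) unfolding induces_coP3_def by simp
    have "?Y = {z}"
    proof (rule ccontr)
      assume "?Y \<noteq> {z}"
      then obtain w where w: "w \<in> ?Y" "w \<noteq> z" using zH by blast
      have V: "x \<in> verts H" "y \<in> verts H" "z \<in> verts H" "w \<in> verts H"
        using two(2,3) zH w component_subset[of H x] by auto
      have xy: "adj H x y" using co unfolding induces_coP3_def by simp
      have "adj H z w" "\<not> adj H x z" "\<not> adj H x w" "\<not> adj H y z" "\<not> adj H y w"
        using bipartition_complement_adj[OF simple(2) two(1)] V two(2,3) zH w by auto
      moreover have "x \<noteq> z" "x \<noteq> w" "y \<noteq> z" "y \<noteq> w" using two(2,3) zH w by auto
      ultimately show False using S.two_edges_P4_free[OF xy _ _ _ _ _ _ _ _ _ P] by blast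
    qed
    then have "card ?Y = 1" by simp
    moreover have "card ?X \<ge> 2"
    proof -
      have "x \<noteq> y" using co simple_graph_adjD(3)[OF simple(2)] unfolding induces_coP3_def by blast
      then have "card {x, y} = 2" by simp
      moreover have "card {x, y} \<le> card ?X"
        using two(2,3) finite_subset[OF component_subset fin] by (intro card_mono) auto
      ultimately show ?thesis by simp
    qed
    ultimately have "H \<cong> complete_graph (card ?X) \<uplus> complete_graph 1"
      using iso_two_cliques_bipartition[OF simple(2), of "card ?X" 1] two(1) by auto
    then show ?thesis using \<open>card ?X \<ge> 2\<close> by blast
  qed
qed

text \<open>
  The five-cycle contains a path with four vertices; moreover, as an odd hole it excludes
  triangles in \<open>H\<close>.
\<close>

lemma C5_second_factor:
  assumes C5: "G \<cong> cycle_graph 5" and H: "has_P3 (graph_complement H)"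
  shows "H \<cong> path_graph 4 \<or> H \<cong> cycle_graph 5 \<or> H \<cong> complete_graph 2 \<uplus> complete_graph 1"
proof -
  interpret S: perfect_product H G using perfect_product_swap perfect_product_axioms by blast
  obtain a b c d e where "induces_C5 G a b c d e" using C5 iso_cycle_5_iff[OF simple(1)] by blast
  then have "contains_induced G (path_graph 4)"
    using contains_P4_iff[OF simple(1)] unfolding induces_C5_def by blast
  then consider "H \<cong> path_graph 4" | "H \<cong> cycle_graph 5"
    | r where "r \<ge> 2" "H \<cong> complete_graph r \<uplus> complete_graph 1"
    using P4_second_factor H by blast
  then show ?thesis
  proof cases
    case 3
    have "r = 2"
    proof (rule ccontr)
      assume "r \<noteq> 2"
      then have r: "r \<ge> 3" "r \<ge> 1" using 3 by auto
      obtain X Y where B: "bipartition (adj (graph_complement H)) (verts H) X Y" "card X = r"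
        using 3(2) iso_two_cliques_bipartition[OF simple(2) r(2) order_refl] by blast
      have "clique_on (adj H) X"
        unfolding clique_on_def
      proof (intro ballI impI)
        fix u v assume uv: "u \<in> X" "v \<in> X" "u \<noteq> v"
        then have "u \<in> verts H" "v \<in> verts H" using B(1) unfolding bipartition_def by auto
        then show "adj H u v" using bipartition_complement_adj[OF simple(2) B(1)] uv by simp
      qed
      then obtain p q t where "adj H p q" "adj H q t" "adj H p t"
        using clique_on_obtain_triangle[of "adj H" X] B(2) r(1) by metis
      then have "odd_hole_free G" by (rule S.triangle_odd_hole_free)
      moreover have "contains_induced G (cycle_graph 5)"
        using C5 unfolding contains_induced_iff_embedding graph_iso_iff_embedding by blast
      moreover have "odd (5 :: nat)" by simp
      ultimately show False unfolding odd_hole_free_def by blast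
    qed
    then show ?thesis using 3 by blast
  qed blast+
qed

text \<open>
  \<open>P4_second_factor\<close> and its dual; the path with four vertices is isomorphic to its complement.
\<close>

lemma listed_P4:
  assumes G: "G \<cong> path_graph 4" and H: "has_P3 H \<or> has_P3 (graph_complement H)"
  shows "listed G H"
proof -
  have P4: "contains_induced G (path_graph 4)"
    using G unfolding contains_induced_iff_embedding graph_iso_iff_embedding by blast
  interpret D: perfect_product "graph_complement G" "graph_complement H"
    using perfect_product_dual perfect_product_axioms by blast
  have "H \<cong> path_graph 4 \<or> H \<cong> cycle_graph 5 \<or>
      (\<exists>r\<ge>1. H \<cong> complete_graph r \<uplus> complete_graph 1 \<or> H \<cong> complete_bipartite_graph 1 r)"
  proof (cases "has_P3 (graph_complement H)")
    case True
    then show ?thesis using P4_second_factor[OF P4 True] by (meson one_le_numeral order_trans)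
  next
    case False
    then have "has_P3 (graph_complement (graph_complement H))"
      using H graph_complement_complement[OF simple(2)] by simp
    moreover have "contains_induced (graph_complement G) (path_graph 4)"
      using P4 contains_P4_iff[OF simple(1)] contains_P4_iff[OF D.simple(1)] induces_P4_complement[OF simple(1)] by blast
    ultimately consider "graph_complement H \<cong> path_graph 4" | "graph_complement H \<cong> cycle_graph 5"
      | r where "r \<ge> 2" "graph_complement H \<cong> complete_graph r \<uplus> complete_graph 1"
      using D.P4_second_factor by blast
    then show ?thesis
    proof cases
      case 1
      then show ?thesis using iso_path_4_complement[OF simple(2)] by blast
    next
      case 2
      then show ?thesis using iso_cycle_5_complement[OF simple(2)] by blast
    next
      case 3
      then have r: "r \<ge> 1" by simp
      obtain X Y where "bipartition (adj H) (verts H) X Y" "card X = r" "card Y = 1"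
        using 3(2) iso_two_cliques_bipartition[OF D.simple(2) r order_refl]
        unfolding graph_complement_complement[OF simple(2)] by auto
      then have "H \<cong> complete_bipartite_graph 1 r"
        using iso_complete_bipartite_iff[OF simple(2) order_refl r] bipartition_swap by blast
      then show ?thesis using r by blast
    qed
  qed
  then obtain r where r: "r \<ge> 1" and *: "H \<cong> path_graph 4 \<or> H \<cong> cycle_graph 5 \<or>
      H \<cong> complete_graph r \<uplus> complete_graph 1 \<or> H \<cong> complete_bipartite_graph 1 r"
    by blast
  from * have "perfect_pair G H 1 1 r 1 \<or> perfect_pair H G 1 1 r 1"
    unfolding perfect_pair_def using G by (elim disjE) simp_all
  then show ?thesis unfolding listed_def using r by blast
qed

lemma listed_C5:
  assumes G: "G \<cong> cycle_graph 5" and H: "has_P3 H \<or> has_P3 (graph_complement H)"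
  shows "listed G H"
proof -
  interpret D: perfect_product "graph_complement G" "graph_complement H"
    using perfect_product_dual perfect_product_axioms by blast
  have K1: "edgeless_graph 1 = complete_graph 1" unfolding edgeless_graph_def complete_graph_def by auto
  have "H \<cong> path_graph 4 \<or> H \<cong> cycle_graph 5 \<or> H \<cong> complete_graph 2 \<uplus> edgeless_graph 1 \<or> H \<cong> path_graph 3"
  proof (cases "has_P3 (graph_complement H)")
    case True
    then show ?thesis using C5_second_factor[OF G True] unfolding K1 by blast
  next
    case False
    then have "has_P3 (graph_complement (graph_complement H))"
      using H graph_complement_complement[OF simple(2)] by simp
    moreover have "graph_complement G \<cong> cycle_graph 5"
      using iso_cycle_5_complement[OF D.simple(1)] G graph_complement_complement[OF simple(1)] by simp
    ultimately consider "graph_complement H \<cong> path_graph 4" | "graph_complement H \<cong> cycle_graph 5"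
      | "graph_complement H \<cong> complete_graph 2 \<uplus> complete_graph 1"
      using D.C5_second_factor by blast
    then show ?thesis
    proof cases
      case 1
      then show ?thesis using iso_path_4_complement[OF simple(2)] by blast
    next
      case 2
      then show ?thesis using iso_cycle_5_complement[OF simple(2)] by blast
    next
      case 3
      obtain X Y where XY: "bipartition (adj H) (verts H) X Y" "card X = 2" "card Y = 1"
        using 3 iso_two_cliques_bipartition[OF D.simple(2), of 2 1]
        unfolding graph_complement_complement[OF simple(2)] by auto
      obtain a c b where ac: "X = {a, c}" "a \<noteq> c" "Y = {b}"
        using XY(2,3) by (metis card_2_iff card_1_singletonE)
      have V: "verts H = {a, b, c}" "a \<noteq> b" "c \<noteq> b" using XY(1) ac unfolding bipartition_def by auto
      then have "adj H a b" "adj H b c" "\<not> adj H a c"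
        using XY(1) ac unfolding bipartition_def by auto
      then show ?thesis using ac(2) V(1) iso_path_3_iff[OF simple(2)] by blast
    qed
  qed
  then have "perfect_pair G H 1 1 1 1" unfolding perfect_pair_def using G by blast
  then show ?thesis by (rule listedI) simp_all
qed

text \<open>
  By \<open>factor_class\<close> and its dual, \<open>G\<close> and the complement of \<open>H\<close> both belong to the factor class.
  If one of them is a path with four vertices or a five-cycle, then the lemmas above apply. A
  complete bipartite \<open>G\<close> goes with two cliques or with the complement of a disconnected union of
  stars and cliques; the case that the complement of \<open>H\<close> is complete bipartite is similar. If
  both are unions of stars and cliques and \<open>G\<close> is disconnected, then \<open>G\<close> also contains an edge
  with an isolated vertex: so either \<open>factor_class_both\<close> applies to \<open>G\<close>, or \<open>H\<close> has no path with
  three vertices and is a union of two cliques.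
\<close>

lemma listed_P3_coP3:
  assumes GP: "has_P3 G" and HQ: "has_P3 (graph_complement H)"
  shows "listed G H"
proof -
  let ?K = "graph_complement H"
  interpret S: perfect_product H G using perfect_product_swap perfect_product_axioms by blast
  interpret D: perfect_product "graph_complement G" ?K
    using perfect_product_dual perfect_product_axioms by blast
  interpret DS: perfect_product ?K "graph_complement G"
    using perfect_product_swap D.perfect_product_axioms by blast
  have L: "in_factor_class G" using factor_class[OF HQ] .
  have LK: "in_factor_class ?K" using DS.factor_class GP graph_complement_complement[OF simple(1)] by simp
  have two: "\<exists>r s. r \<ge> 1 \<and> s \<ge> 1 \<and> H \<cong> complete_graph r \<uplus> complete_graph s"
    if "bipartition (adj ?K) (verts H) X Y" for X Y
    using bipartition_sides_nonempty[OF that simple_graph_finite[OF simple(2)]]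
      iso_two_cliques_bipartition[OF simple(2)] that by blast
  have bip: "listed G H" if B: "bipartition (adj G) (verts G) X Y"
    and K: "union_of_stars_and_cliques ?K \<or> (\<exists>X Y. bipartition (adj ?K) (verts H) X Y)" for X Y
  proof -
    obtain m n where mn: "m \<ge> 1" "n \<ge> 1" "G \<cong> complete_bipartite_graph m n"
      using bipartition_sides_nonempty[OF B simple_graph_finite[OF simple(1)]]
        iso_complete_bipartite_iff[OF simple(1)] B by blast
    have case_two: "listed G H" if B': "bipartition (adj ?K) (verts H) X' Y'" for X' Y'
    proof -
      obtain r s where "r \<ge> 1" "s \<ge> 1" "H \<cong> complete_graph r \<uplus> complete_graph s" using two[OF B'] by blast
      then have "perfect_pair H G m n r s" unfolding perfect_pair_def using mn by blast
      then show ?thesis unfolding listed_def using mn \<open>r \<ge> 1\<close> \<open>s \<ge> 1\<close> by blast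
    qed
    show ?thesis
    proof (cases "\<exists>X Y. bipartition (adj ?K) (verts H) X Y")
      case True
      then show ?thesis using case_two by blast
    next
      case no_bip: False
      then have U: "union_of_stars_and_cliques ?K" using K by blast
      have "connected_graph H"
        unfolding connected_graph_def
      proof (intro ballI)
        fix x y assume xy: "x \<in> verts H" "y \<in> verts H"
        show "(x, y) \<in> reachable H"
        proof (cases "x = y \<or> adj H x y")
          case True
          then show ?thesis using adj_reachable unfolding reachable_def by auto
        next
          case False
          then have K_xy: "adj ?K x y" using xy unfolding adj_complement by blast
          \<comment> \<open>A connected complement of \<open>H\<close> would be a clique or a star, hence complete bipartite or without induced
            paths on three vertices.\<close>
          have "component ?K x \<noteq> verts H"
          proof
            assume all: "component ?K x = verts H"
            have "clique_on (adj ?K) (verts H) \<or> (\<exists>z. star_on (adj ?K) (verts H) z)"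
              using U xy(1) all unfolding union_of_stars_and_cliques_iff[OF D.simple(2)] by fastforce
            moreover have "\<not> clique_on (adj ?K) (verts H)"
            proof
              assume cl: "clique_on (adj ?K) (verts H)"
              obtain u v w where "adj ?K u v" "adj ?K v w" "\<not> adj ?K u w" "u \<noteq> w"
                using HQ unfolding has_P3_def by blast
              then show False using cl unfolding clique_on_def adj_complement by blast
            qed
            ultimately show False
              using star_on_imp_bipartition[of "adj ?K" "verts H"] no_bip by metis
          qed
          then obtain z where z: "z \<in> verts H" "z \<notin> component ?K x"
            using component_subset[of ?K x] by auto
          have "x \<in> component ?K x" using component_self[of x ?K] xy by simp
          moreover have "y \<in> component ?K x" using component_adj[OF D.simple(2) calculation K_xy] .
          ultimately have "\<not> adj ?K x z" "\<not> adj ?K y z" "z \<noteq> x" "z \<noteq> y"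
            using component_adj[OF D.simple(2)] z(2) by blast+
          then have "adj H x z" "adj H z y" using xy z(1) unfolding adj_complement by (auto simp: adj_commute)
          then show ?thesis using adj_reachable reachable_trans by metis
        qed
      qed
      then have "perfect_pair G H m n 1 1"
        unfolding perfect_pair_def
        using mn complement_union_of_stars_and_cliques_free[OF simple(2) U] by blast
      then show ?thesis by (rule listedI) (use mn in simp_all)
    qed
  qed
  consider "G \<cong> path_graph 4" | "G \<cong> cycle_graph 5" | "?K \<cong> path_graph 4" | "?K \<cong> cycle_graph 5"
    | X Y where "bipartition (adj G) (verts G) X Y"
        "union_of_stars_and_cliques ?K \<or> (\<exists>X Y. bipartition (adj ?K) (verts H) X Y)"
    | X Y where "union_of_stars_and_cliques G" "bipartition (adj ?K) (verts H) X Y"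
    | "union_of_stars_and_cliques G" "union_of_stars_and_cliques ?K"
    using L LK unfolding in_factor_class_def verts_complement by blast
  then show ?thesis
  proof cases
    case 1
    then show ?thesis using listed_P4 HQ by blast
  next
    case 2
    then show ?thesis using listed_C5 HQ by blast
  next
    case 3
    then show ?thesis using S.listed_P4[OF iso_path_4_complement[OF simple(2)]] GP listed_swap by blast
  next
    case 4
    then show ?thesis using S.listed_C5[OF iso_cycle_5_complement[OF simple(2)]] GP listed_swap by blast
  next
    case 5
    then show ?thesis by (rule bip)
  next
    case 6
    obtain r s where rs: "r \<ge> 1" "s \<ge> 1" "H \<cong> complete_graph r \<uplus> complete_graph s" using two[OF 6(2)] by blast
    then have "perfect_pair H G 1 1 r s" unfolding perfect_pair_def using 6(1) by blast
    then have "listed H G" by (rule listedI) (use rs in simp_all)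
    then show ?thesis by (rule listed_swap)
  next
    case 7
    obtain a b c where abc: "adj G a b" "adj G b c" "\<not> adj G a c" "a \<noteq> c" using GP unfolding has_P3_def by blast
    have a: "a \<in> verts G" using adjG[OF abc(1)] by blast
    have C: "a \<in> component G a" "b \<in> component G a" "c \<in> component G a"
      using component_self[OF a] component_adj[OF simple(1)] abc(1,2) by blast+
    have ncl: "\<not> clique_on (adj G) (component G a)" using C abc unfolding clique_on_def by blast
    then obtain z where z: "star_on (adj G) (component G a) z"
      using 7(1) a unfolding union_of_stars_and_cliques_iff[OF simple(1)] by blast
    show ?thesis
    proof (cases "component G a = verts G")
      case True
      then show ?thesis using bip[OF star_on_imp_bipartition[OF z ncl, unfolded True]] 7(2) by blast
    next
      case False
      then obtain v where v: "v \<in> verts G" "v \<notin> component G a" using component_subset[of G a] by blast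
      then have "induces_coP3 G a b v"
        using abc(1) C component_adj[OF simple(1)] unfolding induces_coP3_def by blast
      then have GQ: "has_P3 (graph_complement G)" using has_P3_complement[OF simple(1)] by blast
      show ?thesis
      proof (cases "has_P3 H")
        case True
        then have "in_factor_class (graph_complement G)"
          using D.factor_class graph_complement_complement[OF simple(2)] by simp
        then show ?thesis
          using factor_class_both[OF simple(1) GP GQ L] listed_P4 listed_C5 HQ by blast
      next
        case False
        obtain x y w where co: "induces_coP3 H x y w" using HQ has_P3_complement[OF simple(2)] by blast
        obtain r s where rs: "r \<ge> 1" "s \<ge> 1" "H \<cong> complete_graph r \<uplus> complete_graph s"
          using two[OF two_cliques_of_P3_free(1)[OF GP False co]] by blast
        then have "perfect_pair H G 1 1 r s" unfolding perfect_pair_def using 7(1) by blast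
        then have "listed H G" by (rule listedI) (use rs in simp_all)
        then show ?thesis by (rule listed_swap)
      qed
    qed
  qed
qed

end

lemma P3_free_coP3_free_imp_complete_or_edgeless:
  assumes G: "simple_graph G" and no: "\<not> has_P3 G" "\<not> has_P3 (graph_complement G)"
  shows "clique_on (adj G) (verts G) \<or> edges G = {}"
proof (rule ccontr)
  assume contr: "\<not> ?thesis"
  then obtain e where "e \<in> edges G" by blast
  then obtain x y where xy: "adj G x y" "x \<in> verts G" "y \<in> verts G" using simple_graph_edgesE[OF G] by metis
  obtain u v where uv: "u \<in> verts G" "v \<in> verts G" "u \<noteq> v" "\<not> adj G u v"
    using contr unfolding clique_on_def by blast
  have nbr: "w = x \<or> adj G x w" if "w \<in> verts G" for w
  proof (rule ccontr)
    assume w: "\<not> ?thesis"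
    then have "w = y \<or> adj G y w" using no(2) xy that unfolding has_P3_complement[OF G] induces_coP3_def by blast
    then show False using no(1) xy w unfolding has_P3_def by blast
  qed
  have "adj G u x" "adj G x v" using nbr[OF uv(1)] nbr[OF uv(2)] uv(3,4) by (auto simp: adj_commute)
  then show False using no(1) uv unfolding has_P3_def by blast
qed

text \<open>
  Graphs with at most two vertices and complete or edgeless ones are settled directly. Otherwise
  each factor contains the path with three vertices or its complement. Either one factor
  contains the path and the other its complement, or all contained ones are of the same kind.
\<close>

lemma perfect_product_imp_listed:
  assumes "simple_graph G" "simple_graph H" "perfect (G \<nabla> H)"
  shows "listed G H"
proof -
  interpret perfect_product G H using assms by (simp add: perfect_product_def)
  interpret S: perfect_product H G using perfect_product_swap perfect_product_axioms by blast
  show ?thesis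
  proof (cases "card (verts G) \<le> 2 \<or> card (verts H) \<le> 2")
    case True
    then show ?thesis using listed_at_most_two_vertices[OF simple(1)] listed_at_most_two_vertices[OF simple(2)] listed_swap by blast
  next
    case False
    then have card: "card (verts G) \<ge> 3" "card (verts H) \<ge> 3" by auto
    show ?thesis
    proof (cases "clique_on (adj G) (verts G) \<or> edges G = {} \<or> clique_on (adj H) (verts H) \<or> edges H = {}")
      case True
      then show ?thesis
        using listed_complete listed_edgeless S.listed_complete S.listed_edgeless card listed_swap by blast
    next
      case False
      then have PQ: "has_P3 G \<or> has_P3 (graph_complement G)" "has_P3 H \<or> has_P3 (graph_complement H)"
        and edges: "edges G \<noteq> {}" "edges H \<noteq> {}"
        using P3_free_coP3_free_imp_complete_or_edgeless[OF simple(1)] P3_free_coP3_free_imp_complete_or_edgeless[OF simple(2)] by blast+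
      consider "has_P3 G" "has_P3 (graph_complement H)" | "has_P3 H" "has_P3 (graph_complement G)"
        | "\<not> has_P3 G" "\<not> has_P3 H" | "\<not> has_P3 (graph_complement G)" "\<not> has_P3 (graph_complement H)"
        using PQ by blast
      then show ?thesis
      proof cases
        case 1
        then show ?thesis by (rule listed_P3_coP3)
      next
        case 2
        then show ?thesis using S.listed_P3_coP3 listed_swap by blast
      next
        case 3
        then have "union_of_cliques G" "union_of_cliques H" by (simp_all add: union_of_cliques_iff simple)
        then have "perfect_pair G H 1 1 1 1" unfolding perfect_pair_def by simp
        then show ?thesis by (rule listedI) simp_all
      next
        case 4
        then have "complete_multipartite G" "complete_multipartite H"
          using complete_multipartiteI[OF simple(1)] complete_multipartiteI[OF simple(2)] edges by simp_all
        then have "perfect_pair G H 1 1 1 1" unfolding perfect_pair_def by simp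
        then show ?thesis by (rule listedI) simp_all
      qed
    qed
  qed
qed

theorem theorem1:
  fixes G0 :: "'a graph" and G1 :: "'b graph"
  assumes "simple_graph G0" and "simple_graph G1"
  shows "perfect (G0 \<nabla> G1) \<longleftrightarrow>
    (\<exists>m n r s :: nat. m \<ge> 1 \<and> n \<ge> 1 \<and> r \<ge> 1 \<and> s \<ge> 1 \<and>
      (perfect_pair G0 G1 m n r s \<or> perfect_pair G1 G0 m n r s))"
proof
  assume "perfect (G0 \<nabla> G1)"
  with assms show "\<exists>m n r s :: nat. m \<ge> 1 \<and> n \<ge> 1 \<and> r \<ge> 1 \<and> s \<ge> 1 \<and>
      (perfect_pair G0 G1 m n r s \<or> perfect_pair G1 G0 m n r s)"
    by (rule perfect_product_imp_listed[unfolded listed_def])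
next
  assume "\<exists>m n r s :: nat. m \<ge> 1 \<and> n \<ge> 1 \<and> r \<ge> 1 \<and> s \<ge> 1 \<and>
      (perfect_pair G0 G1 m n r s \<or> perfect_pair G1 G0 m n r s)"
  then obtain m n r s :: nat where *: "m \<ge> 1" "n \<ge> 1" "r \<ge> 1" "s \<ge> 1"
    and "perfect_pair G0 G1 m n r s \<or> perfect_pair G1 G0 m n r s"
    by blast
  then show "perfect (G0 \<nabla> G1)"
    using perfect_pair_imp_perfect_product[OF assms *]
      perfect_pair_imp_perfect_product[OF assms(2,1) *] perfect_product_commute[OF assms] by blast
qed

end
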